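(* Let $n\ge3$, $2<p\le2^*=\frac{2n}{n-2}$, $0\le\theta<1/2$ and $\alpha_n=e^{\frac{n-3}{n-2}}$. For any $0<\alpha\le\alpha_n$ and any $u\in C_c^\infty(B_1)$ there holds $$\int_{B_1}|\nabla u|^2dx-\Big(\frac{n-2}{2}\Big)^2\int_{B_1}\frac{u^2}{|x|^2}dx-\theta(1-\theta)\int_{B_1}\frac{u^2}{|x|^2}X(\alpha|x|)^2dx\ \ge\ \Big(\frac{1-2\theta}{n-2}\Big)^{\frac{p+2}{p}}S_{n,p}\Big(\int_{B_1}|x|^{\frac{p(n-2)}{2}-n}X(\alpha|x|)^{\frac{p+2}{2}}|u|^pdx\Big)^{2/p}.$$ Moreover the constant $\big(\frac{1-2\theta}{n-2}\big)^{\frac{p+2}{p}}S_{n,p}$ is sharp for any choice of the parameters.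
   Context: $B_1$ is the open unit ball of $\mathbb{R}^n$ centered at $0$. $X(t)=\frac{1}{1-\ln t}$ for $t\in(0,e)$. Functions are real-valued. $S_{n,p}$ denotes the best (largest) constant in the inequality $\int_{\mathbb{R}^n}|\nabla u|^2dx\ge S_{n,p}\big(\int_{\mathbb{R}^n}|x|^{\frac{p(n-2)}{2}-n}|u|^pdx\big)^{2/p}$ for all $u\in C_c^\infty(\mathbb{R}^n)$. "Sharp" means that the constant cannot be replaced by a larger one. *)

theory Defs
  imports "HOL-Analysis.Analysis"
begin

definition partial_deriv :: "'n::finite \<Rightarrow> (real^'n \<Rightarrow> real) \<Rightarrow> real^'n \<Rightarrow> real"
  where "partial_deriv i f x = frechet_derivative f (at x) (axis i 1)"

definition grad :: "(real^'n::finite \<Rightarrow> real) \<Rightarrow> real^'n \<Rightarrow> real^'n"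
  where "grad f x = (\<chi> i. partial_deriv i f x)"

primrec k_times_cont_diff :: "nat \<Rightarrow> (real^'n::finite \<Rightarrow> real) \<Rightarrow> bool" where
  "k_times_cont_diff 0 f \<longleftrightarrow> continuous_on UNIV f"
| "k_times_cont_diff (Suc k) f \<longleftrightarrow>
     f differentiable_on UNIV \<and> (\<forall>i. k_times_cont_diff k (partial_deriv i f))"

text \<open>The space of smooth functions with compact support in the open set \<open>U\<close>;
  its elements are regarded as functions on the whole space, vanishing outside \<open>U\<close>.\<close>

definition Cc_infinity :: "(real^'n::finite) set \<Rightarrow> (real^'n \<Rightarrow> real) set"
  where "Cc_infinity U =
    {u. (\<forall>k. k_times_cont_diff k u) \<and>
        compact (closure {x. u x \<noteq> 0}) \<and> closure {x. u x \<noteq> 0} \<subseteq> U}"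

text \<open>Only the values on the interval from \<open>0\<close> to \<open>exp 1\<close> (both excluded) are relevant.\<close>

definition X_log :: "real \<Rightarrow> real"
  where "X_log t = 1 / (1 - ln t)"

text \<open>The best constant, for the dimension \<open>CARD('n)\<close>, as the supremum of all admissible
  constants. The admissible constants form a closed set containing \<open>0\<close> and bounded above
  (for \<open>CARD('n) > 2\<close> and \<open>p > 2\<close>), so the supremum is the largest one. The convention
  \<open>0 powr a = 0\<close> affects the integrand only at the origin.\<close>

definition best_const :: "'n::finite itself \<Rightarrow> real \<Rightarrow> real"
  where "best_const _ p = Sup {C. \<forall>u \<in> Cc_infinity (UNIV :: (real^'n) set).
    (LINT x|lborel. (norm (grad u x))\<^sup>2) \<ge>
      C * (LINT x|lborel. norm x powr (p * (real CARD('n) - 2) / 2 - real CARD('n))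
                           * \<bar>u x\<bar> powr p) powr (2 / p)}"

definition hardy_remainder :: "real \<Rightarrow> real \<Rightarrow> (real^'n::finite \<Rightarrow> real) \<Rightarrow> real"
  where "hardy_remainder \<theta> \<alpha> u =
    (LINT x:ball 0 1|lborel. (norm (grad u x))\<^sup>2)
    - ((real CARD('n) - 2) / 2)\<^sup>2 * (LINT x:ball 0 1|lborel. (u x)\<^sup>2 / (norm x)\<^sup>2)
    - \<theta> * (1 - \<theta>) * (LINT x:ball 0 1|lborel. (u x)\<^sup>2 / (norm x)\<^sup>2 * (X_log (\<alpha> * norm x))\<^sup>2)"

definition weighted_p_integral :: "real \<Rightarrow> real \<Rightarrow> (real^'n::finite \<Rightarrow> real) \<Rightarrow> real"
  where "weighted_p_integral p \<alpha> u =
    (LINT x:ball 0 1|lborel. norm x powr (p * (real CARD('n) - 2) / 2 - real CARD('n))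
       * X_log (\<alpha> * norm x) powr ((p + 2) / 2) * \<bar>u x\<bar> powr p)"

end

theory Submission
  imports Defs "HOL-Complex_Analysis.Great_Picard" "HOL-Real_Asymp.Real_Asymp"
begin

text \<open>
  Conjugating with the ground state \<open>r powr (- (n - 2) / 2) * (1 - ln (\<alpha> * r)) powr \<theta>\<close> and substituting
  \<open>\<rho> = (1 - ln (\<alpha> * r)) powr (- (1 - 2 * \<theta>) / (n - 2))\<close> in the radial variable turns the left-hand side into
  \<open>(1 - 2 * \<theta>) / (n - 2)\<close> times a Dirichlet integral on the whole space whose radial part is the standard one
  and whose angular part is at least the standard one; the upper bound on \<open>\<alpha>\<close> is what the angular part needs.
  The weighted integral becomes the one in the definition of the best constant. This gives the inequality, and
  for radial functions everything is an equality. Sharpness follows since the best constant is approached by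
  radial functions, which can be taken to vanish near the origin and to have small support.

  The radial reduction avoids rearrangements
      and the isoperimetric inequality. Among all functions with a given
  Lipschitz bound and support that do not increase the nonlocal difference quotient energies
      and do not decrease the
  weighted integral, one minimizes the second moment (Arzela-Ascoli). Reflecting in a hyperplane
      and moving the
  larger values to the side of the origin (polarization) keeps the constraints and decreases the second
  moment strictly unless the function already has the larger values on that side, so the minimizer is radial.
\<close>

section \<open>Continuously differentiable functions\<close>

text \<open>Regularity shapes the proof. The substitution is singular at the origin and maps the
  unit ball only onto a ball of radius \<open>\<phi> 1\<close>, so it is applied to
  \<open>C^1\<close> functions vanishing near the origin and near the boundary. Removing a
  neighbourhood of the origin costs nothing in the limit: the cutoffs have gradients of order
  \<open>1 / norm x\<close>, whose squares are locally integrable for n \<ge> 3. With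
  \<open>a = (1 - 2 * \<theta>) / (n - 2)\<close>, the substitution is tuned so that both the
  gradient weight and the power weight equal \<open>a\<close>, respectively \<open>1 / a\<close>,
  times what the Jacobian needs. The Dirichlet integral contributes \<open>a\<close> and the
  weighted integral \<open>a powr (2 / p)\<close>, which explains the power
  \<open>(p + 2) / p\<close> in the constant. The radial stretching is
  \<open>a / (1 - ln (\<alpha> * r))\<close> times the tangential one; for
  \<open>\<theta> = 0\<close> this is at most 1 on the whole ball exactly when \<alpha> obeys the
  stated bound. Polarization and limits leave the class \<open>C^1\<close>: the minimizer is only
  Lipschitz. Difference quotient energies survive polarization, limits (Fatou) and mollification
  (convexity), and give back the Dirichlet integral for small steps.\<close>

definition C1_on :: "'a::euclidean_space set \<Rightarrow> ('a \<Rightarrow> 'b::real_normed_vector) \<Rightarrow> bool"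
  where "C1_on S f \<longleftrightarrow> (\<forall>x\<in>S. f differentiable (at x)) \<and>
    (\<forall>h. continuous_on S (\<lambda>x. frechet_derivative f (at x) h))"

lemma C1_onI:
  assumes "\<And>x. x \<in> S \<Longrightarrow> (f has_derivative f' x) (at x)" "\<And>h. continuous_on S (\<lambda>x. f' x h)"
  shows "C1_on S f"
proof -
  have "continuous_on S (\<lambda>x. frechet_derivative f (at x) h)" for h
    by (subst continuous_on_cong[OF refl, of _ _ "\<lambda>x. f' x h"])
       (use assms in \<open>auto simp: frechet_derivative_at[OF assms(1), symmetric]\<close>)
  then show ?thesis
    using assms(1) by (auto simp: C1_on_def differentiable_def)
qed

lemma C1_on_derivative:
  assumes "C1_on S f" "x \<in> S"
  shows "(f has_derivative frechet_derivative f (at x)) (at x)"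
  using assms by (auto simp: C1_on_def frechet_derivative_works)

lemma C1_on_imp_continuous_on: "C1_on S f \<Longrightarrow> continuous_on S f"
  by (meson C1_on_def continuous_at_imp_continuous_on differentiable_imp_continuous_within)

lemma C1_on_subset: "C1_on S f \<Longrightarrow> T \<subseteq> S \<Longrightarrow> C1_on T f"
  unfolding C1_on_def by (meson continuous_on_subset subsetD)

lemma C1_on_Un:
  assumes "C1_on S f" "C1_on T f" "open S" "open T"
  shows "C1_on (S \<union> T) f"
  using assms by (auto simp: C1_on_def intro!: continuous_on_open_Un)

lemma C1_on_cong:
  assumes "C1_on S f" "open S" "\<And>x. x \<in> S \<Longrightarrow> f x = g x"
  shows "C1_on S g"
proof (rule C1_onI)
  show "(g has_derivative frechet_derivative f (at x)) (at x)" if "x \<in> S" for x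
    using has_derivative_transform_within_open[OF C1_on_derivative[OF assms(1) that] assms(2) that]
      assms(3) by auto
  show "continuous_on S (\<lambda>x. frechet_derivative f (at x) h)" for h
    using assms(1) by (auto simp: C1_on_def)
qed

lemma C1_on_const: "C1_on S (\<lambda>x. c)"
  by (rule C1_onI[of _ _ "\<lambda>x h. 0"]) auto

lemma C1_on_ident: "C1_on S (\<lambda>x. x)"
  by (rule C1_onI[of _ _ "\<lambda>x h. h"]) auto

lemma C1_on_bounded_bilinear:
  assumes "bounded_bilinear B" "C1_on S f" "C1_on S g"
  shows "C1_on S (\<lambda>x. B (f x) (g x))"
proof (rule C1_onI)
  fix x assume "x \<in> S"
  show "((\<lambda>x. B (f x) (g x)) has_derivative
     (\<lambda>h. B (f x) (frechet_derivative g (at x) h) + B (frechet_derivative f (at x) h) (g x))) (at x)"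
    by (intro bounded_bilinear.FDERIV[OF assms(1)] C1_on_derivative[OF assms(2) \<open>x \<in> S\<close>]
        C1_on_derivative[OF assms(3) \<open>x \<in> S\<close>])
next
  fix h
  show "continuous_on S (\<lambda>x. B (f x) (frechet_derivative g (at x) h)
      + B (frechet_derivative f (at x) h) (g x))"
    using assms(2,3) C1_on_imp_continuous_on[OF assms(2)] C1_on_imp_continuous_on[OF assms(3)]
    by (intro continuous_on_add bounded_bilinear.continuous_on[OF assms(1)]) (auto simp: C1_on_def)
qed

lemmas C1_on_scaleR = C1_on_bounded_bilinear[OF bounded_bilinear_scaleR]
lemmas C1_on_mult = C1_on_bounded_bilinear[OF bounded_bilinear_mult[where 'a=real]]
lemmas C1_on_inner = C1_on_bounded_bilinear[OF bounded_bilinear_inner]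

lemma C1_on_compose:
  fixes f :: "'a::euclidean_space \<Rightarrow> 'b::euclidean_space"
  assumes f: "C1_on S f" and g: "C1_on T g" and sub: "\<And>x. x \<in> S \<Longrightarrow> f x \<in> T"
  shows "C1_on S (\<lambda>x. g (f x))"
proof (rule C1_onI)
  fix x assume "x \<in> S"
  show "((\<lambda>x. g (f x)) has_derivative
     (\<lambda>h. frechet_derivative g (at (f x)) (frechet_derivative f (at x) h))) (at x)"
    by (rule has_derivative_compose[OF C1_on_derivative[OF f \<open>x \<in> S\<close>] C1_on_derivative[OF g sub[OF \<open>x \<in> S\<close>]]])
next
  fix h
  \<comment> \<open>\<open>C1_on\<close> provides continuity for a fixed direction only, while the
    chain rule inserts a direction that moves with x. Expansion in the basis reduces this to
    finitely many fixed directions.\<close>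
  have eq: "frechet_derivative g (at (f x)) v = (\<Sum>b\<in>Basis. (v \<bullet> b) *\<^sub>R frechet_derivative g (at (f x)) b)"
    if "x \<in> S" for x v
  proof -
    interpret linear "frechet_derivative g (at (f x))"
      using C1_on_derivative[OF g sub[OF that]] has_derivative_linear by blast
    show ?thesis
      by (subst euclidean_representation[symmetric, of v]) (simp add: sum scaleR)
  qed
  have "continuous_on S (\<lambda>x. frechet_derivative g (at (f x)) b)" for b
  proof -
    have "continuous_on T (\<lambda>y. frechet_derivative g (at y) b)"
      using g by (auto simp: C1_on_def)
    from continuous_on_compose2[OF this C1_on_imp_continuous_on[OF f]] sub
    show ?thesis by auto
  qed
  then have "continuous_on S (\<lambda>x. \<Sum>b\<in>Basis. (frechet_derivative f (at x) h \<bullet> b) *\<^sub>R frechet_derivative g (at (f x)) b)"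
    using f by (intro continuous_intros) (auto simp: C1_on_def)
  then show "continuous_on S (\<lambda>x. frechet_derivative g (at (f x)) (frechet_derivative f (at x) h))"
    by (subst continuous_on_cong[OF refl eq]) auto
qed

lemma C1_on_real:
  fixes f :: "real \<Rightarrow> real"
  assumes "\<And>t. t \<in> T \<Longrightarrow> (f has_real_derivative f' t) (at t)" "continuous_on T f'"
  shows "C1_on T f"
  by (rule C1_onI[of _ _ "\<lambda>t h. f' t * h"])
     (use assms in \<open>auto simp: has_field_derivative_def intro!: continuous_intros\<close>)

lemma C1_on_inverse_real: "0 \<notin> T \<Longrightarrow> C1_on T (inverse :: real \<Rightarrow> real)"
  by (rule C1_on_real[of _ _ "\<lambda>r. - inverse (r\<^sup>2)"])
     (auto intro!: derivative_eq_intros continuous_intros simp: power2_eq_square)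

lemma has_derivative_norm_inner:
  fixes x :: "'a::euclidean_space"
  assumes "x \<noteq> 0"
  shows "(norm has_derivative (\<lambda>h. (x \<bullet> h) / norm x)) (at x)"
  using has_derivative_norm[OF assms]
  by (simp add: sgn_div_norm inner_commute divide_inverse mult.commute)

lemma norm_axis: "norm (axis k c :: real^'n) = \<bar>c\<bar>"
proof -
  have "axis k c = c *\<^sub>R (axis k 1 :: real^'n)"
    by (simp add: axis_def vec_eq_iff)
  then show ?thesis by simp
qed

lemma linear_borel_measurable:
  fixes f :: "'a::euclidean_space \<Rightarrow> 'b::euclidean_space"
  shows "linear f \<Longrightarrow> f \<in> borel_measurable borel"
  by (intro borel_measurable_continuous_onI linear_continuous_on linear_conv_bounded_linear[THEN iffD1])

lemma C1_on_norm:
  fixes S :: "'a::euclidean_space set"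
  assumes "0 \<notin> S"
  shows "C1_on S norm"
proof -
  have "C1_on S (\<lambda>x. x \<bullet> x)"
    by (intro C1_on_inner C1_on_ident)
  moreover have "C1_on {0<..} sqrt"
    by (rule C1_on_real[of _ _ "\<lambda>t. inverse (sqrt t) / 2"])
       (auto intro!: continuous_intros DERIV_real_sqrt)
  ultimately have "C1_on S (\<lambda>x. sqrt (x \<bullet> x))"
    by (rule C1_on_compose) (use assms in auto)
  then show ?thesis
    by (simp add: norm_eq_sqrt_inner[abs_def])
qed

section \<open>Gradients\<close>

lemma grad_eqI:
  fixes f :: "real^'n \<Rightarrow> real"
  assumes "(f has_derivative (\<lambda>h. g \<bullet> h)) (at x)"
  shows "grad f x = g"
proof -
  have "frechet_derivative f (at x) = (\<lambda>h. g \<bullet> h)"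
    using frechet_derivative_at[OF assms] by simp
  then show ?thesis
    by (simp add: grad_def partial_deriv_def vec_eq_iff inner_axis)
qed

lemma has_derivative_grad:
  fixes f :: "real^'n \<Rightarrow> real"
  assumes "f differentiable (at x)"
  shows "(f has_derivative (\<lambda>h. grad f x \<bullet> h)) (at x)"
proof -
  let ?D = "frechet_derivative f (at x)"
  have D: "(f has_derivative ?D) (at x)"
    using assms frechet_derivative_works by blast
  then interpret linear ?D by (rule has_derivative_linear)
  have "?D h = grad f x \<bullet> h" for h
  proof -
    have "?D h = (\<Sum>i\<in>UNIV. (h $ i) * ?D (axis i 1))"
      by (subst basis_expansion[of h, symmetric]) (simp add: sum scaleR scalar_mult_eq_scaleR)
    also have "\<dots> = grad f x \<bullet> h"
      by (simp add: grad_def partial_deriv_def inner_vec_def mult.commute)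
    finally show ?thesis .
  qed
  then show ?thesis using D by (metis (no_types, lifting) ext)
qed

lemma C1_on_has_derivative_grad:
  fixes f :: "real^'n \<Rightarrow> real"
  shows "C1_on S f \<Longrightarrow> x \<in> S \<Longrightarrow> (f has_derivative (\<lambda>h. grad f x \<bullet> h)) (at x)"
  by (auto simp: C1_on_def intro: has_derivative_grad)

lemma C1_on_imp_continuous_on_grad:
  fixes f :: "real^'n \<Rightarrow> real"
  shows "C1_on S f \<Longrightarrow> continuous_on S (grad f)"
  unfolding C1_on_def grad_def[abs_def] partial_deriv_def by (intro continuous_on_vec_lambda) auto

lemma grad_cong:
  fixes f :: "real^'n \<Rightarrow> real"
  assumes "open S" "x \<in> S" "\<And>y. y \<in> S \<Longrightarrow> f y = g y" "f differentiable (at x)"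
  shows "grad f x = grad g x"
  using has_derivative_transform_within_open[OF has_derivative_grad[OF assms(4)] assms(1,2)] assms(3)
  by (metis grad_eqI)

lemma grad_eq_0:
  fixes f :: "real^'n \<Rightarrow> real"
  assumes "open S" "x \<in> S" "\<And>y. y \<in> S \<Longrightarrow> f y = 0"
  shows "grad f x = 0"
proof (rule grad_eqI)
  have "((\<lambda>y. 0) has_derivative (\<lambda>h. 0 \<bullet> h)) (at x)" by simp
  from has_derivative_transform_within_open[OF this assms(1,2)] assms(3)
  show "(f has_derivative (\<lambda>h. 0 \<bullet> h)) (at x)" by simp
qed

lemma grad_eq_0_outside_cball:
  fixes f :: "real^'n \<Rightarrow> real"
  assumes "\<And>y. norm y > R \<Longrightarrow> f y = 0" "norm x > R"
  shows "grad f x = 0"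
  by (rule grad_eq_0[of "- cball 0 R"]) (use assms in auto)

lemma grad_mult:
  fixes f g :: "real^'n \<Rightarrow> real"
  assumes "f differentiable (at x)" "g differentiable (at x)"
  shows "grad (\<lambda>x. f x * g x) x = f x *\<^sub>R grad g x + g x *\<^sub>R grad f x"
  by (rule grad_eqI) (auto intro!: derivative_eq_intros has_derivative_grad assms simp: inner_add_left algebra_simps)

section \<open>Integrals of continuous functions with compact support\<close>

lemma integrable_continuous_compact_support:
  fixes f :: "'a::euclidean_space \<Rightarrow> 'b::{banach,second_countable_topology}"
  assumes "continuous_on UNIV f" "\<And>x. norm x > R \<Longrightarrow> f x = 0"
  shows "integrable lborel f"
proof -
  have "integrable lborel (\<lambda>x. indicator (cball 0 R) x *\<^sub>R f x)"
    by (rule borel_integrable_compact) (auto intro: continuous_on_subset[OF assms(1)])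
  moreover have "(\<lambda>x. indicator (cball 0 R) x *\<^sub>R f x) = f"
    using assms(2) by (auto simp: indicator_def fun_eq_iff)
  ultimately show ?thesis by simp
qed

lemma bounded_continuous_compact_support:
  fixes f :: "'a::euclidean_space \<Rightarrow> 'b::real_normed_vector"
  assumes "continuous_on UNIV f" "\<And>x. norm x > R \<Longrightarrow> f x = 0"
  obtains M where "M > 0" "\<And>x. norm (f x) \<le> M"
proof -
  have "compact (f ` cball 0 R)"
    by (intro compact_continuous_image continuous_on_subset[OF assms(1)]) auto
  then obtain M where M: "M > 0" "\<And>y. y \<in> f ` cball 0 R \<Longrightarrow> norm y \<le> M"
    using compact_imp_bounded bounded_pos by metis
  have "norm (f x) \<le> M" for x
    using M assms(2)[of x] by (cases "norm x \<le> R") auto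
  then show ?thesis using that M(1) by blast
qed

lemma uniformly_continuous_compact_support:
  fixes f :: "'a::euclidean_space \<Rightarrow> 'b::real_normed_vector"
  assumes "continuous_on UNIV f" "\<And>x. norm x > R \<Longrightarrow> f x = 0" "e > 0"
  obtains d where "d > 0" "\<And>x y. dist x y < d \<Longrightarrow> dist (f x) (f y) < e"
proof -
  have "uniformly_continuous_on (cball 0 (R+1)) f"
    by (intro compact_uniformly_continuous continuous_on_subset[OF assms(1)]) auto
  then obtain d where d: "d > 0"
      "\<And>x y. x \<in> cball 0 (R+1) \<Longrightarrow> y \<in> cball 0 (R+1) \<Longrightarrow> dist x y < d \<Longrightarrow> dist (f x) (f y) < e"
    unfolding uniformly_continuous_on_def using \<open>e > 0\<close> by (metis dist_commute)
  have "dist (f x) (f y) < e" if "dist x y < min d 1" for x y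
  proof (cases "x \<in> cball 0 (R+1) \<and> y \<in> cball 0 (R+1)")
    case False
    have "norm x \<le> norm y + dist x y" "norm y \<le> norm x + dist x y"
      by (metis add.commute dist_norm norm_triangle_sub,
          metis add.commute dist_norm norm_triangle_sub dist_commute)
    then have "norm x > R" "norm y > R"
      using False that by auto
    then show ?thesis using assms by simp
  qed (use d that in auto)
  then show ?thesis using that[of "min d 1"] d by auto
qed

text \<open>Uniform continuity of the gradient makes the error in the mean value inequality
  independent of x. This is what differentiation under the integral sign needs in
  \<open>has_derivative_convol\<close>.\<close>

lemma C1_uniform_derivative:
  fixes f :: "real^'n \<Rightarrow> real"
  assumes "C1_on UNIV f" "\<And>x. norm x > R \<Longrightarrow> f x = 0" "e > 0"
  obtains d where "d > 0" "\<And>x h. norm h < d \<Longrightarrow> \<bar>f (x + h) - f x - grad f x \<bullet> h\<bar> \<le> e * norm h"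
proof -
  have "grad f x = 0" if "norm x > R" for x
    using grad_eq_0_outside_cball[OF assms(2) that] .
  from uniformly_continuous_compact_support[OF C1_on_imp_continuous_on_grad[OF assms(1)] this \<open>e > 0\<close>]
  obtain d where d: "d > 0" "\<And>x y. dist x y < d \<Longrightarrow> dist (grad f x) (grad f y) < e"
    by blast
  have "\<bar>f (x + h) - f x - grad f x \<bullet> h\<bar> \<le> e * norm h" if h: "norm h < d" for x h
  proof -
    have "norm (f (x + h) - f x - (\<lambda>h. grad f x \<bullet> h) ((x + h) - x)) \<le> norm ((x + h) - x) * e"
    proof (rule differentiable_bound_linearization[where S = "ball x d" and f' = "\<lambda>x h. grad f x \<bullet> h"])
      show "x + t *\<^sub>R (x + h - x) \<in> ball x d" if "t \<in> {0..1}" for t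
      proof -
        have "norm (t *\<^sub>R h) \<le> norm h" using that by (simp add: mult_left_le_one_le)
        then show ?thesis using h by (simp add: dist_norm)
      qed
      show "(f has_derivative (\<lambda>h. grad f y \<bullet> h)) (at y within ball x d)" for y
        using C1_on_has_derivative_grad[OF assms(1), of y] has_derivative_at_withinI by blast
      show "onorm ((\<lambda>i. grad f y \<bullet> i) - (\<lambda>i. grad f x \<bullet> i)) \<le> e" if "y \<in> ball x d" for y
      proof (rule onorm_bound)
        fix i
        have "norm (grad f y - grad f x) \<le> e"
          using d(2)[of y x] that by (simp add: dist_norm norm_minus_commute)
        then show "norm (((\<lambda>i. grad f y \<bullet> i) - (\<lambda>i. grad f x \<bullet> i)) i) \<le> e * norm i"
          unfolding minus_apply
              by (metis Cauchy_Schwarz_ineq2 inner_diff_left mult_right_mono norm_ge_zero order_trans real_norm_def)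
      qed (use assms in auto)
      show "x \<in> ball x d" using d by simp
    qed
    then show ?thesis by (simp add: mult.commute)
  qed
  then show ?thesis using that d(1) by blast
qed

lemma integral_lborel_reflect:
  fixes f :: "'a::euclidean_space \<Rightarrow> 'b::{banach,second_countable_topology}"
  assumes "f \<in> borel_measurable borel"
  shows "(LINT y|lborel. f y) = (LINT z|lborel. f (x - z))"
proof -
  have "lborel = density (distr lborel borel (\<lambda>z::'a. x + (-1) *\<^sub>R z)) (\<lambda>_. \<bar>-1::real\<bar>^DIM('a))"
    by (rule lborel_affine) auto
  then have "lborel = distr lborel borel (\<lambda>z::'a. x - z)"
    by (simp add: density_1)
  then have "(LINT y|lborel. f y) = (LINT y|distr lborel borel (\<lambda>z::'a. x - z). f y)"
    by simp
  also have "\<dots> = (LINT z|lborel. f (x - z))"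
    using assms by (subst integral_distr) auto
  finally show ?thesis .
qed

lemma nn_integral_lborel_translation:
  fixes f :: "'a::euclidean_space \<Rightarrow> ennreal"
  assumes "f \<in> borel_measurable borel"
  shows "(\<integral>\<^sup>+y. f (x + y) \<partial>lborel) = (\<integral>\<^sup>+y. f y \<partial>lborel)"
proof -
  have "(\<integral>\<^sup>+y. f y \<partial>lborel) = (\<integral>\<^sup>+y. f y \<partial>(distr lborel borel ((+) x)))"
    by (simp add: lborel_distr_plus)
  also have "\<dots> = (\<integral>\<^sup>+y. f (x + y) \<partial>lborel)"
    using assms by (subst nn_integral_distr) auto
  finally show ?thesis by simp
qed

section \<open>Smooth bump functions and mollification\<close>

text \<open>Differentiating \<open>exp (- 1 / t)\<close> produces negative powers of t; with these
  included, the derivative of each member is a combination of members.\<close>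

definition flat :: "nat \<Rightarrow> real \<Rightarrow> real"
  where "flat m t = (if t > 0 then exp (- 1 / t) / t ^ m else 0)"

lemma flat_nonneg: "flat m t \<ge> 0"
  by (simp add: flat_def)

lemma has_real_derivative_flat:
  "(flat m has_real_derivative (flat (m + 2) t - real m * flat (m + 1) t)) (at t)"
proof -
  consider "t < 0" | "t = 0" | "t > 0" by linarith
  then show ?thesis
  proof cases
    case 1
    have "((\<lambda>t. 0::real) has_real_derivative 0) (at t)" by simp
    from has_field_derivative_transform_within_open[OF this, of "{..<0}" "flat m"] 1
    show ?thesis by (auto simp: flat_def)
  next
    case 2
    \<comment> \<open>The difference quotient at 0 vanishes on the left and tends to 0 on the right,
      because the exponential beats every power.\<close>
    have lim: "((\<lambda>h. flat m h / h) \<longlongrightarrow> 0) (at 0)"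
    proof (rule filterlim_split_at)
      have "\<forall>\<^sub>F h in at_left 0. 0 = flat m h / h"
        unfolding eventually_at_filter flat_def by (auto intro!: always_eventually)
      then show "((\<lambda>h. flat m h / h) \<longlongrightarrow> 0) (at_left 0)"
        by (rule Lim_transform_eventually[OF tendsto_const])
      have "((\<lambda>h::real. exp (- 1 / h) / h ^ m / h) \<longlongrightarrow> 0) (at_right 0)"
        by real_asymp
      moreover have "\<forall>\<^sub>F h in at_right 0. exp (- 1 / h) / h ^ m / h = flat m h / h"
        unfolding eventually_at_filter flat_def by (auto intro!: always_eventually)
      ultimately show "((\<lambda>h. flat m h / h) \<longlongrightarrow> 0) (at_right 0)"
        by (rule Lim_transform_eventually)
    qed
    moreover have "flat k 0 = 0" for k by (simp add: flat_def)
    ultimately show ?thesis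
      using 2 by (simp add: DERIV_def)
  next
    case 3
    have "((\<lambda>t. exp (- 1 / t) / t ^ m) has_real_derivative (flat (m + 2) t - real m * flat (m + 1) t)) (at t)"
    proof -
      have p: "j = 0 \<or> t ^ j = t * t ^ (j - Suc 0)" for j
        by (cases j) auto
      show ?thesis
        using 3 by (cases m)
          (auto intro!: derivative_eq_intros simp: flat_def divide_simps power2_eq_square; simp add: algebra_simps p)+
    qed
    from has_field_derivative_transform_within_open[OF this, of "{0<..}" "flat m"] 3
    show ?thesis by (auto simp: flat_def)
  qed
qed

text \<open>This class is closed under partial derivatives, so that all its members are smooth.\<close>

inductive bump_algebra :: "real \<Rightarrow> (real^'n::finite \<Rightarrow> real) \<Rightarrow> bool" for e where
  const: "bump_algebra e (\<lambda>x. c)"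
| coord: "bump_algebra e (\<lambda>x. x $ i)"
| flat: "bump_algebra e (\<lambda>x. flat m (e\<^sup>2 - x \<bullet> x))"
| add: "bump_algebra e f \<Longrightarrow> bump_algebra e g \<Longrightarrow> bump_algebra e (\<lambda>x. f x + g x)"
| mult: "bump_algebra e f \<Longrightarrow> bump_algebra e g \<Longrightarrow> bump_algebra e (\<lambda>x. f x * g x)"

lemma partial_deriv_eqI:
  "(f has_derivative D) (at x) \<Longrightarrow> partial_deriv i f x = D (axis i 1)"
  by (metis frechet_derivative_at partial_deriv_def)

lemma bump_algebra_partial_deriv:
  fixes f :: "real^'n::finite \<Rightarrow> real"
  assumes "bump_algebra e f"
  shows "(\<forall>x. f differentiable (at x)) \<and> (\<forall>i. bump_algebra e (partial_deriv i f))"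
  using assms
proof induction
  case (const c)
  have "partial_deriv i (\<lambda>x::real^'n. c) = (\<lambda>x. 0)" for i
    by (rule ext, subst partial_deriv_eqI[where D = "\<lambda>h. 0"]) auto
  then show ?case by (auto intro: bump_algebra.const)
next
  case (coord j)
  have D: "((\<lambda>x::real^'n. x $ j) has_derivative (\<lambda>h. h $ j)) (at x)" for x
    by (intro bounded_linear_imp_has_derivative bounded_linear_vec_nth)
  have "partial_deriv i (\<lambda>x::real^'n. x $ j) = (\<lambda>x. axis i 1 $ j)" for i
    by (rule ext, rule partial_deriv_eqI[OF D])
  with D show ?case by (auto intro: bump_algebra.const simp: differentiable_def)
next
  case (flat m)
  have D: "((\<lambda>x::real^'n. flat m (e\<^sup>2 - x \<bullet> x)) has_derivative
    (\<lambda>h. (flat (m + 2) (e\<^sup>2 - x \<bullet> x) - real m * flat (m + 1) (e\<^sup>2 - x \<bullet> x)) * (- (x \<bullet> h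
        + h \<bullet> x)))) (at x)" for x
  proof (rule has_derivative_compose[where g = "flat m" and f = "\<lambda>x. e\<^sup>2 - x \<bullet> x"
      and f' = "\<lambda>h. - (x \<bullet> h + h \<bullet> x)"
      and g' = "(*) (flat (m + 2) (e\<^sup>2 - x \<bullet> x) - real m * flat (m + 1) (e\<^sup>2 - x \<bullet> x))"])
    show "((\<lambda>x. e\<^sup>2 - x \<bullet> x) has_derivative (\<lambda>h. - (x \<bullet> h + h \<bullet> x))) (at x)"
      by (auto intro!: derivative_eq_intros)
  qed (rule has_field_derivative_imp_has_derivative[OF has_real_derivative_flat])
  have "partial_deriv i (\<lambda>x::real^'n. flat m (e\<^sup>2 - x \<bullet> x)) = (\<lambda>x.
     (flat (m + 2) (e\<^sup>2 - x \<bullet> x) + (- real m) * flat (m + 1) (e\<^sup>2 - x \<bullet> x)) * ((- 2) * x $ i))" for i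
    by (rule ext, subst partial_deriv_eqI[OF D]) (auto simp: inner_axis inner_axis' algebra_simps)
  then have "bump_algebra e (partial_deriv i (\<lambda>x::real^'n. flat m (e\<^sup>2 - x \<bullet> x)))" for i
    by (simp only:) (intro bump_algebra.intros)
  with D show ?case unfolding differentiable_def by blast
next
  case (add f g)
  then have D: "((\<lambda>x. f x + g x) has_derivative
      (\<lambda>h. frechet_derivative f (at x) h + frechet_derivative g (at x) h)) (at x)" for x
    by (auto intro!: has_derivative_add simp: frechet_derivative_works)
  have "partial_deriv i (\<lambda>x. f x + g x) = (\<lambda>x. partial_deriv i f x + partial_deriv i g x)" for i
    by (rule ext, subst partial_deriv_eqI[OF D]) (simp add: partial_deriv_def)
  with D add show ?case unfolding differentiable_def by (auto intro: bump_algebra.add)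
next
  case (mult f g)
  then have D: "((\<lambda>x. f x * g x) has_derivative
      (\<lambda>h. f x * frechet_derivative g (at x) h + frechet_derivative f (at x) h * g x)) (at x)" for x
    by (auto intro!: has_derivative_mult simp: frechet_derivative_works)
  have "partial_deriv i (\<lambda>x. f x * g x) = (\<lambda>x. f x * partial_deriv i g x + partial_deriv i f x * g x)" for i
    by (rule ext, subst partial_deriv_eqI[OF D]) (simp add: partial_deriv_def)
  moreover have "bump_algebra e (\<lambda>x. f x * partial_deriv i g x + partial_deriv i f x * g x)" for i
    by (rule bump_algebra.add[OF bump_algebra.mult bump_algebra.mult]) (use mult in auto)
  ultimately show ?case using D unfolding differentiable_def by auto
qed

lemma bump_algebra_k_times_cont_diff:
  fixes f :: "real^'n::finite \<Rightarrow> real"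
  assumes "bump_algebra e f"
  shows "k_times_cont_diff k f"
  using assms
proof (induction k arbitrary: f)
  case 0
  then show ?case
    using bump_algebra_partial_deriv[OF 0]
    by (auto intro!: continuous_at_imp_continuous_on differentiable_imp_continuous_within)
next
  case (Suc k)
  then show ?case
    using bump_algebra_partial_deriv[OF Suc.prems] by (auto simp: differentiable_on_def)
qed

section \<open>Test functions and their supports\<close>

lemma Cc_infinityI:
  assumes "\<And>k. k_times_cont_diff k u" "compact K" "K \<subseteq> U" "\<And>x. x \<notin> K \<Longrightarrow> u x = 0"
  shows "u \<in> Cc_infinity U"
proof -
  have "closure {x. u x \<noteq> 0} \<subseteq> K"
    using assms by (intro closure_minimal compact_imp_closed) auto
  moreover from this have "compact (closure {x. u x \<noteq> 0})"
    using assms(2) by (meson bounded_closure bounded_subset closed_closure closure_subset compact_eq_bounded_closed order_trans)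
  ultimately show ?thesis
    using assms by (auto simp: Cc_infinity_def)
qed

lemma Cc_infinity_C1_on:
  assumes "u \<in> Cc_infinity U"
  shows "C1_on UNIV u"
proof -
  have "k_times_cont_diff (Suc 0) u"
    using assms by (simp only: Cc_infinity_def mem_Collect_eq)
  then have 1: "u differentiable_on UNIV" "\<And>i. continuous_on UNIV (partial_deriv i u)"
    by auto
  then have d: "u differentiable (at x)" for x
    by (simp add: differentiable_on_def)
  show ?thesis
  proof (rule C1_onI[of _ _ "\<lambda>x h. grad u x \<bullet> h"])
    show "(u has_derivative (\<lambda>h. grad u x \<bullet> h)) (at x)" for x
      by (rule has_derivative_grad[OF d])
    show "continuous_on UNIV (\<lambda>x. grad u x \<bullet> h)" for h
      using 1 by (auto simp: grad_def[abs_def] intro!: continuous_intros continuous_on_vec_lambda)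
  qed
qed

lemma Cc_infinity_support:
  assumes "u \<in> Cc_infinity U"
  obtains R where "R > 0" "\<And>x. norm x > R \<Longrightarrow> u x = 0"
proof -
  have "bounded (closure {x. u x \<noteq> 0})"
    using assms by (auto simp: Cc_infinity_def compact_imp_bounded)
  then obtain R where "R > 0" "\<forall>x\<in>closure {x. u x \<noteq> 0}. norm x \<le> R"
    by (auto simp: bounded_pos)
  moreover have "{x. u x \<noteq> 0} \<subseteq> closure {x. u x \<noteq> 0}" by (rule closure_subset)
  ultimately have "u x = 0" if "norm x > R" for x
    using that by (metis (mono_tags, lifting) linorder_not_less mem_Collect_eq subsetD)
  with \<open>R > 0\<close> show ?thesis by (rule that)
qed

lemma Cc_infinity_ball_support:
  assumes "u \<in> Cc_infinity (ball 0 1)"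
  obtains R where "0 < R" "R < 1" "\<And>x. norm x > R \<Longrightarrow> u x = 0"
proof -
  let ?K = "closure {x. u x \<noteq> 0}"
  have K: "compact ?K" "?K \<subseteq> ball 0 1"
    using assms by (auto simp: Cc_infinity_def)
  have "compact (norm ` ?K)"
    by (intro compact_continuous_image K continuous_intros)
  obtain r where r: "r < 1" "\<And>x. x \<in> ?K \<Longrightarrow> norm x \<le> r"
  proof (cases "?K = {}")
    case True then show ?thesis using that[of 0] by auto
  next
    case False
    then obtain x where "x \<in> ?K" "\<And>y. y \<in> ?K \<Longrightarrow> norm y \<le> norm x"
      using continuous_attains_sup[of ?K norm] K(1) by (auto intro: continuous_intros)
    then show ?thesis using that[of "norm x"] K(2) by auto
  qed
  \<comment> \<open>The maximum with \<open>1/2\<close> makes the radius positive and keeps it below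
    1.\<close>
  have "u x = 0" if "norm x > max r (1/2)" for x
    using r(2)[of x] that closure_subset[of "{x. u x \<noteq> 0}"] by fastforce
  then show ?thesis using that[of "max r (1/2)"] r(1) by auto
qed

definition bump :: "real \<Rightarrow> real^'n::finite \<Rightarrow> real"
  where "bump e x = flat 0 (e\<^sup>2 - x \<bullet> x)"

lemma bump_nonneg: "bump e x \<ge> 0"
  by (simp add: bump_def flat_nonneg)

lemma bump_pos: "e > 0 \<Longrightarrow> norm x < e \<Longrightarrow> bump e x > 0"
  by (simp add: bump_def flat_def dot_square_norm abs_square_less_1 power_strict_mono)

lemma bump_eq_0: "e > 0 \<Longrightarrow> norm x \<ge> e \<Longrightarrow> bump e x = 0"
  by (simp add: bump_def flat_def dot_square_norm not_less power_mono)

lemma bump_Cc_infinity: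
  assumes "e > 0"
  shows "(\<lambda>x::real^'n::finite. c * bump e x) \<in> Cc_infinity UNIV"
proof (rule Cc_infinityI[of _ "cball 0 e"])
  show "k_times_cont_diff k (\<lambda>x::real^'n. c * bump e x)" for k
    unfolding bump_def by (intro bump_algebra_k_times_cont_diff[of e] bump_algebra.intros)
qed (use assms in \<open>auto simp: bump_eq_0\<close>)

text \<open>The part of S where f is positive is open and a null set, hence empty. Continuity is
  asked on S only, so that weights singular at the origin are covered.\<close>

lemma continuous_nonneg_integral_eq_0:
  fixes f :: "'a::euclidean_space \<Rightarrow> real"
  assumes "integrable lborel f" "\<And>x. f x \<ge> 0" "(LINT x|lborel. f x) = 0" "open S" "x \<in> S" "continuous_on S f"
  shows "f x = 0"
proof (rule ccontr)
  assume "f x \<noteq> 0"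
  then have "f x > 0" using assms(2)[of x] by simp
  have "AE y in lborel. f y = 0"
    using integral_nonneg_eq_0_iff_AE[OF assms(1)] assms by auto
  then obtain N where N: "{y. f y \<noteq> 0} \<subseteq> N" "N \<in> null_sets lborel"
    by (auto elim!: AE_E simp: null_sets_def)
  have o: "open (S \<inter> f -` {0<..})"
    using assms(4,6) by (simp add: continuous_open_preimage)
  have "S \<inter> f -` {0<..} \<in> null_sets lborel"
    by (rule null_sets_subset[OF N(2)]) (use o N(1) in auto)
  then have "negligible (S \<inter> f -` {0<..})"
    by (simp add: negligible_iff_null_sets null_sets_completionI)
  moreover have "x \<in> S \<inter> f -` {0<..}" using \<open>f x > 0\<close> assms by auto
  ultimately show False
    using open_not_negligible[OF o] by blast
qed

section \<open>Convolution and mollification\<close>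

definition convol :: "(real^'n::finite \<Rightarrow> real) \<Rightarrow> (real^'n \<Rightarrow> real) \<Rightarrow> real^'n \<Rightarrow> real"
  where "convol f g x = (LINT y|lborel. f y * g (x - y))"

lemma convol_integrable:
  fixes f :: "real^'n::finite \<Rightarrow> real" and g :: "real^'n \<Rightarrow> 'b::{banach,second_countable_topology}"
  assumes "continuous_on UNIV f" "continuous_on UNIV g" "\<And>x. norm x > R \<Longrightarrow> g x = 0"
  shows "integrable lborel (\<lambda>y. f y *\<^sub>R g (x - y))"
proof (rule integrable_continuous_compact_support[where R = "norm x + R"])
  show "continuous_on UNIV (\<lambda>y. f y *\<^sub>R g (x - y))"
    by (intro continuous_intros assms continuous_on_compose2[OF assms(2)]) auto
  show "f y *\<^sub>R g (x - y) = 0" if "norm y > norm x + R" for y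
  proof -
    have "norm (x - y) > R" using that norm_triangle_ineq2[of y x] by (simp add: norm_minus_commute)
    then show ?thesis by (simp add: assms)
  qed
qed

lemma convol_commute:
  assumes "continuous_on UNIV f" "continuous_on UNIV g"
  shows "convol f g = convol g f"
proof
  fix x
  have "(\<lambda>y. f y * g (x - y)) \<in> borel_measurable borel"
    by (intro borel_measurable_continuous_onI continuous_intros assms continuous_on_compose2[OF assms(2)]) auto
  from integral_lborel_reflect[OF this, of x] show "convol f g x = convol g f x"
    by (simp add: convol_def mult.commute)
qed

text \<open>All regularity and the compact support come from g. That f is merely bounded matters:
  \<open>integral_partial_deriv_eq_0\<close> takes the constant 1 for it.\<close>

lemma has_derivative_convol:
  fixes f g :: "real^'n::finite \<Rightarrow> real"
  assumes f: "continuous_on UNIV f" "\<And>x. \<bar>f x\<bar> \<le> M"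
    and g: "C1_on UNIV g" "\<And>x. norm x > R \<Longrightarrow> g x = 0"
  shows "(convol f g has_derivative (\<lambda>h. (LINT y|lborel. f y *\<^sub>R grad g (x - y)) \<bullet> h)) (at x)"
proof -
  let ?D = "\<lambda>h. (LINT y|lborel. f y *\<^sub>R grad g (x - y)) \<bullet> h"
  have gc: "continuous_on UNIV g" "continuous_on UNIV (grad g)"
    using g by (auto intro: C1_on_imp_continuous_on C1_on_imp_continuous_on_grad)
  have gs: "grad g x = 0" if "norm x > R" for x
    using grad_eq_0_outside_cball[OF g(2) that] .
  have M0: "M \<ge> 0" using f(2)[of 0] by linarith
  have ig: "integrable lborel (\<lambda>y. f y *\<^sub>R grad g (x - y))"
    by (rule convol_integrable[OF f(1) gc(2) gs])
  have i: "integrable lborel (\<lambda>y. f y * g (x - y))" for x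
    using convol_integrable[OF f(1) gc(1) g(2), where x = x] by simp
  define V where "V = measure lborel (cball x (R + 1))"
  have fin: "emeasure lborel (cball x (R + 1)) < top"
    by (rule emeasure_lborel_cball_finite[unfolded infinity_ennreal_def])
  have V: "V \<ge> 0" by (simp add: V_def)
  show ?thesis
    unfolding has_derivative_at_alt
  proof (intro conjI allI impI)
    show "bounded_linear ?D" by (rule bounded_linear_inner_right)
    fix e :: real assume "e > 0"
    \<comment> \<open>For increments shorter than 1 the integrand lives in the ball of radius
      \<open>R + 1\<close> around x, of volume \<open>V\<close>, so the total error is at most
      \<open>M * V * e' * norm h\<close>. The added 1 avoids a zero denominator.\<close>
    define e' where "e' = e / (M * V + 1)"
    have MV: "M * V \<ge> 0" using M0 V by simp
    have e': "e' > 0" using \<open>e > 0\<close> MV by (simp add: e'_def)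
    obtain d where d: "d > 0" "\<And>x h. norm h < d \<Longrightarrow> \<bar>g (x + h) - g x - grad g x \<bullet> h\<bar> \<le> e' * norm h"
      using C1_uniform_derivative[OF g e'] by metis
    have "norm (convol f g y - convol f g x - ?D (y - x)) \<le> e * norm (y - x)"
      if "norm (y - x) < min d 1" for y
    proof -
      define h where "h = y - x"
      have h: "norm h < d" "norm h < 1" "y = x + h" using that by (auto simp: h_def)
      have I: "integrable lborel (\<lambda>z. f z * g (x + h - z) - f z * g (x - z) - (f z *\<^sub>R grad g (x - z)) \<bullet> h)"
        by (intro Bochner_Integration.integrable_diff i integrable_inner_left ig)
      have J: "integrable lborel (\<lambda>z. (M * e' * norm h) * indicator (cball x (R + 1)) z)"
        using fin by (intro integrable_mult_right integrable_real_indicator) auto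
      have "convol f g y - convol f g x - ?D h =
         (LINT z|lborel. f z * g (x + h - z) - f z * g (x - z) - (f z *\<^sub>R grad g (x - z)) \<bullet> h)"
        unfolding convol_def h(3)
        using integrable_inner_left[of h, OF ig] integral_inner_left[of h, OF ig]
        by (simp add: Bochner_Integration.integral_diff i)
      also have "norm \<dots> \<le> (LINT z|lborel. (M * e' * norm h) * indicator (cball x (R + 1)) z)"
      proof (rule Bochner_Integration.integral_norm_bound_integral[OF I J])
        fix z
        have eq: "f z * g (x + h - z) - f z * g (x - z) - (f z *\<^sub>R grad g (x - z)) \<bullet> h
           = f z * (g ((x - z) + h) - g (x - z) - grad g (x - z) \<bullet> h)"
          by (simp add: algebra_simps)
        show "norm (f z * g (x + h - z) - f z * g (x - z) - (f z *\<^sub>R grad g (x - z)) \<bullet> h)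
          \<le> (M * e' * norm h) * indicator (cball x (R + 1)) z"
        proof (cases "z \<in> cball x (R + 1)")
          case True
          have "norm (f z * (g ((x - z) + h) - g (x - z) - grad g (x - z) \<bullet> h)) \<le> M * (e' * norm h)"
            unfolding norm_mult using M0 f(2) d(2)[OF h(1)] by (intro mult_mono) auto
          then show ?thesis unfolding eq using True by simp
        next
          case False
          then have "norm (x - z) > R + 1" by (simp add: dist_norm)
          moreover have "norm (x - z) \<le> norm (x - z + h) + norm h"
            by (metis add_diff_cancel_right' norm_triangle_ineq4)
          ultimately have "norm (x - z) > R" "norm (x - z + h) > R" using h(2) by auto
          then show ?thesis unfolding eq using M0 e' by (simp add: g(2) gs)
        qed
      qed
      also have "\<dots> = (M * V) * e' * norm h"
        using fin by (simp add: V_def)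
      also have "\<dots> \<le> e * norm h"
        using MV \<open>e > 0\<close> by (intro mult_right_mono) (auto simp: e'_def field_simps)
      finally show ?thesis by (simp add: h_def)
    qed
    then show "\<exists>d>0. \<forall>y. norm (y - x) < d \<longrightarrow> norm (convol f g y - convol f g x - ?D (y - x))
        \<le> e * norm (y - x)"
      using d(1) by (intro exI[of _ "min d 1"]) auto
  qed
qed

lemma partial_deriv_convol:
  fixes f g :: "real^'n::finite \<Rightarrow> real"
  assumes f: "continuous_on UNIV f" "\<And>x. \<bar>f x\<bar> \<le> M"
    and g: "C1_on UNIV g" "\<And>x. norm x > R \<Longrightarrow> g x = 0"
  shows "partial_deriv i (convol f g) = convol f (partial_deriv i g)"
proof
  fix x
  have "partial_deriv i (convol f g) x = (LINT y|lborel. f y *\<^sub>R grad g (x - y)) \<bullet> axis i 1"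
    by (rule partial_deriv_eqI[OF has_derivative_convol[OF f g]])
  also have "\<dots> = (LINT y|lborel. (f y *\<^sub>R grad g (x - y)) \<bullet> axis i 1)"
    by (intro integral_inner_left[symmetric] convol_integrable[OF f(1) C1_on_imp_continuous_on_grad[OF g(1)]]
         grad_eq_0_outside_cball[OF g(2)])
  also have "\<dots> = convol f (partial_deriv i g) x"
    by (simp add: convol_def grad_def inner_axis)
  finally show "partial_deriv i (convol f g) x = convol f (partial_deriv i g) x" .
qed

lemma partial_deriv_Cc_infinity:
  assumes "u \<in> Cc_infinity UNIV"
  shows "partial_deriv i u \<in> Cc_infinity UNIV"
proof -
  obtain R where R: "R > 0" "\<And>x. norm x > R \<Longrightarrow> u x = 0"
    using Cc_infinity_support[OF assms] by metis
  show ?thesis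
  proof (rule Cc_infinityI[of _ "cball 0 R"])
    have "k_times_cont_diff (Suc k) u" for k
      using assms unfolding Cc_infinity_def by blast
    then show "k_times_cont_diff k (partial_deriv i u)" for k
      by auto
    show "partial_deriv i u x = 0" if "x \<notin> cball 0 R" for x
      using grad_eq_0_outside_cball[of R u x] R(2) that by (simp add: grad_def vec_eq_iff)
  qed auto
qed

text \<open>Every derivative is put on g, so f need not be differentiable. This is what later
  smooths a minimizer that is only Lipschitz.\<close>

lemma k_times_cont_diff_convol:
  fixes f g :: "real^'n::finite \<Rightarrow> real"
  assumes f: "continuous_on UNIV f" "\<And>x. \<bar>f x\<bar> \<le> M" and g: "g \<in> Cc_infinity UNIV"
  shows "k_times_cont_diff k (convol f g)"
  using g
proof (induction k arbitrary: g)
  case 0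
  obtain R where R: "R > 0" "\<And>x. norm x > R \<Longrightarrow> g x = 0"
    using Cc_infinity_support[OF 0] by metis
  show ?case
    using has_derivative_convol[OF f Cc_infinity_C1_on[OF 0] R(2)]
    by (auto intro!: continuous_at_imp_continuous_on has_derivative_continuous)
next
  case (Suc k)
  obtain R where R: "R > 0" "\<And>x. norm x > R \<Longrightarrow> g x = 0"
    using Cc_infinity_support[OF Suc.prems] by metis
  have "convol f g differentiable_on UNIV"
    using has_derivative_convol[OF f Cc_infinity_C1_on[OF Suc.prems] R(2)]
    unfolding differentiable_on_def differentiable_def by blast
  moreover have "k_times_cont_diff k (partial_deriv i (convol f g))" for i
    using partial_deriv_convol[OF f Cc_infinity_C1_on[OF Suc.prems] R(2), where i = i]
      Suc.IH[OF partial_deriv_Cc_infinity[OF Suc.prems, where i = i]] by simp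
  ultimately show ?case by simp
qed

definition mollifier :: "real \<Rightarrow> real^'n::finite \<Rightarrow> real"
  where "mollifier e x = inverse (LINT x::real^'n|lborel. bump e x) * bump e x"

lemma continuous_on_bump:
  assumes "e > 0"
  shows "continuous_on UNIV (bump e)"
  using C1_on_imp_continuous_on[OF Cc_infinity_C1_on[OF bump_Cc_infinity[OF assms, of 1]]] by simp

lemma bump_integral_pos:
  assumes "e > 0"
  shows "(LINT x::real^'n::finite|lborel. bump e x) > 0"
proof -
  have i: "integrable lborel (bump e :: real^'n \<Rightarrow> real)"
    by (rule integrable_continuous_compact_support[OF continuous_on_bump[OF assms],
        of e]) (simp add: bump_eq_0 assms)
  have "(LINT x::real^'n|lborel. bump e x) \<noteq> 0"
    using continuous_nonneg_integral_eq_0[OF i bump_nonneg _ open_UNIV UNIV_I continuous_on_bump[OF assms],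
        of 0]
      bump_pos[OF assms, of "0 :: real^'n"] assms by auto
  then show ?thesis
    using Bochner_Integration.integral_nonneg[of lborel "bump e :: real^'n \<Rightarrow> real"] bump_nonneg
        by (metis less_eq_real_def)
qed

lemma mollifier:
  fixes x y :: "real^'n::finite"
  assumes "e > 0"
  shows "mollifier e \<in> Cc_infinity (UNIV :: (real^'n) set)" "mollifier e x \<ge> 0"
    "norm x \<ge> e \<Longrightarrow> mollifier e x = 0" "norm x = norm y \<Longrightarrow> mollifier e x = mollifier e y"
    "(LINT x::real^'n|lborel. mollifier e x) = 1" "continuous_on UNIV (mollifier e :: real^'n \<Rightarrow> real)"
proof -
  show 1: "mollifier e \<in> Cc_infinity (UNIV :: (real^'n) set)"
    unfolding mollifier_def[abs_def] by (rule bump_Cc_infinity[OF assms])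
  show "continuous_on UNIV (mollifier e :: real^'n \<Rightarrow> real)"
    using C1_on_imp_continuous_on[OF Cc_infinity_C1_on[OF 1]] .
  show "mollifier e x \<ge> 0"
    using bump_integral_pos[OF assms, where 'n='n] bump_nonneg[of e x] by (simp add: mollifier_def)
  show "norm x \<ge> e \<Longrightarrow> mollifier e x = 0"
    using assms by (simp add: mollifier_def bump_eq_0)
  show "norm x = norm y \<Longrightarrow> mollifier e x = mollifier e y"
    by (simp add: mollifier_def bump_def dot_square_norm)
  show "(LINT x::real^'n|lborel. mollifier e x) = 1"
    using bump_integral_pos[OF assms, where 'n='n] by (simp add: mollifier_def)
qed

lemma mollifier_integrable: "e > 0 \<Longrightarrow> integrable lborel (mollifier e :: real^'n::finite \<Rightarrow> real)"
  by (intro integrable_continuous_compact_support[of _ e]) (simp_all add: mollifier(3,6) less_imp_le)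

text \<open>The convolution at x is an average of the values of f within distance e. Different
  choices of c and M yield uniform bounds, pointwise convergence and control of the support.\<close>

lemma convol_mollifier_bound:
  fixes f :: "real^'n::finite \<Rightarrow> real"
  assumes "e > 0" "continuous_on UNIV f" "\<And>y. dist x y \<le> e \<Longrightarrow> \<bar>f y - c\<bar> \<le> M"
  shows "\<bar>convol f (mollifier e) x - c\<bar> \<le> M"
proof -
  have M: "M \<ge> 0" using assms(3)[of x] assms(1) by auto
  note mi = mollifier_integrable[OF assms(1), where 'n='n]
  have i: "integrable lborel (\<lambda>z. mollifier e z * f (x - z))"
  proof (rule integrable_continuous_compact_support[of _ e])
    show "continuous_on UNIV (\<lambda>z. mollifier e z * f (x - z))"
      by (intro continuous_intros mollifier(6)[OF assms(1)] continuous_on_compose2[OF assms(2)]) auto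
  qed (simp add: mollifier(3)[OF assms(1)] less_imp_le)
  have "convol f (mollifier e) x - c
      = (LINT z|lborel. mollifier e z * f (x - z)) - (LINT z|lborel. mollifier e (z::real^'n) * c)"
    using convol_commute[OF assms(2) mollifier(6)[OF assms(1)]] mollifier(5)[OF assms(1), where 'n='n]
        by (simp add: convol_def)
  also have "\<dots> = (LINT z|lborel. mollifier e z * f (x - z) - mollifier e z * c)"
    using i mi by (subst Bochner_Integration.integral_diff) auto
  finally have "\<bar>convol f (mollifier e) x - c\<bar>
      = norm (LINT z|lborel. mollifier e z * f (x - z) - mollifier e z * c)"
    by simp
  also have "\<dots> \<le> (LINT z|lborel. mollifier e (z::real^'n) * M)"
  proof (rule Bochner_Integration.integral_norm_bound_integral)
    show "integrable lborel (\<lambda>z. mollifier e z * f (x - z) - mollifier e z * c)"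
      using i mi by auto
    show "integrable lborel (\<lambda>z. mollifier e (z::real^'n) * M)"
      using mi by auto
    fix z :: "real^'n"
    show "norm (mollifier e z * f (x - z) - mollifier e z * c) \<le> mollifier e z * M"
    proof (cases "norm z \<ge> e")
      case True
      then show ?thesis using mollifier(3)[OF assms(1) True] by simp
    next
      case False
      then have "\<bar>f (x - z) - c\<bar> \<le> M" by (intro assms(3)) (simp add: dist_norm)
      moreover have "\<bar>mollifier e z * f (x - z) - mollifier e z * c\<bar> = mollifier e z * \<bar>f (x - z) - c\<bar>"
        using mollifier(2)[OF assms(1), of z] by (simp add: abs_mult flip: right_diff_distrib)
      ultimately show ?thesis
        using mollifier(2)[OF assms(1), of z] by (simp add: mult_left_mono real_norm_def)
    qed
  qed
  also have "\<dots> = M" using mollifier(5)[OF assms(1), where 'n='n] by simp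
  finally show ?thesis .
qed

lemma convol_mollifier_tendsto:
  fixes f :: "real^'n::finite \<Rightarrow> real"
  assumes "continuous_on UNIV f" "\<And>j. e j > 0" "e \<longlonglongrightarrow> 0"
  shows "(\<lambda>j. convol f (mollifier (e j)) x) \<longlonglongrightarrow> f x"
proof (rule tendstoI)
  fix r :: real assume "r > 0"
  have "isCont f x" using assms(1) by (simp add: continuous_on_eq_continuous_at)
  then obtain d where d: "d > 0" "\<And>y. dist y x < d \<Longrightarrow> dist (f y) (f x) < r / 2"
    unfolding continuous_at_eps_delta using \<open>r > 0\<close> by (metis half_gt_zero)
  have "\<forall>\<^sub>F j in sequentially. e j < d"
    using order_tendstoD(2)[OF assms(3) d(1)] .
  then show "\<forall>\<^sub>F j in sequentially. dist (convol f (mollifier (e j)) x) (f x) < r"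
  proof eventually_elim
    case (elim j)
    have "\<bar>convol f (mollifier (e j)) x - f x\<bar> \<le> r / 2"
      by (rule convol_mollifier_bound[OF assms(2) assms(1)])
         (use d(2) elim in \<open>force simp: dist_real_def dist_commute less_imp_le\<close>)
    then show ?case using \<open>r > 0\<close> by (simp add: dist_real_def)
  qed
qed

lemma convol_mollifier_support:
  fixes f :: "real^'n::finite \<Rightarrow> real"
  assumes "e > 0" "continuous_on UNIV f" "\<And>x. norm x > R \<Longrightarrow> f x = 0" "norm x > R + e"
  shows "convol f (mollifier e) x = 0"
proof -
  have "\<bar>convol f (mollifier e) x - 0\<bar> \<le> 0"
  proof (rule convol_mollifier_bound[OF assms(1,2)])
    fix y assume "dist x y \<le> e"
    moreover have "norm x \<le> norm y + dist x y" by (simp add: dist_norm norm_triangle_sub)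
    ultimately show "\<bar>f y - 0\<bar> \<le> 0" using assms by simp
  qed
  then show ?thesis by simp
qed

lemma convol_mollifier_Cc_infinity:
  fixes f :: "real^'n::finite \<Rightarrow> real"
  assumes "e > 0" "continuous_on UNIV f" "\<And>x. norm x > R \<Longrightarrow> f x = 0" "cball 0 (R + e) \<subseteq> U"
  shows "convol f (mollifier e) \<in> Cc_infinity U"
proof -
  obtain M where "\<And>x. norm (f x) \<le> M"
    using bounded_continuous_compact_support[OF assms(2,3)] by metis
  then show ?thesis
    using assms convol_mollifier_support[OF assms(1-3)]
    by (intro Cc_infinityI[of _ "cball 0 (R + e)"] k_times_cont_diff_convol mollifier(1)) auto
qed

text \<open>By commutativity f takes the role of the differentiated factor. Thus the gradient of a
  mollification is a mollification of the gradient and inherits its bounds and its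
  convergence.\<close>

lemma grad_convol_mollifier:
  fixes f :: "real^'n::finite \<Rightarrow> real"
  assumes "e > 0" "C1_on UNIV f" "\<And>x. norm x > R \<Longrightarrow> f x = 0"
  shows "grad (convol f (mollifier e)) x $ i = convol (\<lambda>x. grad f x $ i) (mollifier e) x"
proof -
  have fc: "continuous_on UNIV f" "continuous_on UNIV (\<lambda>x. grad f x $ i)"
    using assms by (auto intro!: C1_on_imp_continuous_on continuous_intros C1_on_imp_continuous_on_grad)
  have mc: "continuous_on UNIV (mollifier e :: real^'n \<Rightarrow> real)"
    using mollifier(6)[OF assms(1)] .
  have ms: "mollifier e x = 0" if "norm x > e" for x :: "real^'n"
    using mollifier(3)[OF assms(1) less_imp_le[OF that]] .
  from bounded_continuous_compact_support[OF mc ms]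
  obtain M where M: "\<And>x :: real^'n. norm (mollifier e x) \<le> M" by blast
  have "grad (convol f (mollifier e)) x $ i = partial_deriv i (convol (mollifier e) f) x"
    using convol_commute[OF fc(1) mc] by (simp add: grad_def)
  also have "\<dots> = convol (mollifier e) (partial_deriv i f) x"
    using partial_deriv_convol[OF mc, of M f R] M assms by simp
  also have "\<dots> = convol (mollifier e) (\<lambda>x. grad f x $ i) x"
    by (simp add: grad_def[abs_def])
  also have "\<dots> = convol (\<lambda>x. grad f x $ i) (mollifier e) x"
    using convol_commute[OF fc(2) mc] by simp
  finally show ?thesis .
qed

text \<open>Dividing the gradient bound by \<open>norm x\<close> makes no difference for compact supports, but lets
  the notion also cover functions that are cut off near the origin.\<close>

definition C1_approx :: "real \<Rightarrow> (nat \<Rightarrow> real^'n::finite \<Rightarrow> real) \<Rightarrow> (real^'n \<Rightarrow> real) \<Rightarrow> bool"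
  where "C1_approx R f g \<longleftrightarrow> C1_on UNIV g \<and> (\<forall>j. C1_on UNIV (f j)) \<and>
    (\<forall>j x. norm x > R \<longrightarrow> f j x = 0) \<and>
    (\<exists>M. \<forall>j x. \<bar>f j x\<bar> \<le> M \<and> norm x * norm (grad (f j) x) \<le> M) \<and>
    (\<forall>x. x \<noteq> 0 \<longrightarrow> (\<lambda>j. f j x) \<longlonglongrightarrow> g x \<and> (\<lambda>j. grad (f j) x) \<longlonglongrightarrow> grad g x)"

lemma C1_approx_mollification:
  fixes g :: "real^'n::finite \<Rightarrow> real"
  assumes g: "C1_on UNIV g" "\<And>x. norm x > R \<Longrightarrow> g x = 0" and "R < R'"
  obtains f where "C1_approx R' f g" "\<And>j. f j \<in> Cc_infinity UNIV" "\<And>U j. cball 0 R' \<subseteq> U \<Longrightarrow> f j \<in> Cc_infinity U"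
proof -
  \<comment> \<open>The widths start at the gap \<open>R' - R\<close>, so that all supports stay in
    the ball of radius \<open>R'\<close>.\<close>
  define e where "e j = (R' - R) / real (Suc j)" for j
  have e: "e j > 0" "e j \<le> R' - R" for j
  proof -
    have "(R' - R) / real (Suc j) \<le> (R' - R) / 1"
      using \<open>R < R'\<close> by (intro divide_left_mono) auto
    then show "e j > 0" "e j \<le> R' - R" using \<open>R < R'\<close> by (auto simp: e_def)
  qed
  have "(\<lambda>j. (R' - R) * inverse (real (Suc j))) \<longlonglongrightarrow> (R' - R) * 0"
    by (intro tendsto_intros LIMSEQ_inverse_real_of_nat)
  then have elim: "e \<longlonglongrightarrow> 0" by (simp add: e_def[abs_def] divide_inverse)
  have gc: "continuous_on UNIV g" "\<And>i. continuous_on UNIV (\<lambda>x. grad g x $ i)" "continuous_on UNIV (grad g)"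
    using g by (auto intro!: C1_on_imp_continuous_on continuous_intros C1_on_imp_continuous_on_grad)
  define f where "f j = convol g (mollifier (e j))" for j
  have Cc: "f j \<in> Cc_infinity U" if "cball 0 R' \<subseteq> U" for j U
    unfolding f_def using e[of j] that
    by (intro convol_mollifier_Cc_infinity[OF _ gc(1) g(2)]) (auto simp: subset_iff)
  obtain M1 where M1: "\<And>x. norm (g x) \<le> M1"
    using bounded_continuous_compact_support[OF gc(1) g(2)] by metis
  have gs: "grad g x = 0" if "norm x > R" for x
    using grad_eq_0_outside_cball[OF g(2) that] .
  obtain M2 where M2: "\<And>x. norm (grad g x) \<le> M2"
    using bounded_continuous_compact_support[OF gc(3) gs] by metis
  have M20: "M2 \<ge> 0" using M2[of 0] norm_ge_zero order_trans by blast
  have b1: "\<bar>f j x\<bar> \<le> M1" for j x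
    using convol_mollifier_bound[OF e(1) gc(1), where c = 0 and M = M1] M1 by (simp add: f_def)
  have gf: "grad (f j) x $ i = convol (\<lambda>x. grad g x $ i) (mollifier (e j)) x" for j x i
    unfolding f_def by (rule grad_convol_mollifier[OF e(1) g])
  have "\<bar>grad (f j) x $ i\<bar> \<le> M2" for j x i
  proof -
    have "\<bar>grad g y $ i - 0\<bar> \<le> M2" for y
      using component_le_norm_cart[of "grad g y" i] M2[of y] by simp
    from convol_mollifier_bound[OF e(1) gc(2) this] show ?thesis by (simp add: gf)
  qed
  then have "(\<Sum>i\<in>UNIV. \<bar>grad (f j) x $ i\<bar>) \<le> real CARD('n) * M2" for j x
    by (intro sum_bounded_above) auto
  then have b2: "norm (grad (f j) x) \<le> real CARD('n) * M2" for j x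
    using norm_le_l1_cart[of "grad (f j) x"] by (rule order_trans[rotated])
  have s: "f j x = 0" if "norm x > R'" for j x
    unfolding f_def using e[of j] that by (intro convol_mollifier_support[OF _ gc(1) g(2)]) auto
  have b3: "norm x * norm (grad (f j) x) \<le> \<bar>R'\<bar> * (real CARD('n) * M2)" for j x
  proof (cases "norm x > R'")
    case True
    then show ?thesis using grad_eq_0_outside_cball[OF s True] M20 by simp
  next
    case False
    then show ?thesis using b2[of j x] by (intro mult_mono) auto
  qed
  have "C1_approx R' f g"
    unfolding C1_approx_def
  proof (intro conjI allI impI exI)
    show "C1_on UNIV (f j)" for j using Cc_infinity_C1_on[OF Cc[of UNIV]] by simp
    show "\<bar>f j x\<bar> \<le> max M1 (\<bar>R'\<bar> * (real CARD('n) * M2))" for j x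
      using b1[of j x] by simp
    show "norm x * norm (grad (f j) x) \<le> max M1 (\<bar>R'\<bar> * (real CARD('n) * M2))" for j x
      using b3[of x j] by simp
    show "(\<lambda>j. f j x) \<longlonglongrightarrow> g x" for x
      unfolding f_def by (rule convol_mollifier_tendsto[OF gc(1) e(1) elim])
    show "(\<lambda>j. grad (f j) x) \<longlonglongrightarrow> grad g x" for x
      by (rule vec_tendstoI) (simp add: gf convol_mollifier_tendsto[OF gc(2) e(1) elim])
  qed (use g s in auto)
  then show ?thesis using that Cc by auto
qed

section \<open>Orthogonal maps and radial changes of variables\<close>

text \<open>The change of variables theorem of the library requires a well-ordered index type. This copy of the
  index type is well-ordered and serves to remove the restriction.\<close>

typedef ('n::finite) widx = "{i::nat. i < CARD('n)}" morphisms widx_nat Abs_widx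
  by (rule exI[of _ 0]) simp

instantiation widx :: (finite) wellorder
begin

definition less_eq_widx :: "'a widx \<Rightarrow> 'a widx \<Rightarrow> bool"
  where "less_eq_widx i j \<longleftrightarrow> widx_nat i \<le> widx_nat j"

definition less_widx :: "'a widx \<Rightarrow> 'a widx \<Rightarrow> bool"
  where "less_widx i j \<longleftrightarrow> widx_nat i < widx_nat j"

instance
proof
  fix P :: "'a widx \<Rightarrow> bool" and a
  assume step: "\<And>x. (\<And>y. y < x \<Longrightarrow> P y) \<Longrightarrow> P x"
  show "P a"
  proof (induction "widx_nat a" arbitrary: a rule: less_induct)
    case less
    show ?case by (rule step) (simp add: less less_widx_def)
  qed
qed (auto simp: less_eq_widx_def less_widx_def widx_nat_inject)

end

instance widx :: (finite) finite
proof
  have "(UNIV :: 'a widx set) = Abs_widx ` {i. i < CARD('a)}"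
    using type_definition.Abs_image[OF type_definition_widx] by auto
  then show "finite (UNIV :: 'a widx set)"
    by (metis finite_Collect_less_nat finite_imageI)
qed

lemma ex_bij_widx: "\<exists>b :: 'n widx \<Rightarrow> 'n::finite. bij b"
proof -
  have "CARD('n widx) = CARD('n)"
    using type_definition.card[OF type_definition_widx[where 'n='n]] by simp
  then show ?thesis
    by (intro finite_same_card_bij) auto
qed

section \<open>Invariance of the measure under relabelling and rotation\<close>

definition reindex :: "('m \<Rightarrow> 'n) \<Rightarrow> real^'n \<Rightarrow> real^'m"
  where "reindex b x = (\<chi> j. x $ b j)"

lemma reindex_inverse:
  assumes "bij b"
  shows "reindex (inv b) (reindex b x) = x" "reindex b (reindex (inv b) y) = y"
  using assms by (auto simp: reindex_def vec_eq_iff bij_is_surj surj_f_inv_f bij_is_inj)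

lemma linear_reindex: "linear (reindex b)"
  by (rule linearI) (auto simp: reindex_def vec_eq_iff)

lemma inner_reindex:
  fixes b :: "'m::finite \<Rightarrow> 'n::finite"
  assumes "bij b"
  shows "reindex b x \<bullet> reindex b y = x \<bullet> y"
  unfolding inner_vec_def reindex_def
  using sum.reindex_bij_betw[OF assms, of "\<lambda>i. x $ i * y $ i"] by simp

lemma norm_reindex:
  fixes b :: "'m::finite \<Rightarrow> 'n::finite"
  shows "bij b \<Longrightarrow> norm (reindex b x) = norm x"
  by (simp add: norm_eq_sqrt_inner inner_reindex)

lemma borel_measurable_reindex [measurable]:
  fixes b :: "'m::finite \<Rightarrow> 'n::finite"
  shows "reindex b \<in> borel_measurable borel"
  by (intro linear_borel_measurable linear_reindex)

lemma prod_Basis_cart: "(\<Prod>b\<in>Basis. (x :: real^'n::finite) \<bullet> b) = (\<Prod>i\<in>UNIV. x $ i)"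
proof -
  have "bij_betw (\<lambda>i. axis i (1::real)) (UNIV :: 'n set) Basis"
    by (auto simp: bij_betw_def inj_on_def axis_eq_axis Basis_vec_def)
  from prod.reindex_bij_betw[OF this, of "\<lambda>b. x \<bullet> b"] show ?thesis
    by (simp add: inner_axis)
qed

text \<open>A relabelling of coordinates maps boxes to boxes and only permutes the factors of the
  volume.\<close>

lemma lborel_distr_reindex:
  fixes b :: "'m::finite \<Rightarrow> 'n::finite"
  assumes b: "bij b"
  shows "distr lborel borel (reindex b) = lborel"
proof (rule lborel_eqI[symmetric])
  fix l u :: "real^'m"
  assume "\<And>e. e \<in> Basis \<Longrightarrow> l \<bullet> e \<le> u \<bullet> e"
  from this[of "axis _ 1"] have lu: "l $ i \<le> u $ i" for i
    by (auto simp: inner_axis Basis_vec_def)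
  have pre: "reindex b -` box l u = box (reindex (inv b) l) (reindex (inv b) u)"
    using b by (auto simp: mem_box_cart reindex_def) (metis bij_inv_eq_iff)+
  have "emeasure (distr lborel borel (reindex b)) (box l u)
      = emeasure lborel (box (reindex (inv b) l) (reindex (inv b) u))"
    by (subst emeasure_distr) (auto simp: pre)
  also have "\<dots> = (\<Prod>e\<in>Basis. (reindex (inv b) u - reindex (inv b) l) \<bullet> e)"
    using lu by (intro emeasure_lborel_box) (auto simp: Basis_vec_def reindex_def inner_axis)
  also have "\<dots> = (\<Prod>i\<in>UNIV. (u - l) $ inv b i)"
    unfolding prod_Basis_cart by (simp add: reindex_def)
  also have "\<dots> = (\<Prod>i\<in>UNIV. (u - l) $ i)"
    using prod.reindex_bij_betw[OF bij_imp_bij_inv[OF b], of "\<lambda>i. (u - l) $ i"] by simp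
  finally show "emeasure (distr lborel borel (reindex b)) (box l u) = (\<Prod>e\<in>Basis. (u - l) \<bullet> e)"
    unfolding prod_Basis_cart .
qed simp

lemma lborel_distr_orthogonal_wellorder:
  fixes f :: "real^'m::{finite,wellorder} \<Rightarrow> real^'m::_"
  assumes "orthogonal_transformation f"
  shows "distr lborel borel f = lborel"
proof (rule lborel_eqI[symmetric])
  fix l u :: "real^'m::_"
  assume lu: "\<And>e. e \<in> Basis \<Longrightarrow> l \<bullet> e \<le> u \<bullet> e"
  have bij: "bij f" by (rule orthogonal_transformation_bij[OF assms])
  have oi: "orthogonal_transformation (inv f)" by (rule orthogonal_transformation_inv[OF assms])
  have [measurable]: "f \<in> borel_measurable borel"
    by (intro linear_borel_measurable orthogonal_transformation_linear assms)
  have vim: "f -` box l u = inv f ` box l u" by (rule bij_vimage_eq_inv_image[OF bij])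
  have meas: "f -` box l u \<in> sets borel"
    using measurable_sets[OF \<open>f \<in> borel_measurable borel\<close>, of "box l u"] by simp
  have lm: "f -` box l u \<in> lmeasurable"
    unfolding vim by (rule measurable_orthogonal_image[OF oi lmeasurable_box])
  have "emeasure (distr lborel borel f) (box l u) = emeasure lborel (f -` box l u)"
    by (subst emeasure_distr) auto
  also have "\<dots> = emeasure lebesgue (f -` box l u)"
    using meas by (simp add: emeasure_completion)
  also have "\<dots> = measure lebesgue (f -` box l u)"
    by (rule emeasure_eq_measure2[OF lm])
  also have "\<dots> = measure lebesgue (box l u)"
    unfolding vim by (simp add: measure_orthogonal_image[OF oi lmeasurable_box])
  also have "\<dots> = emeasure lborel (box l u)"
    using emeasure_eq_measure2[OF lmeasurable_box, of l u] by (simp add: emeasure_completion)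
  finally show "emeasure (distr lborel borel f) (box l u) = (\<Prod>e\<in>Basis. (u - l) \<bullet> e)"
    using lu by simp
qed simp

text \<open>Relabelling preserves inner products and the measure, so conjugation with it carries the
  statement over from the well-ordered copy of the index type.\<close>

lemma lborel_distr_orthogonal:
  fixes f :: "real^'n::finite \<Rightarrow> real^'n"
  assumes f: "orthogonal_transformation f"
  shows "distr lborel borel f = lborel"
proof -
  obtain b :: "'n widx \<Rightarrow> 'n" where b: "bij b" using ex_bij_widx by blast
  let ?T = "reindex b" and ?T' = "reindex (inv b)"
  have b': "bij (inv b)" using b by (rule bij_imp_bij_inv)
  have [measurable]: "f \<in> borel_measurable borel"
    by (intro linear_borel_measurable orthogonal_transformation_linear f)
  define g where "g = ?T \<circ> f \<circ> ?T'"
  have "linear g"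
    unfolding g_def using f orthogonal_transformation_linear by (intro linear_compose linear_reindex) auto
  then have g: "orthogonal_transformation g"
    using f by (simp add: orthogonal_transformation_def g_def inner_reindex[OF b] inner_reindex[OF b'])
  have [measurable]: "g \<in> borel_measurable borel"
    unfolding g_def by measurable
  have "distr lborel borel f = distr (distr lborel borel ?T') borel f"
    by (simp add: lborel_distr_reindex[OF b'])
  also have "\<dots> = distr lborel borel (f \<circ> ?T')"
    by (subst distr_distr) auto
  also have "f \<circ> ?T' = ?T' \<circ> g"
    by (auto simp: fun_eq_iff g_def reindex_inverse[OF b])
  also have "distr lborel borel (?T' \<circ> g) = distr (distr lborel borel g) borel ?T'"
    by (subst distr_distr) auto
  also have "\<dots> = lborel"
    by (simp add: lborel_distr_orthogonal_wellorder[OF g] lborel_distr_reindex[OF b'])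
  finally show ?thesis .
qed

text \<open>After a rotation of a coordinate axis onto the line of y the map is diagonal: the
  eigenvalue is \<open>A + B * (norm y)\<^sup>2\<close> along y and \<open>A\<close> on the
  orthogonal complement.\<close>

lemma abs_det_radial:
  fixes y :: "real^'n::finite"
  shows "\<bar>det (matrix (\<lambda>h. A *\<^sub>R h + (B * (y \<bullet> h)) *\<^sub>R y))\<bar> = \<bar>A\<bar> ^ (CARD('n) - 1) * \<bar>A + B * (norm y)\<^sup>2\<bar>"
proof -
  obtain k :: 'n where True by auto
  let ?L = "\<lambda>h. A *\<^sub>R h + (B * (y \<bullet> h)) *\<^sub>R y"
  define c where "c i = (if i = k then A + B * (norm y)\<^sup>2 else A)" for i
  define Dg where "Dg h = (\<chi> i. c i * h $ i)" for h :: "real^'n"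
  obtain f where f: "orthogonal_transformation f" "f (axis k (norm y)) = y"
    using orthogonal_transformation_exists[of "axis k (norm y)" y] by (auto simp: norm_axis)
  have lf: "linear f" by (rule orthogonal_transformation_linear[OF f(1)])
  then interpret f: linear f .
  have lL: "linear ?L"
    by (rule linearI) (auto simp: inner_add_right scaleR_add_right algebra_simps)
  have lD: "linear Dg"
    by (rule linearI) (auto simp: Dg_def vec_eq_iff algebra_simps)
  have "?L (f h) = f (Dg h)" for h
  proof -
    have Dg: "Dg h = A *\<^sub>R h + (B * norm y * h $ k) *\<^sub>R axis k (norm y)"
      by (auto simp: Dg_def c_def vec_eq_iff axis_def algebra_simps power2_eq_square)
    have "y \<bullet> f h = axis k (norm y) \<bullet> h"
      using f by (metis orthogonal_transformation_def)
    then have yh: "y \<bullet> f h = norm y * h $ k" by (simp add: inner_axis' )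
    show ?thesis
      unfolding Dg f.add f.scaleR f(2) yh by (simp add: mult.assoc)
  qed
  then have "?L \<circ> f = f \<circ> Dg" by (auto simp: fun_eq_iff)
  then have "matrix ?L ** matrix f = matrix f ** matrix Dg"
    using matrix_compose[OF lf lL] matrix_compose[OF lD lf] by simp
  then have "det (matrix ?L) * det (matrix f) = det (matrix f) * det (matrix Dg)"
    by (simp flip: det_mul)
  from arg_cong[OF this, of abs] have "\<bar>det (matrix ?L)\<bar> * \<bar>det (matrix f)\<bar>
      = \<bar>det (matrix f)\<bar> * \<bar>det (matrix Dg)\<bar>"
    by (simp only: abs_mult)
  then have "\<bar>det (matrix ?L)\<bar> = \<bar>det (matrix Dg)\<bar>"
    using orthogonal_transformation_det[OF f(1)] by simp
  also have "det (matrix Dg) = (\<Prod>i\<in>UNIV. c i)"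
    by (subst det_diagonal) (auto simp: matrix_def Dg_def axis_def)
  also have "\<dots> = c k * (\<Prod>i\<in>UNIV - {k}. c i)"
    by (rule prod.remove) auto
  also have "(\<Prod>i\<in>UNIV - {k}. c i) = A ^ (CARD('n) - 1)"
    by (simp add: c_def card_Diff_singleton)
  finally show ?thesis unfolding c_def by (simp only: abs_mult power_abs if_P mult.commute)
qed

lemma has_derivative_radial:
  fixes x :: "'a::euclidean_space"
  assumes "(\<phi> has_real_derivative \<phi>') (at (norm x))" "x \<noteq> 0"
  shows "((\<lambda>x. (\<phi> (norm x) / norm x) *\<^sub>R x) has_derivative
    (\<lambda>h. (\<phi> (norm x) / norm x) *\<^sub>R h + ((\<phi>' - \<phi> (norm x) / norm x) / (norm x)\<^sup>2 * (x \<bullet> h)) *\<^sub>R x)) (at x)"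
proof -
  note n = has_derivative_norm_inner[OF assms(2)]
  have "((\<lambda>t. \<phi> t / t) has_real_derivative ((\<phi>' - \<phi> (norm x) / norm x) / norm x)) (at (norm x))"
    using assms by (auto intro!: derivative_eq_intros simp: divide_simps power2_eq_square)
  then have "((\<lambda>t. \<phi> t / t) has_derivative (*) ((\<phi>' - \<phi> (norm x) / norm x) / norm x)) (at (norm x))"
    by (simp add: has_field_derivative_def)
  from has_derivative_compose[OF n this]
  have "((\<lambda>x. \<phi> (norm x) / norm x) has_derivative (\<lambda>h. (\<phi>' - \<phi> (norm x) / norm x) / (norm x)\<^sup>2 * (x \<bullet> h))) (at x)"
    by (simp add: power2_eq_square mult.assoc field_simps)
  from has_derivative_scaleR[OF this has_derivative_ident] show ?thesis by simp
qed

text \<open>A radial map stretches by \<open>\<phi>'\<close> in the radial direction and by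
  \<open>\<phi> r / r\<close> in the remaining ones, whence the Jacobian. Since g vanishes off the
  image, the integral over the image is the full integral.\<close>

lemma radial_change_of_variables_wellorder:
  fixes g :: "real^'m::{finite,wellorder} \<Rightarrow> real"
  assumes d: "\<And>r. 0 < r \<Longrightarrow> r < 1 \<Longrightarrow> (\<phi> has_real_derivative \<phi>' r) (at r)"
    and pos: "\<And>r. 0 < r \<Longrightarrow> r < 1 \<Longrightarrow> \<phi> r > 0" "\<And>r. 0 < r \<Longrightarrow> r < 1 \<Longrightarrow> \<phi>' r > 0"
    and im: "\<phi> ` {0<..<1} = {0<..<c}"
    and cont: "continuous_on {0<..<1} \<phi>'"
    and g: "integrable lborel g" "\<And>y. y = 0 \<or> norm y \<ge> c \<Longrightarrow> g y = 0"
  shows "integrable lborel (\<lambda>x. indicator (ball 0 1 - {0}) x *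
      (\<phi>' (norm x) * (\<phi> (norm x) / norm x) ^ (CARD('m) - 1) * g ((\<phi> (norm x) / norm x) *\<^sub>R x)))"
    "(LINT x|lborel. indicator (ball 0 1 - {0}) x *
      (\<phi>' (norm x) * (\<phi> (norm x) / norm x) ^ (CARD('m) - 1) * g ((\<phi> (norm x) / norm x) *\<^sub>R x)))
          = (LINT y|lborel. g y)"
proof -
  define S :: "(real^'m::_) set" where "S = ball 0 1 - {0}"
  define \<Psi> where "\<Psi> x = (\<phi> (norm x) / norm x) *\<^sub>R x" for x :: "real^'m::_"
  define \<Psi>' where
      "\<Psi>' x h = (\<phi> (norm x) / norm x) *\<^sub>R h
      + ((\<phi>' (norm x) - \<phi> (norm x) / norm x) / (norm x)\<^sup>2 * (x \<bullet> h)) *\<^sub>R x"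
    for x h :: "real^'m::_"
  define J where "J x = \<phi>' (norm x) * (\<phi> (norm x) / norm x) ^ (CARD('m) - 1)" for x :: "real^'m::_"
  have oS: "open S" by (auto simp: S_def)
  have S: "0 < norm x" "norm x < 1" if "x \<in> S" for x
    using that by (auto simp: S_def)
  have mono: "\<phi> r < \<phi> s" if "0 < r" "r < s" "s < 1" for r s
  proof (rule DERIV_pos_imp_increasing[OF that(2)])
    fix t assume "r \<le> t" "t \<le> s"
    then have "0 < t" "t < 1" using that by auto
    then show "\<exists>y. (\<phi> has_real_derivative y) (at t) \<and> 0 < y"
      using d pos(2) by blast
  qed
  have der: "(\<Psi> has_derivative \<Psi>' x) (at x within S)" if "x \<in> S" for x
    unfolding \<Psi>_def[abs_def] \<Psi>'_def[abs_def]
  proof (rule has_derivative_at_withinI, rule has_derivative_radial)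
    show "(\<phi> has_real_derivative \<phi>' (norm x)) (at (norm x))"
      using S[OF that] by (rule d)
    show "x \<noteq> 0" using S[OF that] by auto
  qed
  have nPsi: "norm (\<Psi> x) = \<phi> (norm x)" if "x \<in> S" for x
    using S[OF that] pos(1)[of "norm x"] by (simp add: \<Psi>_def)
  have inj: "inj_on \<Psi> S"
  proof (rule inj_onI)
    fix x y assume *: "x \<in> S" "y \<in> S" "\<Psi> x = \<Psi> y"
    then have "\<phi> (norm x) = \<phi> (norm y)" using nPsi by metis
    then have "norm x = norm y"
      using mono[of "norm x" "norm y"] mono[of "norm y" "norm x"] S[OF *(1)] S[OF *(2)]
      by (metis less_irrefl linorder_neqE_linordered_idom)
    with *(3) show "x = y"
      using S[OF *(2)] pos(1)[of "norm y"] by (auto simp: \<Psi>_def)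
  qed
  have detJ: "\<bar>det (matrix (\<Psi>' x))\<bar> = J x" if "x \<in> S" for x
  proof -
    \<comment> \<open>This is the radial eigenvalue \<open>A + B * (norm x)\<^sup>2\<close> of
      \<open>abs_det_radial\<close> for the derivative at hand.\<close>
    have "\<phi> (norm x) / norm x + (\<phi>' (norm x) - \<phi> (norm x) / norm x) / (norm x)\<^sup>2 * (norm x)\<^sup>2 = \<phi>' (norm x)"
      using S[OF that] by simp
    then show ?thesis
      unfolding \<Psi>'_def abs_det_radial using S[OF that] pos[of "norm x"] by (simp add: J_def mult.commute)
  qed
  have im\<Psi>: "\<Psi> ` S = ball 0 c - {0}"
  proof (intro subset_antisym subsetI)
    fix y assume "y \<in> \<Psi> ` S"
    then obtain x where x: "x \<in> S" "y = \<Psi> x" by auto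
    then have "\<phi> (norm x) \<in> {0<..<c}" using S[of x] im by auto
    then show "y \<in> ball 0 c - {0}" using nPsi[OF x(1)] x(2) by auto
  next
    fix y :: "real^'m::_" assume "y \<in> ball 0 c - {0}"
    then have y: "y \<in> ball 0 c" "y \<noteq> 0" by auto
    then have "norm y \<in> \<phi> ` {0<..<1}" using im by auto
    then obtain r where r: "0 < r" "r < 1" "norm y = \<phi> r" by auto
    have "\<Psi> ((r / norm y) *\<^sub>R y) = y" "(r / norm y) *\<^sub>R y \<in> S"
      using r y pos(1)[OF r(1,2)] by (auto simp: \<Psi>_def S_def)
    then show "y \<in> \<Psi> ` S" by (metis imageI)
  qed
  have mS: "S \<in> sets lebesgue" using oS by simp
  have g': "y \<noteq> 0 \<and> norm y < c" if "g y \<noteq> 0" for y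
    using g(2)[of y] that by (meson not_le)
  have gi: "g absolutely_integrable_on (\<Psi> ` S)"
  proof -
    have "integrable lebesgue g"
      using g(1) by (subst integrable_completion) auto
    moreover have "(\<lambda>x. indicator (\<Psi> ` S) x *\<^sub>R g x) = g"
      using g' by (auto simp: im\<Psi> fun_eq_iff indicator_def)
    ultimately show ?thesis by (simp add: set_integrable_def)
  qed
  have gL: "integral (\<Psi> ` S) g = (LINT y|lborel. g y)"
  proof -
    have "(\<lambda>x. indicator (\<Psi> ` S) x *\<^sub>R g x) = g"
      using g' by (auto simp: im\<Psi> fun_eq_iff indicator_def)
    then show ?thesis
      using set_borel_integral_eq_integral(2)[of "\<Psi> ` S" g] g(1)
      by (simp add: set_integrable_def set_lebesgue_integral_def)
  qed
  \<comment> \<open>The substitution theorem is applied to vector-valued integrands, so the scalar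
    function is viewed with values in \<open>real^1\<close>.\<close>
  let ?v = "\<lambda>y. vec (g y) :: real^1"
  have "(\<lambda>x. \<bar>det (matrix (\<Psi>' x))\<bar> *\<^sub>R ?v (\<Psi> x)) absolutely_integrable_on S \<and>
      integral S (\<lambda>x. \<bar>det (matrix (\<Psi>' x))\<bar> *\<^sub>R ?v (\<Psi> x)) = vec (LINT y|lborel. g y)"
  proof (rule has_absolute_integral_change_of_variables[OF mS der inj, THEN iffD2])
    show "?v absolutely_integrable_on \<Psi> ` S \<and> integral (\<Psi> ` S) ?v = vec (LINT y|lborel. g y)"
      using gi gL by (simp add: absolutely_integrable_on_1_iff integral_on_1_eq)
  qed
  then have 1: "(\<lambda>x. \<bar>det (matrix (\<Psi>' x))\<bar> * g (\<Psi> x)) absolutely_integrable_on S"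
      "integral S (\<lambda>x. \<bar>det (matrix (\<Psi>' x))\<bar> * g (\<Psi> x)) = (LINT y|lborel. g y)"
    by (simp_all add: absolutely_integrable_on_1_iff integral_on_1_eq vec_eq_iff)
  let ?F = "\<lambda>x. indicator S x * (J x * g (\<Psi> x))"
  have F: "(\<lambda>x. indicator S x *\<^sub>R (\<bar>det (matrix (\<Psi>' x))\<bar> * g (\<Psi> x))) = ?F"
    by (auto simp: fun_eq_iff indicator_def detJ)
  have i1: "integrable lebesgue ?F"
    using 1(1) unfolding set_integrable_def F .
  have i2: "(LINT x|lebesgue. ?F x) = (LINT y|lborel. g y)"
    using set_lebesgue_integral_eq_integral(2)[OF 1(1)] 1(2) unfolding set_lebesgue_integral_def F by simp
  \<comment> \<open>So far everything refers to the Lebesgue completion. Borel measurability of the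
    transformed integrand brings integrability and integral back to \<open>lborel\<close>.\<close>
  have n_in: "norm ` S \<subseteq> {0<..<1}" using S by auto
  have c\<phi>: "continuous_on {0<..<1} \<phi>"
    by (rule continuous_at_imp_continuous_on) (use d DERIV_isCont in force)
  have cn: "continuous_on S (\<lambda>x. \<phi> (norm x))" "continuous_on S (\<lambda>x. \<phi>' (norm x))"
    using n_in by (auto intro!: continuous_on_compose2[OF c\<phi>] continuous_on_compose2[OF cont] continuous_intros)
  have cJ: "continuous_on S J" "continuous_on S \<Psi>"
    unfolding J_def[abs_def] \<Psi>_def[abs_def] using S by (auto intro!: continuous_intros cn)
  have [measurable]: "S \<in> sets borel" using oS by simp
  have m1: "(\<lambda>x. if x \<in> S then J x else 0) \<in> borel_measurable borel"
    by (intro borel_measurable_continuous_on_if cJ) auto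
  have m2: "(\<lambda>x. if x \<in> S then \<Psi> x else 0) \<in> borel_measurable borel"
    by (intro borel_measurable_continuous_on_if cJ) auto
  have m3: "g \<in> borel_measurable borel" using g(1) by auto
  have "?F = (\<lambda>x. indicator S x * ((if x \<in> S then J x else 0) * g (if x \<in> S then \<Psi> x else 0)))"
    by (auto simp: fun_eq_iff)
  also have "\<dots> \<in> borel_measurable borel"
    using m1 measurable_compose[OF m2 m3] by measurable
  finally have Fm: "?F \<in> borel_measurable lborel" by simp
  show "integrable lborel (\<lambda>x. indicator (ball 0 1 - {0}) x *
      (\<phi>' (norm x) * (\<phi> (norm x) / norm x) ^ (CARD('m) - 1) * g ((\<phi> (norm x) / norm x) *\<^sub>R x)))"
    using i1 unfolding integrable_completion[OF Fm] by (simp add: S_def J_def \<Psi>_def)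
  show "(LINT x|lborel. indicator (ball 0 1 - {0}) x *
      (\<phi>' (norm x) * (\<phi> (norm x) / norm x) ^ (CARD('m) - 1) * g ((\<phi> (norm x) / norm x) *\<^sub>R x)))
          = (LINT y|lborel. g y)"
    using i2 unfolding integral_completion[OF Fm] by (simp add: S_def J_def \<Psi>_def)
qed

lemma radial_change_of_variables:
  fixes g :: "real^'n::finite \<Rightarrow> real"
  assumes d: "\<And>r. 0 < r \<Longrightarrow> r < 1 \<Longrightarrow> (\<phi> has_real_derivative \<phi>' r) (at r)"
    and pos: "\<And>r. 0 < r \<Longrightarrow> r < 1 \<Longrightarrow> \<phi> r > 0" "\<And>r. 0 < r \<Longrightarrow> r < 1 \<Longrightarrow> \<phi>' r > 0"
    and im: "\<phi> ` {0<..<1} = {0<..<c}"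
    and cont: "continuous_on {0<..<1} \<phi>'"
    and g: "integrable lborel g" "\<And>y. y = 0 \<or> norm y \<ge> c \<Longrightarrow> g y = 0"
  defines "F \<equiv> \<lambda>x. indicator (ball 0 1 - {0}) x *
      (\<phi>' (norm x) * (\<phi> (norm x) / norm x) ^ (CARD('n) - 1) * g ((\<phi> (norm x) / norm x) *\<^sub>R x))"
  shows "integrable lborel F" "(LINT x|lborel. F x) = (LINT y|lborel. g y)"
proof -
  obtain b :: "'n widx \<Rightarrow> 'n" where b: "bij b" using ex_bij_widx by blast
  let ?T = "reindex b" and ?T' = "reindex (inv b)"
  have b': "bij (inv b)" using b by (rule bij_imp_bij_inv)
  have card: "CARD('n widx) = CARD('n)"
    using type_definition.card[OF type_definition_widx[where 'n='n]] by simp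
  define G where "G z = g (?T' z)" for z
  have gm: "g \<in> borel_measurable borel" using g(1) by auto
  have di: "distr lborel borel ?T' = lborel" by (rule lborel_distr_reindex[OF b'])
  have di': "distr lborel borel ?T = lborel" by (rule lborel_distr_reindex[OF b])
  have Gi: "integrable lborel G"
    unfolding G_def using g(1) gm by (subst integrable_distr_eq[symmetric, of _ _ borel]) (auto simp: di)
  have GL: "(LINT z|lborel. G z) = (LINT y|lborel. g y)"
    unfolding G_def using gm by (subst integral_distr[symmetric, of _ _ borel]) (auto simp: di)
  have G0: "G z = 0" if "z = 0 \<or> norm z \<ge> c" for z
    unfolding G_def by (rule g(2)) (use that norm_reindex[OF b',
        of z] in \<open>auto simp: linear_0[OF linear_reindex]\<close>)
  let ?H = "\<lambda>z::real^'n widx. indicator (ball 0 1 - {0}) z *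
      (\<phi>' (norm z) * (\<phi> (norm z) / norm z) ^ (CARD('n widx) - 1) * G ((\<phi> (norm z) / norm z) *\<^sub>R z))"
  note R = radial_change_of_variables_wellorder[OF d pos im cont Gi G0]
  have FH: "F = (\<lambda>x. ?H (?T x))"
  proof
    fix x :: "real^'n"
    have "?T x = 0 \<longleftrightarrow> x = 0" using norm_reindex[OF b, of x] by (metis norm_eq_zero)
    moreover have "G ((\<phi> (norm x) / norm x) *\<^sub>R ?T x) = g ((\<phi> (norm x) / norm x) *\<^sub>R x)"
      by (simp add: G_def linear_cmul[OF linear_reindex] reindex_inverse[OF b])
    ultimately show "F x = ?H (?T x)"
      by (simp add: F_def norm_reindex[OF b] card indicator_def)
  qed
  have Hm: "?H \<in> borel_measurable borel" using R(1) by auto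
  show "integrable lborel F"
    unfolding FH using R(1) Hm by (subst integrable_distr_eq[symmetric, of _ _ borel]) (auto simp: di')
  have "(LINT x|lborel. F x) = (LINT z|lborel. ?H z)"
    unfolding FH using Hm by (subst integral_distr[symmetric, of _ _ borel]) (auto simp: di')
  also have "\<dots> = (LINT y|lborel. g y)" using R(2) GL by simp
  finally show "(LINT x|lborel. F x) = (LINT y|lborel. g y)" .
qed

section \<open>Weighted integrals and their convergence\<close>

lemma powr_lt_one: "0 < r \<Longrightarrow> r < 1 \<Longrightarrow> s > 0 \<Longrightarrow> r powr s < (1::real)"
  using powr_less_mono2[of s r 1] by simp

text \<open>Obtained from the radial substitution \<open>r \<mapsto> r powr (1 - \<beta> / n)\<close>, whose Jacobian is a multiple of
  the integrand.\<close>

lemma integrable_norm_powr_ball: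
  fixes \<beta> :: real
  assumes "\<beta> < CARD('n::finite)"
  shows "integrable lborel (\<lambda>x::real^'n. indicator (ball 0 1) x * norm x powr (- \<beta>))"
proof -
  \<comment> \<open>With this exponent the Jacobian is \<open>s\<close> times the power
    \<open>n * (s - 1) = - \<beta>\<close> of the radius.\<close>
  define s where "s = 1 - \<beta> / CARD('n)"
  have n: "real CARD('n) > 0" by simp
  have s: "s > 0" using assms n by (simp add: s_def field_simps)
  let ?g = "indicator (ball 0 1 - {0}) :: real^'n \<Rightarrow> real"
  have im: "(\<lambda>r. r powr s) ` {0<..<1} = {0<..<1}"
  proof (intro subset_antisym subsetI)
    fix y assume "y \<in> (\<lambda>r. r powr s) ` {0<..<1::real}"
    then show "y \<in> {0<..<1}" using s by (auto intro: powr_lt_one)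
  next
    fix y :: real assume y: "y \<in> {0<..<1}"
    then have "(y powr (1 / s)) powr s = y" "y powr (1 / s) \<in> {0<..<1}"
      using s by (auto simp: powr_powr intro: powr_lt_one)
    then show "y \<in> (\<lambda>r. r powr s) ` {0<..<1::real}" by (metis imageI)
  qed
  have gi: "integrable lborel ?g"
  proof (rule integrable_real_indicator)
    have "emeasure lborel (ball 0 1 - {0::real^'n}) \<le> emeasure lborel (cball 0 (1::real) :: (real^'n) set)"
      by (intro emeasure_mono) auto
    also have "\<dots> < \<infinity>" by (rule emeasure_lborel_cball_finite)
    finally show "emeasure lborel (ball 0 1 - {0::real^'n}) < \<infinity>" .
  qed auto
  have "integrable lborel (\<lambda>x. indicator (ball 0 1 - {0}) x *
      ((s * norm x powr (s - 1)) * (norm x powr s / norm x) ^ (CARD('n) - 1) * ?g ((norm x powr s / norm x) *\<^sub>R x)))"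
    by (rule radial_change_of_variables(1)[OF _ _ _ im _ gi])
      (use s in \<open>auto intro!: derivative_eq_intros continuous_intros simp: powr_diff\<close>)
  moreover have eq: "indicator (ball 0 1 - {0}) x *
      ((s * norm x powr (s - 1)) * (norm x powr s / norm x) ^ (CARD('n) - 1) * ?g ((norm x powr s / norm x) *\<^sub>R x))
      = s * (indicator (ball 0 1) x * norm x powr (- \<beta>))" for x :: "real^'n"
  proof (cases "x \<in> ball 0 1 - {0}")
    case True
    then have r: "0 < norm x" "norm x < 1" by auto
    have "norm ((norm x powr s / norm x) *\<^sub>R x) = norm x powr s" using r by simp
    then have "?g ((norm x powr s / norm x) *\<^sub>R x) = 1"
      using r s by (auto simp: indicator_def intro!: powr_lt_one)
    moreover have "norm x powr s / norm x = norm x powr (s - 1)"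
      using r by (simp add: powr_diff)
    moreover have "(norm x powr (s - 1)) ^ (CARD('n) - 1) = norm x powr ((s - 1) * (real CARD('n) - 1))"
      using r by (simp add: powr_power of_nat_diff mult.commute)
    moreover have "s - 1 + (s - 1) * (real CARD('n) - 1) = - \<beta>"
      using n by (simp add: s_def field_simps)
    ultimately show ?thesis
      using True r by (simp add: powr_add[symmetric] mult.assoc)
  qed (auto simp: indicator_def)
  ultimately have "integrable lborel (\<lambda>x::real^'n. s * (indicator (ball 0 1) x * norm x powr (- \<beta>)))"
    by (simp only:)
  then show ?thesis
    using s by simp
qed

lemma integrable_norm_powr:
  fixes \<beta> :: real
  assumes "0 \<le> \<beta>" "\<beta> < CARD('n::finite)"
  shows "integrable lborel (\<lambda>x::real^'n. indicator (cball 0 R) x * norm x powr (- \<beta>))"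
proof (rule Bochner_Integration.integrable_bound)
  have "integrable lborel (indicator (cball 0 R) :: real^'n \<Rightarrow> real)"
    by (rule integrable_real_indicator) (auto intro: emeasure_lborel_cball_finite[unfolded infinity_ennreal_def])
  then show "integrable lborel (\<lambda>x::real^'n. indicator (ball 0 1) x * norm x powr (- \<beta>)
      + indicator (cball 0 R) x)"
    by (intro Bochner_Integration.integrable_add integrable_norm_powr_ball assms)
  have "norm x powr (- \<beta>) \<le> 1" if "norm x \<ge> 1" for x :: "real^'n"
    using powr_mono[of "- \<beta>" 0 "norm x"] that assms by (cases "x = 0") auto
  then show "AE x in lborel. norm (indicator (cball 0 R) x * norm x powr (- \<beta>))
      \<le> norm (indicator (ball 0 1) x * norm x powr (- \<beta>) + indicator (cball 0 R) (x::real^'n))"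
    by (intro AE_I2) (auto simp: indicator_def)
next
  have "(\<lambda>x::real^'n. norm x powr (- \<beta>)) \<in> borel_measurable borel" by measurable
  then show "(\<lambda>x::real^'n. indicator (cball 0 R) x * norm x powr (- \<beta>)) \<in> borel_measurable lborel"
    by (intro borel_measurable_times borel_measurable_indicator) auto
qed

text \<open>The dominating function is a multiple of an integrable power on a ball. Bound and limit
  are asked away from the origin only, since weights are singular there and cut-off functions need
  not converge there.\<close>

lemma norm_powr_dominated_convergence:
  fixes H :: "nat \<Rightarrow> real^'n::finite \<Rightarrow> real" and \<beta> :: real
  assumes "0 \<le> \<beta>" "\<beta> < CARD('n)"
    and [measurable]: "\<And>j. H j \<in> borel_measurable borel" "h \<in> borel_measurable borel"
    and bound: "\<And>j x. x \<noteq> 0 \<Longrightarrow> norm x \<le> R \<Longrightarrow> \<bar>H j x\<bar> \<le> C * norm x powr (- \<beta>)"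
    and zero: "\<And>j x. norm x > R \<Longrightarrow> H j x = 0"
    and lim: "\<And>x. x \<noteq> 0 \<Longrightarrow> (\<lambda>j. H j x) \<longlonglongrightarrow> h x"
  shows "\<And>j. integrable lborel (H j)" "integrable lborel h"
    "(\<lambda>j. LINT x|lborel. H j x) \<longlonglongrightarrow> (LINT x|lborel. h x)"
proof -
  have i: "integrable lborel (\<lambda>x::real^'n. C * (indicator (cball 0 R) x * norm x powr (- \<beta>)))"
    by (intro integrable_mult_right integrable_norm_powr assms)
  have nz: "AE x in lborel. x \<noteq> (0::real^'n)" by (rule AE_lborel_singleton)
  have l: "AE x in lborel. (\<lambda>j. H j x) \<longlonglongrightarrow> h x"
    using nz by eventually_elim (rule lim)
  have b: "AE x in lborel. norm (H j x) \<le> C * (indicator (cball 0 R) x * norm x powr (- \<beta>))" for j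
    using nz
  proof eventually_elim
    case (elim x)
    then show ?case
      using bound[OF elim, of j] zero[of x j] by (cases "norm x \<le> R") auto
  qed
  \<comment> \<open>Dominated convergence is applied to a constant sequence.\<close>
  show "integrable lborel (H j)" for j
    by (rule integrable_dominated_convergence2[where s = "\<lambda>_. H j" and f = "H j" and w =
        "\<lambda>x. C * (indicator (cball 0 R) x * norm x powr (- \<beta>))"]) (use i b in auto)
  show "integrable lborel h"
    by (rule integrable_dominated_convergence[OF _ _ i l b]) auto
  show "(\<lambda>j. LINT x|lborel. H j x) \<longlonglongrightarrow> (LINT x|lborel. h x)"
    by (rule integral_dominated_convergence[OF _ _ i l b]) auto
qed

section \<open>The integrals of the problem and their limits\<close>

definition dirichlet :: "(real^'n::finite \<Rightarrow> real) \<Rightarrow> real"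
  where "dirichlet f = (LINT x|lborel. (norm (grad f x))\<^sup>2)"

text \<open>The exponent runs from -2 at \<open>p = 2\<close>, the Hardy weight, up to 0 at the
  critical Sobolev exponent. Its sign is what polarization uses.\<close>

definition hs_exponent :: "'n::finite itself \<Rightarrow> real \<Rightarrow> real"
  where "hs_exponent _ p = p * (real CARD('n) - 2) / 2 - real CARD('n)"

definition hs_integral :: "real \<Rightarrow> (real^'n::finite \<Rightarrow> real) \<Rightarrow> real"
  where "hs_integral p f = (LINT x|lborel. norm x powr hs_exponent TYPE('n) p * \<bar>f x\<bar> powr p)"

lemma C1_measurable:
  fixes f :: "real^'n::finite \<Rightarrow> real"
  assumes "C1_on UNIV f"
  shows "f \<in> borel_measurable borel" "grad f \<in> borel_measurable borel"
  using assms by (auto intro: borel_measurable_continuous_onI C1_on_imp_continuous_on C1_on_imp_continuous_on_grad)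

lemma hs_exponent_bounds:
  assumes "CARD('n::finite) \<ge> 3" "2 < p" "p \<le> 2 * real CARD('n) / (real CARD('n) - 2)"
  shows "hs_exponent TYPE('n) p \<le> 0" "- hs_exponent TYPE('n) p < CARD('n)"
proof -
  have n: "real CARD('n) - 2 > 0" using assms(1) by linarith
  have "p * (real CARD('n) - 2) \<le> 2 * real CARD('n)" using assms(3) n by (simp add: field_simps)
  then show "hs_exponent TYPE('n) p \<le> 0" by (simp add: hs_exponent_def)
  have "p * (real CARD('n) - 2) > 0" using assms(2) n by simp
  then show "- hs_exponent TYPE('n) p < CARD('n)" by (simp add: hs_exponent_def)
qed

lemma X_log_bounds:
  assumes "0 < \<alpha>" "ln \<alpha> < 1" "0 < r" "r \<le> 1"
  shows "0 < X_log (\<alpha> * r)" "X_log (\<alpha> * r) \<le> 1 / (1 - ln \<alpha>)"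
proof -
  have "ln (\<alpha> * r) \<le> ln \<alpha>" using assms by (subst ln_mult) auto
  moreover from this have "ln (\<alpha> * r) < 1" using assms by linarith
  ultimately show "0 < X_log (\<alpha> * r)" "X_log (\<alpha> * r) \<le> 1 / (1 - ln \<alpha>)"
    using assms by (auto simp: X_log_def intro!: divide_left_mono mult_pos_pos)
qed

lemma X_log_measurable [measurable]: "X_log \<in> borel_measurable borel"
  unfolding X_log_def[abs_def] by measurable

context
  fixes p :: real and f :: "nat \<Rightarrow> real^'n::finite \<Rightarrow> real" and g :: "real^'n \<Rightarrow> real" and R :: real
  assumes n3: "CARD('n) \<ge> 3" and p: "2 < p" "p \<le> 2 * real CARD('n) / (real CARD('n) - 2)"
    and approx: "C1_approx R f g"
begin

lemma C1_approx_measurable: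
  "f j \<in> borel_measurable borel" "grad (f j) \<in> borel_measurable borel"
  "g \<in> borel_measurable borel" "grad g \<in> borel_measurable borel"
  using approx by (auto simp: C1_approx_def intro: C1_measurable)

lemma C1_approx_bounds:
  obtains M where "M \<ge> 0" "\<And>j x. \<bar>f j x\<bar> \<le> M" "\<And>j x. norm x * norm (grad (f j) x) \<le> M"
proof -
  obtain M where M: "\<And>j x. \<bar>f j x\<bar> \<le> M \<and> norm x * norm (grad (f j) x) \<le> M"
    using approx by (auto simp: C1_approx_def)
  then have "M \<ge> 0" using abs_ge_zero order_trans by blast
  then show ?thesis using that M by blast
qed

lemma C1_approx_zero: "norm x > R \<Longrightarrow> f j x = 0" "norm x > R \<Longrightarrow> grad (f j) x = 0"
  using approx by (auto simp: C1_approx_def intro!: grad_eq_0_outside_cball[of R])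

lemma C1_approx_tendsto: "x \<noteq> 0 \<Longrightarrow> (\<lambda>j. f j x) \<longlonglongrightarrow> g x" "x \<noteq> 0 \<Longrightarrow> (\<lambda>j. grad (f j) x) \<longlonglongrightarrow> grad g x"
  using approx by (auto simp: C1_approx_def)

text \<open>The bound on \<open>norm x * norm (grad (f j) x)\<close> dominates the squared gradients
  by a multiple of \<open>norm x powr (- 2)\<close>, which is locally integrable because the
  dimension is at least 3.\<close>

lemma C1_approx_gradient_integral:
  fixes W :: "real^'n \<Rightarrow> real"
  assumes [measurable]: "W \<in> borel_measurable borel" and W: "\<And>x. \<bar>W x\<bar> \<le> B"
  shows "(\<lambda>j. LINT x|lborel. W x * (norm (grad (f j) x))\<^sup>2) \<longlonglongrightarrow> (LINT x|lborel. W x * (norm (grad g x))\<^sup>2)"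
    "integrable lborel (\<lambda>x. W x * (norm (grad g x))\<^sup>2)"
proof -
  note [measurable] = C1_approx_measurable
  obtain M where M: "M \<ge> 0" "\<And>j x. norm x * norm (grad (f j) x) \<le> M"
    using C1_approx_bounds by metis
  have b: "\<bar>W x * (norm (grad (f j) x))\<^sup>2\<bar> \<le> (B * M\<^sup>2) * norm x powr (- 2)" if "x \<noteq> 0" for x j
  proof -
    have "(norm x * norm (grad (f j) x))\<^sup>2 \<le> M\<^sup>2"
      using M(2)[of x j] by (intro power_mono) auto
    then have "(norm (grad (f j) x))\<^sup>2 \<le> M\<^sup>2 * norm x powr (- 2)"
      using that by (simp add: power_mult_distrib powr_minus powr_numeral field_simps)
    then have "\<bar>W x\<bar> * (norm (grad (f j) x))\<^sup>2 \<le> B * (M\<^sup>2 * norm x powr (- 2))"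
      using W[of x] by (intro mult_mono) auto
    then show ?thesis by (simp add: abs_mult mult.assoc)
  qed
  have t: "(\<lambda>j. W x * (norm (grad (f j) x))\<^sup>2) \<longlonglongrightarrow> W x * (norm (grad g x))\<^sup>2" if "x \<noteq> 0" for x
    by (intro tendsto_intros C1_approx_tendsto(2)[OF that])
  show "(\<lambda>j. LINT x|lborel. W x * (norm (grad (f j) x))\<^sup>2) \<longlonglongrightarrow> (LINT x|lborel. W x * (norm (grad g x))\<^sup>2)"
    "integrable lborel (\<lambda>x. W x * (norm (grad g x))\<^sup>2)"
    by (rule norm_powr_dominated_convergence[where \<beta> = 2 and R = R and C = "B * M\<^sup>2" and
       H = "\<lambda>j x. W x * (norm (grad (f j) x))\<^sup>2"]; use n3 b t C1_approx_zero(2) in simp)+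
qed

lemma C1_approx_function_integral:
  fixes W :: "real^'n \<Rightarrow> real" and \<beta> :: real
  assumes [measurable]: "W \<in> borel_measurable borel"
    and W: "\<And>x. x \<noteq> 0 \<Longrightarrow> \<bar>W x\<bar> \<le> B * norm x powr (- \<beta>)"
    and "0 \<le> \<beta>" "\<beta> < CARD('n)" "q > 0"
  shows "(\<lambda>j. LINT x|lborel. W x * \<bar>f j x\<bar> powr q) \<longlonglongrightarrow> (LINT x|lborel. W x * \<bar>g x\<bar> powr q)"
    "integrable lborel (\<lambda>x. W x * \<bar>g x\<bar> powr q)"
proof -
  note [measurable] = C1_approx_measurable
  obtain M where M: "M \<ge> 0" "\<And>j x. \<bar>f j x\<bar> \<le> M"
    using C1_approx_bounds by metis
  have b: "\<bar>W x * \<bar>f j x\<bar> powr q\<bar> \<le> (B * M powr q) * norm x powr (- \<beta>)" if "x \<noteq> 0" for x j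
  proof -
    have "\<bar>f j x\<bar> powr q \<le> M powr q"
      using M(2)[of j x] \<open>q > 0\<close> by (intro powr_mono2) auto
    then have "\<bar>W x\<bar> * \<bar>f j x\<bar> powr q \<le> (B * norm x powr (- \<beta>)) * M powr q"
      using W[OF that] by (intro mult_mono) (auto intro: order_trans)
    then show ?thesis by (simp add: abs_mult mult_ac)
  qed
  have t: "(\<lambda>j. W x * \<bar>f j x\<bar> powr q) \<longlonglongrightarrow> W x * \<bar>g x\<bar> powr q" if "x \<noteq> 0" for x
    by (intro tendsto_intros tendsto_powr' C1_approx_tendsto(1)[OF that]) (use \<open>q > 0\<close> in auto)
  show "(\<lambda>j. LINT x|lborel. W x * \<bar>f j x\<bar> powr q) \<longlonglongrightarrow> (LINT x|lborel. W x * \<bar>g x\<bar> powr q)"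
    "integrable lborel (\<lambda>x. W x * \<bar>g x\<bar> powr q)"
    by (rule norm_powr_dominated_convergence[where \<beta> = \<beta> and R = R and C = "B * M powr q" and
       H = "\<lambda>j x. W x * \<bar>f j x\<bar> powr q"]; use assms b t C1_approx_zero(1) in simp)+
qed

lemma C1_approx_dirichlet: "(\<lambda>j. dirichlet (f j)) \<longlonglongrightarrow> dirichlet g"
  using C1_approx_gradient_integral(1)[of "\<lambda>_. 1" 1] by (simp add: dirichlet_def)

lemma C1_approx_hs_integral: "(\<lambda>j. hs_integral p (f j)) \<longlonglongrightarrow> hs_integral p g"
  unfolding hs_integral_def
  by (rule C1_approx_function_integral(1)[where B = 1 and \<beta> = "- hs_exponent TYPE('n) p"])
     (use hs_exponent_bounds[OF n3 p] p in auto)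

lemma C1_approx_remainders:
  assumes \<alpha>: "0 < \<alpha>" "ln \<alpha> < 1"
  shows "(\<lambda>j. hardy_remainder \<theta> \<alpha> (f j)) \<longlonglongrightarrow> hardy_remainder \<theta> \<alpha> g"
    "(\<lambda>j. weighted_p_integral p \<alpha> (f j)) \<longlonglongrightarrow> weighted_p_integral p \<alpha> g"
    "integrable lborel (\<lambda>x. indicator (ball 0 1) x * (norm (grad g x))\<^sup>2)"
    "integrable lborel (\<lambda>x. indicator (ball 0 1) x * ((g x)\<^sup>2 / (norm x)\<^sup>2))"
    "integrable lborel (\<lambda>x. indicator (ball 0 1) x * ((g x)\<^sup>2 / (norm x)\<^sup>2 * (X_log (\<alpha> * norm x))\<^sup>2))"
proof -
  let ?I = "indicator (ball 0 1) :: real^'n \<Rightarrow> real"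
  let ?W2 = "\<lambda>x::real^'n. ?I x / (norm x)\<^sup>2" and ?W3 =
      "\<lambda>x::real^'n. ?I x / (norm x)\<^sup>2 * (X_log (\<alpha> * norm x))\<^sup>2"
  let ?W4 = "\<lambda>x::real^'n. ?I x * (norm x powr hs_exponent TYPE('n) p * X_log (\<alpha> * norm x) powr ((p + 2) / 2))"
  let ?b = "1 / (1 - ln \<alpha>)"
  have [measurable]: "ball 0 1 \<in> sets (borel :: (real^'n) measure)" by simp
  have mI: "?I \<in> borel_measurable borel" by (rule borel_measurable_indicator) simp
  have bI: "\<bar>?I x\<bar> \<le> 1" for x by (simp add: indicator_def)
  note 1 = C1_approx_gradient_integral[OF mI bI]
  have pw: "norm x powr (- 2) = 1 / (norm x)\<^sup>2" if "x \<noteq> 0" for x :: "real^'n"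
    using that by (simp add: powr_minus powr_numeral field_simps)
  have W2: "\<bar>?W2 x\<bar> \<le> 1 * norm x powr (- 2)" if "x \<noteq> 0" for x
    using that by (simp add: pw indicator_def)
  have n2: "0 \<le> (2::real)" "2 < real CARD('n)" "0 < (2::real)" using n3 by auto
  have m2: "?W2 \<in> borel_measurable borel" by measurable
  note 2 = C1_approx_function_integral[OF m2 W2 n2]
  have W3: "\<bar>?W3 x\<bar> \<le> ?b\<^sup>2 * norm x powr (- 2)" if "x \<noteq> 0" for x
  proof (cases "x \<in> ball 0 1")
    case True
    then have "(X_log (\<alpha> * norm x))\<^sup>2 \<le> ?b\<^sup>2"
      using X_log_bounds[OF \<alpha>, of "norm x"] that by (intro power_mono) auto
    then have "(X_log (\<alpha> * norm x))\<^sup>2 / (norm x)\<^sup>2 \<le> ?b\<^sup>2 / (norm x)\<^sup>2"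
      by (rule divide_right_mono) simp
    then show ?thesis using that True by (simp add: pw abs_mult)
  qed simp
  have m3: "?W3 \<in> borel_measurable borel" by measurable
  note 3 = C1_approx_function_integral[OF m3 W3 n2]
  have W4: "\<bar>?W4 x\<bar> \<le> ?b powr ((p + 2) / 2) * norm x powr (- (- hs_exponent TYPE('n) p))" if "x \<noteq> 0" for x
  proof (cases "x \<in> ball 0 1")
    case True
    then have "X_log (\<alpha> * norm x) powr ((p + 2) / 2) \<le> ?b powr ((p + 2) / 2)"
      using X_log_bounds[OF \<alpha>, of "norm x"] that p by (intro powr_mono2) auto
    then show ?thesis using that True by (simp add: abs_mult mult.commute mult_left_mono)
  qed simp
  have m4: "?W4 \<in> borel_measurable borel" by measurable
  have n4: "0 \<le> - hs_exponent TYPE('n) p" "- hs_exponent TYPE('n) p < real CARD('n)" "0 < p"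
    using p hs_exponent_bounds[OF n3 p] by auto
  note 4 = C1_approx_function_integral(1)[OF m4 W4 n4]
  \<comment> \<open>Squares are written as \<open>powr 2\<close> so that the Hardy terms become
    instances of the general statement with \<open>q = 2\<close>.\<close>
  have sq: "\<bar>t\<bar> powr 2 = t\<^sup>2" for t :: real
    by (cases "t = 0") (auto simp: powr_numeral)
  have e1: "hardy_remainder \<theta> \<alpha> u = (LINT x|lborel. ?I x * (norm (grad u x))\<^sup>2)
    - ((real CARD('n) - 2) / 2)\<^sup>2 * (LINT x|lborel. ?W2 x * \<bar>u x\<bar> powr 2)
    - \<theta> * (1 - \<theta>) * (LINT x|lborel. ?W3 x * \<bar>u x\<bar> powr 2)" for u :: "real^'n \<Rightarrow> real"
    by (simp add: hardy_remainder_def set_lebesgue_integral_def sq mult_ac)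
  have e2: "weighted_p_integral p \<alpha> u = (LINT x|lborel. ?W4 x * \<bar>u x\<bar> powr p)" for u :: "real^'n \<Rightarrow> real"
    by (simp add: weighted_p_integral_def set_lebesgue_integral_def hs_exponent_def mult_ac)
  show "(\<lambda>j. hardy_remainder \<theta> \<alpha> (f j)) \<longlonglongrightarrow> hardy_remainder \<theta> \<alpha> g"
    unfolding e1 by (intro tendsto_intros 1 2 3)
  show "(\<lambda>j. weighted_p_integral p \<alpha> (f j)) \<longlonglongrightarrow> weighted_p_integral p \<alpha> g"
    unfolding e2 by (rule 4)
  show "integrable lborel (\<lambda>x. indicator (ball 0 1) x * (norm (grad g x))\<^sup>2)"
    by (rule 1)
  show "integrable lborel (\<lambda>x. indicator (ball 0 1) x * ((g x)\<^sup>2 / (norm x)\<^sup>2))"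
    using 2(2) by (simp add: sq)
  show "integrable lborel (\<lambda>x. indicator (ball 0 1) x * ((g x)\<^sup>2 / (norm x)\<^sup>2 * (X_log (\<alpha> * norm x))\<^sup>2))"
    using 3(2) by (simp add: sq mult_ac)
qed

end

text \<open>As a constant sequence, a single function gets the integrability statements proved for
  approximations.\<close>

lemma C1_approx_const:
  assumes "C1_on UNIV f" "\<And>x. norm x > R \<Longrightarrow> f x = 0"
  shows "C1_approx R (\<lambda>_. f) f"
proof -
  have c: "continuous_on UNIV f" "continuous_on UNIV (grad f)"
    using assms by (auto intro: C1_on_imp_continuous_on C1_on_imp_continuous_on_grad)
  obtain M1 where M1: "M1 > 0" "\<And>x. norm (f x) \<le> M1"
    using bounded_continuous_compact_support[OF c(1) assms(2)] by blast
  have "norm x *\<^sub>R grad f x = 0" if "norm x > R" for x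
    using grad_eq_0_outside_cball[OF assms(2) that] by simp
  moreover have "continuous_on UNIV (\<lambda>x. norm x *\<^sub>R grad f x)"
    by (intro continuous_intros c)
  ultimately obtain M2 where M2: "M2 > 0" "\<And>x. norm (norm x *\<^sub>R grad f x) \<le> M2"
    using bounded_continuous_compact_support[of "\<lambda>x. norm x *\<^sub>R grad f x" R] by blast
  have "\<bar>f x\<bar> \<le> max M1 M2 \<and> norm x * norm (grad f x) \<le> max M1 M2" for x
    using M1(2)[of x] M2(2)[of x] by (simp add: le_max_iff_disj)
  with assms show ?thesis by (auto simp: C1_approx_def)
qed

section \<open>Cutting off near the origin\<close>

definition radial :: "('a::real_normed_vector \<Rightarrow> 'b) \<Rightarrow> bool"
  where "radial f \<longleftrightarrow> (\<forall>x y. norm x = norm y \<longrightarrow> f x = f y)"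

text \<open>A quadratic spline with knots 1, 3/2 and 2, rising from 0 to 1; its derivative is the
  tent of height 2 over the interval from 1 to 2.\<close>

definition cutoff :: "real \<Rightarrow> real"
  where "cutoff t = 2 * (max 0 (t - 1))\<^sup>2 - 4 * (max 0 (t - 3 / 2))\<^sup>2 + 2 * (max 0 (t - 2))\<^sup>2"

definition cutoff_deriv :: "real \<Rightarrow> real"
  where "cutoff_deriv t = 4 * max 0 (t - 1) - 8 * max 0 (t - 3 / 2) + 4 * max 0 (t - 2)"

lemma has_real_derivative_max_square:
  "((\<lambda>t. (max 0 (t - a))\<^sup>2) has_real_derivative 2 * max 0 (t - a)) (at t)" for a t :: real
proof -
  consider "t < a" | "t = a" | "t > a" by linarith
  then show ?thesis
  proof cases
    case 1
    have "((\<lambda>t. 0) has_real_derivative 2 * max 0 (t - a)) (at t)" using 1 by simp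
    from has_field_derivative_transform_within_open[OF this, of "{..<a}"] 1 show ?thesis by auto
  next
    case 2
    have "((\<lambda>h. (max 0 h)\<^sup>2 / h) \<longlongrightarrow> 0) (at (0::real))"
    proof (rule Lim_transform_eventually)
      have "isCont (max 0) (0::real)" by (intro continuous_intros)
      then show "(max 0 \<longlongrightarrow> 0) (at (0::real))" by (simp add: isCont_def)
      show "\<forall>\<^sub>F h in at 0. max 0 h = (max 0 h)\<^sup>2 / (h::real)"
        unfolding eventually_at_filter by (auto simp: max_def power2_eq_square intro!: always_eventually)
    qed
    then show ?thesis using 2 by (simp add: DERIV_def)
  next
    case 3
    have "((\<lambda>t. (t - a)\<^sup>2) has_real_derivative 2 * max 0 (t - a)) (at t)"
      using 3 by (auto intro!: derivative_eq_intros)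
    from has_field_derivative_transform_within_open[OF this, of "{a<..}"] 3 show ?thesis by auto
  qed
qed

lemma has_real_derivative_cutoff: "(cutoff has_real_derivative cutoff_deriv t) (at t)"
proof -
  have "(cutoff has_real_derivative
      2 * (2 * max 0 (t - 1)) - 4 * (2 * max 0 (t - 3 / 2)) + 2 * (2 * max 0 (t - 2))) (at t)"
    unfolding cutoff_def[abs_def]
    by (intro DERIV_add DERIV_diff DERIV_cmult has_real_derivative_max_square)
  then show ?thesis by (simp add: cutoff_deriv_def)
qed

lemma cutoff_simps:
  "t \<le> 1 \<Longrightarrow> cutoff t = 0" "t \<ge> 2 \<Longrightarrow> cutoff t = 1"
  "t \<le> 1 \<Longrightarrow> cutoff_deriv t = 0" "t \<ge> 2 \<Longrightarrow> cutoff_deriv t = 0"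
  by (auto simp: cutoff_def cutoff_deriv_def power2_eq_square algebra_simps)

lemma cutoff_bounds: "0 \<le> cutoff t" "cutoff t \<le> 1" "\<bar>cutoff_deriv t\<bar> \<le> 2"
proof -
  consider "t \<le> 1" | "1 < t" "t \<le> 3/2" | "3/2 < t" "t \<le> 2" | "t > 2" by linarith
  then have "0 \<le> cutoff t \<and> cutoff t \<le> 1 \<and> \<bar>cutoff_deriv t\<bar> \<le> 2"
  proof cases
    case 2
    have "(t - 1)\<^sup>2 \<le> (1/2)\<^sup>2" using 2 by (intro power_mono) auto
    then show ?thesis using 2 by (auto simp: cutoff_def cutoff_deriv_def power2_eq_square)
  next
    case 3
    have "(2 - t)\<^sup>2 \<le> (1/2)\<^sup>2" using 3 by (intro power_mono) auto
    moreover have "cutoff t = 1 - 2 * (2 - t)\<^sup>2"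
      using 3 by (simp add: cutoff_def power2_eq_square algebra_simps)
    moreover have "cutoff_deriv t = 4 * (2 - t)"
      using 3 by (simp add: cutoff_deriv_def)
    ultimately show ?thesis using 3 by (auto simp: power2_eq_square)
  qed (simp_all add: cutoff_simps)
  then show "0 \<le> cutoff t" "cutoff t \<le> 1" "\<bar>cutoff_deriv t\<bar> \<le> 2" by auto
qed

text \<open>The cutoff at scale \<open>1 / Suc j\<close> has a gradient of order
  \<open>Suc j\<close>, but only where \<open>norm x\<close> is of order \<open>1 / Suc j\<close>;
  hence \<open>norm x\<close> times the gradient is bounded uniformly in j. Using the squared norm
  as argument keeps the cutoff \<open>C^1\<close> at the origin and radial.\<close>

lemma C1_approx_cutoff:
  fixes g :: "real^'n::finite \<Rightarrow> real"
  assumes g: "C1_on UNIV g" "\<And>x. norm x > R \<Longrightarrow> g x = 0"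
  obtains f where "C1_approx R f g" "\<And>j. \<exists>\<delta>>0. \<forall>x. norm x < \<delta> \<longrightarrow> f j x = 0" "\<And>j. radial g \<Longrightarrow> radial (f j)"
proof -
  define f where "f = (\<lambda>j x. cutoff ((real (Suc j))\<^sup>2 * (x \<bullet> x)) * g x)"
  let ?t = "\<lambda>j x::real^'n. (real (Suc j))\<^sup>2 * (x \<bullet> x)"
  have cont: "continuous_on UNIV cutoff_deriv"
    unfolding cutoff_deriv_def[abs_def] by (intro continuous_intros)
  have C1c: "C1_on UNIV (\<lambda>x. cutoff (?t j x))" for j
    by (rule C1_on_compose[OF _ C1_on_real[OF has_real_derivative_cutoff cont]])
       (auto intro!: C1_on_mult C1_on_const C1_on_inner C1_on_ident)
  have C1: "C1_on UNIV (f j)" for j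
    unfolding f_def by (intro C1_on_mult C1c g)
  have gc: "grad (\<lambda>x. cutoff (?t j x)) x = (cutoff_deriv (?t j x) * (real (Suc j))\<^sup>2 * 2) *\<^sub>R x" for j x
  proof (rule grad_eqI)
    have "((\<lambda>x. ?t j x) has_derivative (\<lambda>h. (real (Suc j))\<^sup>2 * (x \<bullet> h + h \<bullet> x))) (at x)"
      by (auto intro!: derivative_eq_intros)
    from has_derivative_compose[OF this has_field_derivative_imp_has_derivative[OF has_real_derivative_cutoff]]
    show "((\<lambda>x. cutoff (?t j x)) has_derivative (\<bullet>) ((cutoff_deriv (?t j x) * (real (Suc j))\<^sup>2 * 2) *\<^sub>R x)) (at x)"
      by (rule has_derivative_eq_rhs) (auto simp: fun_eq_iff inner_commute algebra_simps)
  qed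
  have gf: "grad (f j) x
      = cutoff (?t j x) *\<^sub>R grad g x + (g x * (cutoff_deriv (?t j x) * (real (Suc j))\<^sup>2 * 2)) *\<^sub>R x" for j x
  proof -
    have "(\<lambda>x. cutoff (?t j x)) differentiable (at x)" "g differentiable (at x)"
      using C1c[of j] g(1) by (auto simp: C1_on_def)
    then show ?thesis unfolding f_def by (simp only: grad_mult gc scaleR_scaleR)
  qed
  obtain M where M: "M \<ge> 0" "\<And>x. \<bar>g x\<bar> \<le> M" "\<And>x. norm x * norm (grad g x) \<le> M"
  proof -
    obtain M where M: "\<And>x. \<bar>g x\<bar> \<le> M" "\<And>x. norm x * norm (grad g x) \<le> M"
      using C1_approx_const[OF g] unfolding C1_approx_def by blast
    moreover from this have "M \<ge> 0" using abs_ge_zero order_trans by blast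
    ultimately show ?thesis using that by blast
  qed
  have b1: "\<bar>f j x\<bar> \<le> M" for j x
  proof -
    have "\<bar>f j x\<bar> \<le> 1 * \<bar>g x\<bar>"
      unfolding f_def abs_mult using cutoff_bounds[of "?t j x"] by (intro mult_right_mono) auto
    then show ?thesis using M(2)[of x] by simp
  qed
  have b2: "norm x * norm (grad (f j) x) \<le> M + 8 * M" for j x
  proof -
    have t0: "?t j x \<ge> 0" by simp
    \<comment> \<open>The derivative of the cutoff vanishes beyond 2, so the large factor
      \<open>(Suc j)\<^sup>2\<close> is compensated wherever it matters.\<close>
    have "\<bar>cutoff_deriv (?t j x)\<bar> * ?t j x \<le> 2 * 2"
    proof (cases "?t j x \<le> 2")
      case True
      then show ?thesis using cutoff_bounds(3)[of "?t j x"] t0 by (intro mult_mono) auto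
    next
      case False
      then show ?thesis using cutoff_simps(4)[of "?t j x"] by simp
    qed
    then have 1: "\<bar>g x\<bar> * (\<bar>cutoff_deriv (?t j x)\<bar> * ?t j x) \<le> M * (2 * 2)"
      by (intro mult_mono[of "\<bar>g x\<bar>"]) (use M t0 in auto)
    have "norm (grad (f j) x) \<le> norm (cutoff (?t j x) *\<^sub>R grad g x)
        + norm ((g x * (cutoff_deriv (?t j x) * (real (Suc j))\<^sup>2 * 2)) *\<^sub>R x)"
      unfolding gf by (rule norm_triangle_ineq)
    also have "\<dots> \<le> norm (grad g x) + \<bar>g x\<bar> * (\<bar>cutoff_deriv (?t j x)\<bar> * (real (Suc j))\<^sup>2 * 2) * norm x"
      using cutoff_bounds[of "?t j x"] by (intro add_mono) (auto simp: abs_mult mult_left_le_one_le)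
    finally have "norm x * norm (grad (f j) x) \<le>
       norm x * (norm (grad g x) + \<bar>g x\<bar> * (\<bar>cutoff_deriv (?t j x)\<bar> * (real (Suc j))\<^sup>2 * 2) * norm x)"
      by (rule mult_left_mono) simp
    also have "\<dots> = norm x * norm (grad g x) + 2 * (\<bar>g x\<bar> * (\<bar>cutoff_deriv (?t j x)\<bar> * ?t j x))"
      by (simp add: algebra_simps dot_square_norm power2_eq_square)
    also have "\<dots> \<le> M + 8 * M" using 1 M(3)[of x] by simp
    finally show ?thesis .
  qed
  \<comment> \<open>At a fixed nonzero point the cutoff and its derivative are eventually 1 and 0,
    so function and gradient are eventually those of g.\<close>
  have ev: "\<forall>\<^sub>F j in sequentially. ?t j x \<ge> 2" if "x \<noteq> 0" for x
  proof -
    have "filterlim (\<lambda>j. (real (Suc j))\<^sup>2 * (x \<bullet> x)) at_top sequentially"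
      using that by real_asymp
    then show ?thesis by (simp add: filterlim_at_top)
  qed
  have 1: "C1_approx R f g"
    unfolding C1_approx_def
  proof (intro conjI allI impI exI)
    show "\<bar>f j x\<bar> \<le> M + 8 * M" for j x using b1[of j x] M(1) by simp
    show "norm x * norm (grad (f j) x) \<le> M + 8 * M" for j x by (rule b2)
    show "(\<lambda>j. f j x) \<longlonglongrightarrow> g x" if "x \<noteq> 0" for x
      by (rule tendsto_eventually, rule eventually_mono[OF ev[OF that]]) (simp add: f_def cutoff_simps)
    show "(\<lambda>j. grad (f j) x) \<longlonglongrightarrow> grad g x" if "x \<noteq> 0" for x
      by (rule tendsto_eventually, rule eventually_mono[OF ev[OF that]]) (simp add: gf cutoff_simps)
  qed (use g C1 in \<open>auto simp: f_def\<close>)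
  have 2: "\<exists>\<delta>>0. \<forall>x. norm x < \<delta> \<longrightarrow> f j x = 0" for j
  proof (intro exI[of _ "1 / real (Suc j)"] conjI allI impI)
    fix x :: "real^'n" assume "norm x < 1 / real (Suc j)"
    then have "real (Suc j) * norm x < 1" by (simp add: field_simps)
    then have "(real (Suc j) * norm x)\<^sup>2 \<le> 1\<^sup>2" by (intro power_mono) auto
    then show "f j x = 0" by (simp add: f_def cutoff_simps dot_square_norm power_mult_distrib)
  qed simp
  have 3: "radial g \<Longrightarrow> radial (f j)" for j
    unfolding radial_def f_def dot_square_norm by metis
  show ?thesis by (rule that[OF 1 2 3])
qed

section \<open>The ground state transformation\<close>

text \<open>Convolution with the constant 1 gives a constant function. Its partial derivative is 0,
  and differentiation under the integral identifies it with the integral in question.\<close>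

lemma integral_partial_deriv_eq_0:
  fixes g :: "real^'n::finite \<Rightarrow> real"
  assumes "C1_on UNIV g" "\<And>x. norm x > R \<Longrightarrow> g x = 0"
  shows "(LINT x|lborel. partial_deriv i g x) = 0"
proof -
  have c1: "continuous_on UNIV (\<lambda>_::real^'n. 1::real)" by simp
  have m: "g \<in> borel_measurable borel" "partial_deriv i g \<in> borel_measurable borel"
  proof -
    have "continuous_on UNIV (\<lambda>x. grad g x $ i)"
      by (intro continuous_intros C1_on_imp_continuous_on_grad assms)
    then show "partial_deriv i g \<in> borel_measurable borel"
      by (simp add: grad_def borel_measurable_continuous_onI)
  qed (rule C1_measurable(1)[OF assms(1)])
  have "convol (\<lambda>_. 1) g = (\<lambda>x. LINT y|lborel. g y)"
    using integral_lborel_reflect[OF m(1)] by (simp add: convol_def fun_eq_iff)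
  then have "partial_deriv i (convol (\<lambda>_. 1) g) 0 = 0"
    using partial_deriv_eqI[of "\<lambda>x. LINT y|lborel. g y" "\<lambda>h. 0" 0 i] by simp
  then have "convol (\<lambda>_. 1) (partial_deriv i g) 0 = 0"
    using partial_deriv_convol[OF c1 _ assms, where M = 1 and i = i] by simp
  then show ?thesis
    using integral_lborel_reflect[OF m(2), of 0] by (simp add: convol_def)
qed

text \<open>The integrand is the divergence of the compactly supported field
  \<open>f x *\<^sub>R x\<close>.\<close>

lemma integral_divergence_radial_field:
  fixes f :: "real^'n::finite \<Rightarrow> real"
  assumes f: "C1_on UNIV f" "\<And>x. norm x > R \<Longrightarrow> f x = 0"
  shows "integrable lborel (\<lambda>x. real CARD('n) * f x + grad f x \<bullet> x)"
    "(LINT x|lborel. real CARD('n) * f x + grad f x \<bullet> x) = 0"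
proof -
  have gs: "grad f x = 0" if "norm x > R" for x
    using grad_eq_0_outside_cball[OF f(2) that] .
  have fc: "continuous_on UNIV f" "continuous_on UNIV (grad f)"
    using f by (auto intro!: C1_on_imp_continuous_on C1_on_imp_continuous_on_grad)
  have lin: "C1_on UNIV (\<lambda>x::real^'n. x $ i)" for i
  proof -
    have "C1_on UNIV (\<lambda>x::real^'n. x \<bullet> axis i 1)"
      by (intro C1_on_inner C1_on_ident C1_on_const)
    then show ?thesis by (simp add: inner_axis)
  qed
  have C1: "C1_on UNIV (\<lambda>x. x $ i * f x)" for i
    by (intro C1_on_mult lin f)
  have pd: "partial_deriv i (\<lambda>x. x $ i * f x) x = f x + x $ i * grad f x $ i" for i x
  proof -
    have "((\<lambda>x. x $ i) has_derivative (\<lambda>h. h $ i)) (at x)"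
      by (intro bounded_linear_imp_has_derivative bounded_linear_vec_nth)
    from partial_deriv_eqI[OF has_derivative_mult[OF this C1_on_has_derivative_grad[OF f(1) UNIV_I]]]
    show ?thesis by (simp add: inner_axis)
  qed
  have int: "integrable lborel (\<lambda>x. f x + x $ i * grad f x $ i)" for i
    by (rule integrable_continuous_compact_support[of _ R]) (auto intro!: continuous_intros fc simp: gs f(2))
  have eq: "real CARD('n) * f x + grad f x \<bullet> x = (\<Sum>i\<in>UNIV. f x + x $ i * grad f x $ i)" for x
    by (simp add: sum.distrib inner_vec_def mult.commute)
  show "integrable lborel (\<lambda>x. real CARD('n) * f x + grad f x \<bullet> x)"
    unfolding eq by (intro Bochner_Integration.integrable_sum int)
  have "(LINT x|lborel. f x + x $ i * grad f x $ i) = 0" for i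
  proof -
    have "partial_deriv i (\<lambda>x. x $ i * f x) = (\<lambda>x. f x + x $ i * grad f x $ i)"
      by (rule ext) (rule pd)
    then show ?thesis
      using integral_partial_deriv_eq_0[OF C1[of i], of R i] f(2) by simp
  qed
  then show "(LINT x|lborel. real CARD('n) * f x + grad f x \<bullet> x) = 0"
    unfolding eq by (subst Bochner_Integration.integral_sum[OF int]) simp
qed

text \<open>The function \<open>\<psi> (norm x)\<close> is the ground state of the Hardy operator with the logarithmic correction. The
  map \<open>x \<mapsto> \<phi> (norm x) * x / norm x\<close> turns the ground state representation into a Dirichlet integral; the
  assumption \<open>1 / k \<le> 1 - ln \<alpha>\<close> makes the angular part come out with the right sign.\<close>

locale ground_state =
  fixes k \<theta> \<alpha> a :: real
  assumes k: "k > 0" and \<theta>: "0 \<le> \<theta>" "\<theta> < 1 / 2" and \<alpha>: "0 < \<alpha>" "1 / k \<le> 1 - ln \<alpha>"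
    and a_def: "a = (1 - 2 * \<theta>) / k"
begin

definition s :: "real \<Rightarrow> real" where "s r = 1 - ln (\<alpha> * r)"
definition \<phi> :: "real \<Rightarrow> real" where "\<phi> r = s r powr (- a)"
definition \<phi>' :: "real \<Rightarrow> real" where "\<phi>' r = a * s r powr (- a - 1) / r"
definition \<psi> :: "real \<Rightarrow> real" where "\<psi> r = r powr (- k / 2) * s r powr \<theta>"
text \<open>The vector \<open>b (norm x) *\<^sub>R x\<close> is the gradient of the logarithm of the
  ground state; compare \<open>DERIV_\<psi>\<close>.\<close>

definition b :: "real \<Rightarrow> real" where "b r = - (k / 2 + \<theta> / s r) / r\<^sup>2"
definition b' :: "real \<Rightarrow> real" where "b' r = 2 * (k / 2 + \<theta> / s r) / r ^ 3 - \<theta> / (s r)\<^sup>2 / r ^ 3"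
text \<open>The inverse of \<phi>, found by solving
  \<open>y = (1 - ln (\<alpha> * r)) powr (- a)\<close> for r.\<close>

definition \<iota> :: "real \<Rightarrow> real" where "\<iota> y = exp (1 - y powr (- 1 / a)) / \<alpha>"

lemma a: "a > 0" "a \<le> 1 / k"
  using k \<theta> by (auto simp: a_def intro!: divide_right_mono)

lemma ak: "a * k = 1 - 2 * \<theta>"
  using k by (simp add: a_def)

lemma ln_\<alpha>: "ln \<alpha> < 1"
proof -
  have "1 / k > 0" using k by simp
  then show ?thesis using \<alpha> by linarith
qed

lemma s_ge: "s r \<ge> 1 / k" if "0 < r" "r \<le> 1"
proof -
  have "ln r \<le> 0" using that by simp
  moreover have "ln (\<alpha> * r) = ln \<alpha> + ln r" using that \<alpha> by (simp add: ln_mult)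
  ultimately show ?thesis using \<alpha> unfolding s_def by linarith
qed

lemma s_pos: "0 < r \<Longrightarrow> r \<le> 1 \<Longrightarrow> s r > 0"
  using s_ge[of r] k by (smt (verit) divide_pos_pos)

lemma s_nonzero: "0 < r \<Longrightarrow> r < 1 \<Longrightarrow> s r \<noteq> 0"
  using s_pos[of r] by simp

lemma X_log_eq: "X_log (\<alpha> * r) = 1 / s r"
  by (simp add: X_log_def s_def)

lemma DERIV_s: "0 < r \<Longrightarrow> (s has_real_derivative (- 1 / r)) (at r)"
  unfolding s_def[abs_def] using \<alpha> by (auto intro!: derivative_eq_intros simp: field_simps)

lemma \<phi>_pos: "0 < r \<Longrightarrow> r \<le> 1 \<Longrightarrow> \<phi> r > 0"
  using s_pos[of r] by (simp add: \<phi>_def)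

lemma \<phi>'_pos: "0 < r \<Longrightarrow> r \<le> 1 \<Longrightarrow> \<phi>' r > 0"
  using s_pos[of r] a by (simp add: \<phi>'_def)

lemma \<psi>_pos: "0 < r \<Longrightarrow> r \<le> 1 \<Longrightarrow> \<psi> r > 0"
  using s_pos[of r] by (simp add: \<psi>_def)

lemma DERIV_\<phi>:
  assumes "0 < r" "r \<le> 1"
  shows "(\<phi> has_real_derivative \<phi>' r) (at r)"
proof -
  have "((\<lambda>t. t powr (- a)) has_real_derivative (- a) * s r powr (- a - 1)) (at (s r))"
    by (rule has_real_derivative_powr) (rule s_pos[OF assms])
  from DERIV_chain2[OF this DERIV_s[OF assms(1)]] show ?thesis
    by (simp add: \<phi>_def[abs_def] \<phi>'_def)
qed

lemma DERIV_\<psi>: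
  assumes "0 < r" "r \<le> 1"
  shows "(\<psi> has_real_derivative r * b r * \<psi> r) (at r)"
proof -
  have 1: "((\<lambda>r. r powr (- k / 2)) has_real_derivative (- k / 2) * r powr (- k / 2 - 1)) (at r)"
    by (rule has_real_derivative_powr) (rule assms)
  have "((\<lambda>t. t powr \<theta>) has_real_derivative \<theta> * s r powr (\<theta> - 1)) (at (s r))"
    by (rule has_real_derivative_powr) (rule s_pos[OF assms])
  from DERIV_mult[OF 1 DERIV_chain2[OF this DERIV_s[OF assms(1)]]]
  have "(\<psi> has_real_derivative ((- k / 2) * r powr (- k / 2 - 1)) * s r powr \<theta>
      + (\<theta> * s r powr (\<theta> - 1) * (- 1 / r)) * r powr (- k / 2)) (at r)"
    by (simp add: \<psi>_def[abs_def])
  moreover have "((- k / 2) * r powr (- k / 2 - 1)) * s r powr \<theta>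
      + (\<theta> * s r powr (\<theta> - 1) * (- 1 / r)) * r powr (- k / 2) = r * b r * \<psi> r"
  proof -
    define A B where "A = r powr (- k / 2)" and "B = s r powr \<theta>"
    have "r powr (- k / 2 - 1) = A / r" "s r powr (\<theta> - 1) = B / s r"
      using assms s_pos[OF assms] by (simp_all add: A_def B_def powr_diff)
    moreover have "(- k / 2) * (A / r) * B + (\<theta> * (B / s r) * (- 1 / r)) * A = r * b r * (A * B)"
      using assms s_pos[OF assms] by (simp add: b_def field_simps power2_eq_square)
    ultimately show ?thesis by (simp only: \<psi>_def A_def[symmetric] B_def[symmetric])
  qed
  ultimately show ?thesis by simp
qed

lemma DERIV_b:
  assumes "0 < r" "r \<le> 1"
  shows "(b has_real_derivative b' r) (at r)"
proof -
  have [derivative_intros]: "(s has_field_derivative (- 1 / r)) (at r within UNIV)"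
    using DERIV_s[OF assms(1)] by simp
  show ?thesis
    unfolding b_def[abs_def] b'_def using assms s_pos[OF assms]
    by (auto intro!: derivative_eq_intros simp: field_simps power2_eq_square power3_eq_cube)
qed

text \<open>The Riccati form of the ground state equation. With \<open>n = k + 2\<close>, the
  left-hand side is the divergence of the field \<open>b (norm x) *\<^sub>R x\<close> plus its
  squared length, that is, the Laplacian of the ground state divided by the ground state; the
  right-hand side is minus the potential.\<close>

lemma b_identity:
  assumes "0 < r" "r \<le> 1"
  shows "(k + 2) * b r + r * b' r + r\<^sup>2 * (b r)\<^sup>2 = - ((k / 2)\<^sup>2 + \<theta> * (1 - \<theta>) / (s r)\<^sup>2) / r\<^sup>2"
proof -
  have "s r \<noteq> 0" "r \<noteq> 0" using assms s_pos[OF assms] by auto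
  then show ?thesis
    unfolding b_def b'_def
    by (simp add: divide_simps power2_eq_square power3_eq_cube) algebra
qed

lemma continuous_s: "continuous_on {0<..<1} s"
  by (rule continuous_at_imp_continuous_on) (use DERIV_s DERIV_isCont in force)

lemma continuous_\<phi>': "continuous_on {0<..<1} \<phi>'"
  unfolding \<phi>'_def[abs_def]
  by (intro continuous_intros continuous_s) (auto simp: s_nonzero)

lemma C1_\<phi>: "C1_on {0<..<1} \<phi>"
  by (rule C1_on_real[OF _ continuous_\<phi>']) (auto intro: DERIV_\<phi>)

lemma continuous_b: "continuous_on {0<..<1} b"
  unfolding b_def[abs_def]
  by (intro continuous_intros continuous_s) (auto simp: s_nonzero)

lemma C1_b: "C1_on {0<..<1} b"
proof (rule C1_on_real)
  show "continuous_on {0<..<1} b'"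
    unfolding b'_def[abs_def]
    by (intro continuous_intros continuous_s) (auto simp: s_nonzero)
qed (auto intro: DERIV_b)

lemma C1_\<psi>: "C1_on {0<..<1} \<psi>"
proof (rule C1_on_real)
  have "continuous_on {0<..<1} \<psi>"
    by (rule continuous_at_imp_continuous_on) (use DERIV_\<psi> DERIV_isCont in force)
  then show "continuous_on {0<..<1} (\<lambda>r. r * b r * \<psi> r)"
    by (intro continuous_intros continuous_b)
qed (auto intro: DERIV_\<psi>)

text \<open>The quotient of the two sides is \<open>a / s r\<close>, and
  \<open>a \<le> 1 / k \<le> s r\<close>. The upper bound on \<alpha> enters here, through
  \<open>s_ge\<close>: radial stretching does not exceed tangential stretching.\<close>

lemma \<phi>'_le: "0 < r \<Longrightarrow> r \<le> 1 \<Longrightarrow> \<phi>' r \<le> \<phi> r / r"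
proof -
  assume r: "0 < r" "r \<le> 1"
  have "a \<le> s r" using s_ge[OF r] a(2) by linarith
  then have "a / s r \<le> 1" using s_pos[OF r] by (simp add: divide_le_eq)
  then have "(a / s r) * s r powr (- a) \<le> 1 * s r powr (- a)" by (rule mult_right_mono) simp
  moreover have "s r powr (- a - 1) = s r powr (- a) / s r" using s_pos[OF r] by (simp add: powr_diff)
  ultimately have "a * s r powr (- a - 1) \<le> s r powr (- a)" by simp
  then show ?thesis using r by (simp add: \<phi>_def \<phi>'_def divide_right_mono)
qed

lemma \<phi>_power:
  assumes "0 < r" "r \<le> 1" "real n = k + 2"
  shows "(\<phi> r / r) ^ (n - 1) = s r powr (- a * (k + 1)) * r powr (- (k + 1))"
proof -
  have n: "real (n - 1) = k + 1" using assms(3) k by (cases n) auto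
  have pos: "\<phi> r / r > 0" using \<phi>_pos[OF assms(1,2)] assms(1) by simp
  have "(\<phi> r / r) ^ (n - 1) = (\<phi> r / r) powr (k + 1)"
    using powr_realpow[OF pos, of "n - 1"] n by simp
  also have "\<dots> = \<phi> r powr (k + 1) / r powr (k + 1)"
    using \<phi>_pos[OF assms(1,2)] assms(1) by (simp add: powr_divide)
  also have "\<phi> r powr (k + 1) = s r powr (- a * (k + 1))"
    unfolding \<phi>_def by (rule powr_powr)
  also have "\<dots> / r powr (k + 1) = s r powr (- a * (k + 1)) * r powr (- (k + 1))"
    unfolding powr_minus_divide by simp
  finally show ?thesis .
qed

text \<open>The weight of the radial energy is \<open>a\<close> times the Jacobian. Matching the
  powers of \<open>s r\<close> requires \<open>2 * \<theta> - a - 1 = - a * (k + 1)\<close>, which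
  is the origin of the value of \<open>a\<close>.\<close>

lemma \<psi>_\<phi>'_identity:
  assumes "0 < r" "r \<le> 1" "real n = k + 2"
  shows "(\<psi> r)\<^sup>2 * (\<phi>' r)\<^sup>2 = a * (\<phi>' r * (\<phi> r / r) ^ (n - 1))"
proof -
  have sp: "s r > 0" by (rule s_pos[OF assms(1,2)])
  note 1 = \<phi>_power[OF assms(1-3)]
  have "(\<psi> r)\<^sup>2 = r powr (- k) * s r powr (2 * \<theta>)"
    using sp assms(1) by (simp add: \<psi>_def power2_eq_square powr_add[symmetric] mult_ac)
  moreover have "\<phi>' r = a * s r powr (- a - 1) * r powr (- 1)"
    using assms(1) by (simp add: \<phi>'_def powr_minus divide_inverse)
  ultimately have "(\<psi> r)\<^sup>2 * \<phi>' r
      = a * ((r powr (- k) * r powr (- 1)) * (s r powr (2 * \<theta>) * s r powr (- a - 1)))"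
    by (simp add: mult_ac)
  also have "\<dots> = a * (r powr (- (k + 1)) * s r powr (- a * (k + 1)))"
  proof -
    have "2 * \<theta> + (- a - 1) = - a * (k + 1)" using ak by (simp add: algebra_simps)
    moreover have "- k + (- 1) = - (k + 1)" by simp
    ultimately show ?thesis by (simp only: powr_add[symmetric])
  qed
  finally have "(\<psi> r)\<^sup>2 * \<phi>' r = a * (\<phi> r / r) ^ (n - 1)" unfolding 1 by (simp add: mult_ac)
  then show ?thesis by (simp add: power2_eq_square mult_ac)
qed

text \<open>The powers of r match by the choice of the exponent \<open>e\<close>, the powers of
  \<open>s r\<close> by \<open>a * k = 1 - 2 * \<theta>\<close>. The second match is what singles
  out \<open>(p + 2) / 2\<close> as the exponent of the logarithmic weight.\<close>

lemma weight_identity: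
  assumes "0 < r" "r \<le> 1" "real n = k + 2" "e = p * k / 2 - (k + 2)"
  shows "a * (r powr e * (1 / s r) powr ((p + 2) / 2) * \<psi> r powr p) = \<phi>' r * (\<phi> r / r) ^ (n - 1) * \<phi> r powr e"
proof -
  have sp: "s r > 0" by (rule s_pos[OF assms(1,2)])
  note 1 = \<phi>_power[OF assms(1-3)]
  have 2: "\<phi>' r = a * s r powr (- a - 1) * r powr (- 1)"
    using assms(1) by (simp add: \<phi>'_def powr_minus divide_inverse)
  have 3: "\<phi> r powr e = s r powr (- a * e)" by (simp add: \<phi>_def powr_powr)
  have 4: "\<psi> r powr p = r powr (- k / 2 * p) * s r powr (\<theta> * p)"
    unfolding \<psi>_def by (subst powr_mult) (simp_all only: powr_powr powr_ge_zero)
  have 5: "(1 / s r) powr ((p + 2) / 2) = s r powr (- ((p + 2) / 2))"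
    unfolding powr_minus_divide using sp by (subst powr_divide) auto
  have es: "- ((p + 2) / 2) + \<theta> * p = (- a - 1) + - a * (k + 1) + - a * e"
  proof -
    have "a * e = (a * k) * p / 2 - a * k - 2 * a" unfolding assms(4) by (simp add: algebra_simps)
    then have "- a * e = - ((1 - 2 * \<theta>) * p / 2 - (1 - 2 * \<theta>) - 2 * a)" unfolding ak by simp
    moreover have "- a * (k + 1) = - (1 - 2 * \<theta>) - a" unfolding ak[symmetric] by (simp add: algebra_simps)
    ultimately show ?thesis by (simp only:) (simp add: field_simps)
  qed
  have er: "e + - k / 2 * p = - 1 + - (k + 1)" using assms(4) by (simp add: algebra_simps)
  have "a * (r powr e * (1 / s r) powr ((p + 2) / 2) * \<psi> r powr p)
     = a * ((r powr e * r powr (- k / 2 * p)) * (s r powr (- ((p + 2) / 2)) * s r powr (\<theta> * p)))"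
    unfolding 4 5 by (simp only: mult_ac)
  also have "\<dots> = a * (r powr (- 1 + - (k + 1)) * s r powr ((- a - 1) + - a * (k + 1) + - a * e))"
    by (simp only: powr_add[symmetric] es er)
  also have "\<dots> = \<phi>' r * (\<phi> r / r) ^ (n - 1) * \<phi> r powr e"
    unfolding 1 2 3 powr_add by (simp only: mult_ac)
  finally show ?thesis .
qed

lemma \<phi>_strict_mono:
  assumes "0 < r" "r < t" "t \<le> 1"
  shows "\<phi> r < \<phi> t"
proof (rule DERIV_pos_imp_increasing[OF assms(2)])
  fix x assume "r \<le> x" "x \<le> t"
  then have "0 < x" "x \<le> 1" using assms by auto
  then show "\<exists>y. (\<phi> has_real_derivative y) (at x) \<and> 0 < y"
    using DERIV_\<phi> \<phi>'_pos by blast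
qed

lemma \<iota>:
  assumes "0 < y" "y < \<phi> 1"
  shows "0 < \<iota> y" "\<iota> y < 1" "\<phi> (\<iota> y) = y"
proof -
  show pos: "0 < \<iota> y" using \<alpha> by (simp add: \<iota>_def)
  have s: "s (\<iota> y) = y powr (- 1 / a)" using \<alpha> by (simp add: s_def \<iota>_def)
  have "(y powr (- 1 / a)) powr (- a) = y" using assms a by (simp add: powr_powr)
  then show 1: "\<phi> (\<iota> y) = y" by (simp add: \<phi>_def s)
  have "s (\<iota> y) > s 1"
  proof (rule ccontr)
    assume "\<not> s (\<iota> y) > s 1"
    then have "s 1 powr (- a) \<le> s (\<iota> y) powr (- a)"
      using assms a s by (intro powr_mono2') auto
    then show False using assms 1 by (simp add: \<phi>_def)
  qed
  then have "ln (\<alpha> * \<iota> y) < ln (\<alpha> * 1)" by (simp add: s_def)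
  then show "\<iota> y < 1" using pos \<alpha> by simp
qed

lemma \<iota>_\<phi>:
  assumes "0 < r" "r < 1"
  shows "\<iota> (\<phi> r) = r"
proof -
  have p: "0 < \<phi> r" "\<phi> r < \<phi> 1" using \<phi>_pos \<phi>_strict_mono assms by auto
  note i = \<iota>[OF p]
  show ?thesis
    using \<phi>_strict_mono[of "\<iota> (\<phi> r)" r] \<phi>_strict_mono[of r "\<iota> (\<phi> r)"] i assms
    by (metis less_eq_real_def less_irrefl linorder_neqE_linordered_idom)
qed

lemma \<phi>_image: "\<phi> ` {0<..<1} = {0<..<\<phi> 1}"
proof (intro subset_antisym subsetI)
  fix y assume "y \<in> \<phi> ` {0<..<1}"
  then show "y \<in> {0<..<\<phi> 1}" using \<phi>_pos \<phi>_strict_mono by auto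
next
  fix y assume "y \<in> {0<..<\<phi> 1}"
  then have "y = \<phi> (\<iota> y)" "\<iota> y \<in> {0<..<1}" using \<iota>[of y] by auto
  then show "y \<in> \<phi> ` {0<..<1}" by blast
qed

lemma C1_\<iota>: "C1_on {0<..} \<iota>"
proof -
  have "C1_on {0<..} (\<lambda>y::real. y powr (- 1 / a))"
    by (rule C1_on_real[of _ _ "\<lambda>y. (- 1 / a) * y powr (- 1 / a - 1)"])
       (use a in \<open>intro has_real_derivative_powr continuous_intros; auto\<close>)+
  moreover have "C1_on UNIV (\<lambda>t. exp (1 - t) / \<alpha>)"
    by (rule C1_on_real[of _ _
        "\<lambda>t. - exp (1 - t) / \<alpha>"]) (use \<alpha> in \<open>auto intro!: derivative_eq_intros continuous_intros\<close>)
  ultimately show ?thesis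
    unfolding \<iota>_def[abs_def] by (rule C1_on_compose) auto
qed

end

section \<open>The substitution in several variables\<close>

context ground_state
begin

definition \<Psi> :: "real^'n::finite \<Rightarrow> real^'n"
  where "\<Psi> x = (\<phi> (norm x) / norm x) *\<^sub>R x"

definition D\<Psi> :: "real^'n::finite \<Rightarrow> real^'n \<Rightarrow> real^'n"
  where "D\<Psi> x h = (\<phi> (norm x) / norm x) *\<^sub>R h +
    ((\<phi>' (norm x) - \<phi> (norm x) / norm x) / (norm x)\<^sup>2 * (x \<bullet> h)) *\<^sub>R x"

text \<open>Pullback under the substitution followed by multiplication with the ground state. The
  value 0 off the punctured ball is a \<open>C^1\<close> extension for those U that vanish near the
  origin and near the sphere of radius \<open>\<phi> 1\<close>.\<close>

definition transf :: "(real^'n::finite \<Rightarrow> real) \<Rightarrow> real^'n \<Rightarrow> real"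
  where "transf U x = (if 0 < norm x \<and> norm x < 1 then \<psi> (norm x) * U (\<Psi> x) else 0)"

definition punctured_ball :: "(real^'n::finite) set"
  where "punctured_ball = ball 0 1 - {0}"

lemma punctured_ball_iff: "x \<in> punctured_ball \<longleftrightarrow> 0 < norm x \<and> norm x < 1"
  by (auto simp: punctured_ball_def)

lemma open_punctured_ball: "open punctured_ball"
  by (auto simp: punctured_ball_def)

lemma C1_radial_function: "C1_on {0<..<1} f \<Longrightarrow> C1_on punctured_ball (\<lambda>x. f (norm x))"
  by (rule C1_on_compose[OF C1_on_norm]) (auto simp: punctured_ball_iff)

lemma C1_\<Psi>: "C1_on punctured_ball (\<Psi> :: real^'n::finite \<Rightarrow> _)"
proof -
  have "C1_on {0<..<1} (inverse :: real \<Rightarrow> real)"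
    by (rule C1_on_inverse_real) simp
  from C1_on_mult[OF C1_\<phi> this] have "C1_on {0<..<1} (\<lambda>r. \<phi> r / r)"
    by (simp add: divide_inverse)
  from C1_on_scaleR[OF C1_radial_function[OF this] C1_on_ident]
  show ?thesis by (simp add: \<Psi>_def[abs_def])
qed

lemma \<Psi>_has_derivative: "x \<in> punctured_ball \<Longrightarrow> (\<Psi> has_derivative D\<Psi> x) (at x)"
  unfolding \<Psi>_def[abs_def] D\<Psi>_def[abs_def]
  by (rule has_derivative_radial[OF DERIV_\<phi>]) (auto simp: punctured_ball_iff)

lemma norm_\<Psi>: "x \<in> punctured_ball \<Longrightarrow> norm (\<Psi> x) = \<phi> (norm x)"
  using \<phi>_pos[of "norm x"] by (auto simp: \<Psi>_def punctured_ball_iff)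

text \<open>Self-adjointness lets the chain rule express the gradient of
  \<open>U \<circ> \<Psi>\<close> through \<open>D\<Psi>\<close> itself instead of its
  adjoint.\<close>

lemma D\<Psi>_symmetric: "v \<bullet> D\<Psi> x h = D\<Psi> x v \<bullet> h"
  by (simp add: D\<Psi>_def inner_add_right inner_add_left inner_commute mult_ac)

text \<open>The eigenvalues of \<open>D\<Psi> x\<close> are \<open>\<phi>'\<close> along x and
  \<open>\<phi> r / r\<close> across it, and the first is the smaller one by
  \<open>\<phi>'_le\<close>.\<close>

lemma norm_D\<Psi>_ge:
  assumes "x \<in> punctured_ball"
  shows "(\<phi>' (norm x))\<^sup>2 * (norm v)\<^sup>2 \<le> (norm (D\<Psi> x v))\<^sup>2"
proof -
  define r A P where "r = norm x" and "A = \<phi> r / r" and "P = \<phi>' r"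
  have r: "0 < r" "r < 1" using assms by (auto simp: r_def punctured_ball_iff)
  have AP: "0 < P" "P \<le> A" using \<phi>'_pos[of r] \<phi>'_le[of r] r by (auto simp: A_def P_def)
  have xx: "x \<bullet> x = r\<^sup>2" by (simp add: r_def dot_square_norm)
  \<comment> \<open>\<open>q\<close> is the squared length of the component of v along x, and
    \<open>z\<close> is the coefficient of the rank-one part, normalized by
    \<open>z * r\<^sup>2 = P - A\<close>.\<close>
  define z q where "z = (P - A) / r\<^sup>2" and "q = (x \<bullet> v)\<^sup>2 / r\<^sup>2"
  have zq: "z * r\<^sup>2 = P - A" "(x \<bullet> v)\<^sup>2 = q * r\<^sup>2" using r by (simp_all add: z_def q_def)
  have "(norm (D\<Psi> x v))\<^sup>2 = (A *\<^sub>R v + (z * (x \<bullet> v)) *\<^sub>R x) \<bullet> (A *\<^sub>R v + (z * (x \<bullet> v)) *\<^sub>R x)"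
    by (simp add: dot_square_norm D\<Psi>_def A_def P_def r_def z_def)
  also have "\<dots> = A\<^sup>2 * (v \<bullet> v) + (2 * A * z * (x \<bullet> v)\<^sup>2 + z\<^sup>2 * (x \<bullet> v)\<^sup>2 * r\<^sup>2)"
    by (simp add: inner_add_left inner_add_right xx inner_commute power2_eq_square algebra_simps)
  also have "2 * A * z * (x \<bullet> v)\<^sup>2 + z\<^sup>2 * (x \<bullet> v)\<^sup>2 * r\<^sup>2 = 2 * A * (z * r\<^sup>2) * q + (z * r\<^sup>2)\<^sup>2 * q"
    unfolding zq(2) by (simp add: power2_eq_square algebra_simps)
  also have "\<dots> = - (A\<^sup>2 - P\<^sup>2) * q"
    unfolding zq(1) by (simp add: power2_eq_square algebra_simps)
  also have "A\<^sup>2 * (v \<bullet> v) + - (A\<^sup>2 - P\<^sup>2) * q = A\<^sup>2 * (v \<bullet> v) - (A\<^sup>2 - P\<^sup>2) * ((x \<bullet> v)\<^sup>2 / r\<^sup>2)"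
    unfolding q_def by (simp only: minus_mult_left[symmetric] add_uminus_conv_diff)
  also have "\<dots> \<ge> A\<^sup>2 * (v \<bullet> v) - (A\<^sup>2 - P\<^sup>2) * (v \<bullet> v)"
  proof -
    have "(x \<bullet> v)\<^sup>2 \<le> r\<^sup>2 * (v \<bullet> v)" using Cauchy_Schwarz_ineq[of x v] by (simp add: xx)
    then have "(x \<bullet> v)\<^sup>2 / r\<^sup>2 \<le> v \<bullet> v" using r by (simp add: divide_le_eq mult.commute)
    moreover have "P\<^sup>2 \<le> A\<^sup>2" using AP by (intro power_mono) auto
    ultimately show ?thesis by (intro diff_left_mono mult_left_mono) auto
  qed
  finally show ?thesis by (simp add: P_def r_def dot_square_norm algebra_simps)
qed

text \<open>The case of equality in \<open>norm_D\<Psi>_ge\<close>: gradients of radial functions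
  point along x.\<close>

lemma norm_D\<Psi>_parallel:
  assumes "x \<in> punctured_ball"
  shows "(norm (D\<Psi> x (c *\<^sub>R x)))\<^sup>2 = (\<phi>' (norm x))\<^sup>2 * (norm (c *\<^sub>R x))\<^sup>2"
proof -
  have "D\<Psi> x (c *\<^sub>R x) = \<phi>' (norm x) *\<^sub>R (c *\<^sub>R x)"
    using assms by (simp add: D\<Psi>_def dot_square_norm punctured_ball_iff flip: scaleR_add_left)
      (simp add: algebra_simps)
  then show ?thesis by (simp add: power_mult_distrib)
qed

context
  fixes U :: "real^'n::finite \<Rightarrow> real" and R' \<delta>' :: real
  assumes kn: "real CARD('n) = k + 2" and n3: "CARD('n) \<ge> 3"
    and U: "C1_on UNIV U" "\<And>y. norm y < \<delta>' \<Longrightarrow> U y = 0" "\<And>y. norm y > R' \<Longrightarrow> U y = 0"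
    and R': "R' < \<phi> 1" and \<delta>': "\<delta>' > 0"
begin

lemma transf_support:
  obtains \<delta> R where "0 < \<delta>" "R < 1" "\<And>x. norm x < \<delta> \<Longrightarrow> transf U x = 0" "\<And>x. norm x > R \<Longrightarrow> transf U x = 0"
proof -
  \<comment> \<open>\<open>R'\<close> may be negative and \<open>\<delta>'\<close> may be large;
    comparison with half of \<open>\<phi> 1\<close> keeps the arguments of \<iota> between 0 and
    \<open>\<phi> 1\<close>.\<close>
  define R where "R = \<iota> (max R' (\<phi> 1 / 2))"
  define \<delta> where "\<delta> = \<iota> (min \<delta>' (\<phi> 1 / 2))"
  have p1: "\<phi> 1 > 0" by (rule \<phi>_pos) auto
  note i1 = \<iota>[of "max R' (\<phi> 1 / 2)", folded R_def] and i2 = \<iota>[of "min \<delta>' (\<phi> 1 / 2)", folded \<delta>_def]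
  have R: "0 < R" "R < 1" "\<phi> R \<ge> R'" using i1 p1 R' by auto
  have d: "0 < \<delta>" "\<delta> < 1" "\<phi> \<delta> \<le> \<delta>'" using i2 p1 \<delta>' by auto
  show ?thesis
  proof (rule that[OF d(1) R(2)])
    fix x :: "real^'n"
    show "transf U x = 0" if "norm x < \<delta>"
    proof (cases "x \<in> punctured_ball")
      case True
      then have "\<phi> (norm x) < \<phi> \<delta>" using that d by (intro \<phi>_strict_mono) (auto simp: punctured_ball_iff)
      then show ?thesis using norm_\<Psi>[OF True] d U(2)[of "\<Psi> x"] by (simp add: transf_def)
    qed (auto simp: transf_def punctured_ball_iff)
    show "transf U x = 0" if "norm x > R"
    proof (cases "x \<in> punctured_ball")
      case True
      then have "\<phi> R < \<phi> (norm x)" using that R by (intro \<phi>_strict_mono) (auto simp: punctured_ball_iff)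
      then show ?thesis using norm_\<Psi>[OF True] R U(3)[of "\<Psi> x"] by (simp add: transf_def)
    qed (auto simp: transf_def punctured_ball_iff)
  qed
qed

lemma transf_eq: "x \<in> punctured_ball \<Longrightarrow> transf U x = \<psi> (norm x) * U (\<Psi> x)"
  by (simp add: transf_def punctured_ball_iff)

text \<open>The space is covered by the punctured ball, a small ball and an exterior region; on the
  last two the function is 0.\<close>

lemma C1_extend:
  fixes f :: "real^'n \<Rightarrow> real"
  assumes "C1_on punctured_ball f" "0 < \<delta>" "R < 1" "\<And>x. norm x < \<delta> \<Longrightarrow> f x = 0" "\<And>x. norm x > R \<Longrightarrow> f x = 0"
  shows "C1_on UNIV f"
proof -
  have o: "open {x::real^'n. norm x > R}"
    using open_vimage[of "{R<..}" "norm :: real^'n \<Rightarrow> real"]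
        by (auto simp: vimage_def intro: continuous_intros)
  have "C1_on (ball 0 \<delta>) f"
    by (rule C1_on_cong[OF C1_on_const[of _ 0]]) (auto simp: assms(4))
  moreover have "C1_on {x. norm x > R} f"
    by (rule C1_on_cong[OF C1_on_const[of _ 0] o]) (auto simp: assms(5))
  ultimately have "C1_on ((punctured_ball \<union> ball 0 \<delta>) \<union> {x. norm x > R}) f"
    by (intro C1_on_Un assms(1) open_punctured_ball open_Un o) auto
  moreover have "(punctured_ball \<union> ball 0 \<delta>) \<union> {x::real^'n. norm x > R} = UNIV"
    using assms(2,3) by (auto simp: punctured_ball_iff)
  ultimately show ?thesis by simp
qed

lemma C1_transf: "C1_on UNIV (transf U)"
proof -
  obtain \<delta> R where dR: "0 < \<delta>" "R < 1" "\<And>x. norm x < \<delta> \<Longrightarrow> transf U x = 0" "\<And>x. norm x > R \<Longrightarrow> transf U x = 0"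
    using transf_support by metis
  have "C1_on punctured_ball (\<lambda>x. \<psi> (norm x) * U (\<Psi> x))"
    by (intro C1_on_mult C1_radial_function C1_\<psi> C1_on_compose[OF C1_\<Psi> U(1)]) auto
  from C1_on_cong[OF this open_punctured_ball] have "C1_on punctured_ball (transf U)"
    using transf_eq by metis
  from C1_extend[OF this dR] show ?thesis .
qed

text \<open>The first term comes from differentiating the ground state. What remains after
  subtracting it is the energy density of the transformed problem.\<close>

lemma grad_transf:
  assumes "x \<in> punctured_ball"
  shows "grad (transf U) x = (b (norm x) * transf U x) *\<^sub>R x + \<psi> (norm x) *\<^sub>R D\<Psi> x (grad U (\<Psi> x))"
proof -
  let ?r = "norm x"
  have r: "0 < ?r" "?r < 1" "x \<noteq> 0" using assms by (auto simp: punctured_ball_iff)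
  note n = has_derivative_norm_inner[OF r(3)]
  have "(\<psi> has_derivative (*) (?r * b ?r * \<psi> ?r)) (at ?r)"
    using DERIV_\<psi>[of ?r] r by (simp add: has_field_derivative_def)
  from has_derivative_compose[OF n this]
  have 1: "((\<lambda>x. \<psi> (norm x)) has_derivative (\<lambda>h. b ?r * \<psi> ?r * (x \<bullet> h))) (at x)"
    using r by (simp add: mult.assoc)
  have "((\<lambda>x. U (\<Psi> x)) has_derivative (\<lambda>h. grad U (\<Psi> x) \<bullet> D\<Psi> x h)) (at x)"
    by (rule has_derivative_compose[OF \<Psi>_has_derivative[OF assms] C1_on_has_derivative_grad[OF U(1) UNIV_I]])
  then have 2: "((\<lambda>x. U (\<Psi> x)) has_derivative (\<lambda>h. D\<Psi> x (grad U (\<Psi> x)) \<bullet> h)) (at x)"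
    by (simp add: D\<Psi>_symmetric)
  have "grad (\<lambda>x. \<psi> (norm x) * U (\<Psi> x)) x = (b ?r * transf U x) *\<^sub>R x + \<psi> ?r *\<^sub>R D\<Psi> x (grad U (\<Psi> x))"
  proof (rule grad_eqI, rule has_derivative_eq_rhs[OF has_derivative_mult[OF 1 2]])
    show "(\<lambda>h. \<psi> ?r * (D\<Psi> x (grad U (\<Psi> x)) \<bullet> h) + b ?r * \<psi> ?r * (x \<bullet> h) * U (\<Psi> x)) =
      (\<lambda>h. ((b ?r * transf U x) *\<^sub>R x + \<psi> ?r *\<^sub>R D\<Psi> x (grad U (\<Psi> x))) \<bullet> h)"
      by (simp add: fun_eq_iff transf_eq[OF assms] inner_add_left)
  qed
  moreover have "grad (transf U) x = grad (\<lambda>x. \<psi> (norm x) * U (\<Psi> x)) x"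
    by (rule grad_cong[OF open_punctured_ball assms transf_eq]) (use C1_transf in \<open>auto simp: C1_on_def\<close>)
  ultimately show ?thesis by simp
qed

text \<open>For \<open>u = transf U\<close> the integrand on the right is the squared length of
  \<open>grad u x - (b * u) *\<^sub>R x\<close>. Expanding it and applying \<open>b_identity\<close>
  gives the Hardy integrand minus the divergence of \<open>(u\<^sup>2 * b) *\<^sub>R x\<close>,
  which integrates to 0.\<close>

lemma hardy_remainder_transf:
  shows "integrable lborel (\<lambda>x. indicator punctured_ball x * ((\<psi> (norm x))\<^sup>2 * (norm (D\<Psi> x (grad U (\<Psi> x))))\<^sup>2))"
    "hardy_remainder \<theta> \<alpha> (transf U) =
      (LINT x|lborel. indicator punctured_ball x * ((\<psi> (norm x))\<^sup>2 * (norm (D\<Psi> x (grad U (\<Psi> x))))\<^sup>2))"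
proof -
  let ?u = "transf U"
  obtain \<delta> R where dR: "0 < \<delta>" "R < 1" "\<And>x. norm x < \<delta> \<Longrightarrow> ?u x = 0" "\<And>x. norm x > R \<Longrightarrow> ?u x = 0"
    using transf_support by metis
  note C1u = C1_transf
  \<comment> \<open>The divergence of the field \<open>f x *\<^sub>R x\<close> absorbs the mixed
    term of the expanded square.\<close>
  define f where "f x = (?u x * ?u x) * b (norm x)" for x
  have C1f: "C1_on UNIV f"
    unfolding f_def
    by (rule C1_extend[OF _ dR(1,2)])
       (auto intro!: C1_on_mult C1_on_subset[OF C1u] C1_radial_function C1_b simp: dR)
  have f0: "f x = 0" if "norm x > R" for x by (simp add: f_def dR(4)[OF that])
  note div = integral_divergence_radial_field[OF C1f f0]
  let ?I = "indicator (ball 0 1) :: real^'n \<Rightarrow> real"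
  define P1 P2 P3 where "P1 x = ?I x * (norm (grad ?u x))\<^sup>2" and "P2 x = ?I x * ((?u x)\<^sup>2 / (norm x)\<^sup>2)"
    and "P3 x = ?I x * ((?u x)\<^sup>2 / (norm x)\<^sup>2 * (X_log (\<alpha> * norm x))\<^sup>2)" for x
  \<comment> \<open>The integrability facts stem from a context with an exponent; the critical one
    serves as an instance.\<close>
  have pp: "(2::real) < 2 * real CARD('n) / (real CARD('n) - 2)"
    using n3 by (simp add: less_divide_eq)
  note ints = C1_approx_remainders(3-5)[OF n3 pp order_refl C1_approx_const[OF C1u dR(4)] \<alpha>(1) ln_\<alpha>,
      folded P1_def P2_def P3_def]
  have hr: "hardy_remainder \<theta> \<alpha> ?u
      = (LINT x|lborel. P1 x) - (k / 2)\<^sup>2 * (LINT x|lborel. P2 x) - \<theta> * (1 - \<theta>) * (LINT x|lborel. P3 x)"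
    using kn by (simp add: hardy_remainder_def set_lebesgue_integral_def P1_def P2_def P3_def)
  define Q where "Q x = indicator punctured_ball x * ((\<psi> (norm x))\<^sup>2 * (norm (D\<Psi> x (grad U (\<Psi> x))))\<^sup>2)" for x
  \<comment> \<open>The identity holds at every point: off the punctured ball all terms vanish,
    because \<open>?u\<close> is 0 near the origin and near and beyond the unit sphere.\<close>
  have Q: "Q x = P1 x - (k / 2)\<^sup>2 * P2 x - \<theta> * (1 - \<theta>) * P3 x - (real CARD('n) * f x + grad f x \<bullet> x)" for x
  proof (cases "x \<in> punctured_ball")
    case True
    define r where "r = norm x"
    have r: "0 < r" "r < 1" "x \<noteq> 0" using True by (auto simp: r_def punctured_ball_iff)
    define u G where "u = ?u x" and "G = grad ?u x"
    note n = has_derivative_norm_inner[OF r(3)]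
    have "(b has_derivative (*) (b' (norm x))) (at (norm x))"
      using DERIV_b[of r] r by (simp add: has_field_derivative_def r_def)
    from has_derivative_compose[OF n this]
    have d1: "((\<lambda>x. b (norm x)) has_derivative (\<lambda>h. b' r * ((x \<bullet> h) / r))) (at x)"
      by (simp add: r_def)
    have d2: "(?u has_derivative (\<lambda>h. G \<bullet> h)) (at x)"
      unfolding G_def by (rule C1_on_has_derivative_grad[OF C1u UNIV_I])
    have "grad f x = (2 * u * b r) *\<^sub>R G + (u\<^sup>2 * b' r / r) *\<^sub>R x"
    proof (rule grad_eqI)
      show "(f has_derivative (\<bullet>) ((2 * u * b r) *\<^sub>R G + (u\<^sup>2 * b' r / r) *\<^sub>R x)) (at x)"
        unfolding f_def[abs_def]
        by (rule has_derivative_eq_rhs[OF has_derivative_mult[OF has_derivative_mult[OF d2 d2] d1]])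
           (simp add: fun_eq_iff inner_add_left u_def r_def power2_eq_square algebra_simps)
    qed
    moreover have "x \<bullet> x = r\<^sup>2" by (simp add: r_def dot_square_norm)
    ultimately have gfx: "grad f x \<bullet> x = 2 * u * b r * (G \<bullet> x) + u\<^sup>2 * (r * b' r)"
      using r by (simp add: inner_add_left power2_eq_square)
    have "\<psi> r *\<^sub>R D\<Psi> x (grad U (\<Psi> x)) = G - (b r * u) *\<^sub>R x"
      using grad_transf[OF True] by (simp add: G_def u_def r_def)
    then have "(\<psi> r)\<^sup>2 * (norm (D\<Psi> x (grad U (\<Psi> x))))\<^sup>2 = (norm (G - (b r * u) *\<^sub>R x))\<^sup>2"
      by (metis norm_scaleR power2_abs power_mult_distrib)
    also have "\<dots> = (norm G)\<^sup>2 - 2 * u * b r * (G \<bullet> x) + u\<^sup>2 * (r\<^sup>2 * (b r)\<^sup>2)"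
      unfolding power2_norm_eq_inner using \<open>x \<bullet> x = r\<^sup>2\<close>
      by (simp add: inner_diff_left inner_diff_right inner_commute power2_eq_square algebra_simps)
    finally have Q1: "Q x = (norm G)\<^sup>2 - 2 * u * b r * (G \<bullet> x) + u\<^sup>2 * (r\<^sup>2 * (b r)\<^sup>2)"
      using True by (simp add: Q_def r_def)
    define B B' W H1 H2 where "B = b r" and "B' = r * b' r" and "W = r\<^sup>2 * (b r)\<^sup>2"
      and "H1 = 1 / r\<^sup>2" and "H2 = (1 / s r)\<^sup>2"
    have "(k + 2) * B + B' + W = - ((k / 2)\<^sup>2 + \<theta> * (1 - \<theta>) / (s r)\<^sup>2) / r\<^sup>2"
      using b_identity[of r] r by (simp add: B_def B'_def W_def)
    also have "\<dots> = - ((k / 2)\<^sup>2 * H1 + \<theta> * (1 - \<theta>) * (H1 * H2))"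
      by (simp only: divide_inverse power_mult_distrib power_one mult_1_left power_inverse distrib_right
          minus_mult_left[symmetric] H1_def H2_def mult.assoc mult.commute[of "inverse (r\<^sup>2)"])
    finally have W: "W = - ((k / 2)\<^sup>2 * H1 + \<theta> * (1 - \<theta>) * (H1 * H2)) - (k + 2) * B - B'"
      by linarith
    have "u\<^sup>2 * W = - ((k
        + 2) * (u\<^sup>2 * B)) - u\<^sup>2 * B' - (k / 2)\<^sup>2 * (u\<^sup>2 * H1) - \<theta> * (1 - \<theta>) * (u\<^sup>2 * H1 * H2)"
      unfolding W by (simp add: algebra_simps)
    then have id: "u\<^sup>2 * (r\<^sup>2 * (b r)\<^sup>2) = - ((k + 2) * (u\<^sup>2 * b r)) - u\<^sup>2 * (r * b' r)
        - (k / 2)\<^sup>2 * (u\<^sup>2 / r\<^sup>2) - \<theta> * (1 - \<theta>) * (u\<^sup>2 / r\<^sup>2 * (1 / s r)\<^sup>2)"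
      by (simp add: B_def B'_def W_def H1_def H2_def)
    have P: "P1 x = (norm G)\<^sup>2" "P2 x = u\<^sup>2 / r\<^sup>2" "P3 x = u\<^sup>2 / r\<^sup>2 * (1 / s r)\<^sup>2"
      using True r by (auto simp: P1_def P2_def P3_def u_def G_def r_def X_log_eq punctured_ball_iff)
    have fx: "f x = u\<^sup>2 * b r" by (simp add: f_def u_def r_def power2_eq_square)
    show ?thesis
      unfolding Q1 P gfx fx id kn by simp
  next
    case False
    show ?thesis
    proof (cases "x = 0")
      case True
      have "grad ?u 0 = 0" by (rule grad_eq_0[of "ball 0 \<delta>"]) (use dR in auto)
      then show ?thesis
        using True False dR(1,3) by (simp add: Q_def P1_def P2_def P3_def f_def)
    next
      case nz: False
      then have x: "norm x \<ge> 1" using False by (auto simp: punctured_ball_iff)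
      then have "f x = 0" "grad f x = 0"
        using f0[of x] grad_eq_0_outside_cball[OF f0, where x = x] dR(2) by auto
      then show ?thesis using x False by (simp add: Q_def P1_def P2_def P3_def)
    qed
  qed
  show "integrable lborel (\<lambda>x. indicator punctured_ball x * ((\<psi> (norm x))\<^sup>2 * (norm (D\<Psi> x (grad U (\<Psi> x))))\<^sup>2))"
    unfolding Q_def[symmetric] Q
    by (intro Bochner_Integration.integrable_diff integrable_mult_right ints div(1))
  have "(LINT x|lborel. Q x)
      = (LINT x|lborel. P1 x) - (k / 2)\<^sup>2 * (LINT x|lborel. P2 x) - \<theta> * (1 - \<theta>) * (LINT x|lborel. P3 x)"
    unfolding Q using ints div by simp
  then show "hardy_remainder \<theta> \<alpha> (transf U) =
      (LINT x|lborel. indicator punctured_ball x * ((\<psi> (norm x))\<^sup>2 * (norm (D\<Psi> x (grad U (\<Psi> x))))\<^sup>2))"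
    unfolding hr Q_def[symmetric] by simp
qed

text \<open>The weight in the integrand is \<open>a\<close> times the Jacobian by
  \<open>\<psi>_\<phi>'_identity\<close>, so this is the change of variables for the squared
  gradient of U.\<close>

lemma dirichlet_transf:
  shows "integrable lborel (\<lambda>x. indicator punctured_ball x * ((\<psi> (norm x))\<^sup>2 * ((\<phi>' (norm x))\<^sup>2 * (norm (grad U (\<Psi> x)))\<^sup>2)))"
    "(LINT x|lborel. indicator punctured_ball x * ((\<psi> (norm x))\<^sup>2 * ((\<phi>' (norm x))\<^sup>2 * (norm (grad U (\<Psi> x)))\<^sup>2))) = a * dirichlet U"
proof -
  let ?g = "\<lambda>y. (norm (grad U y))\<^sup>2"
  have gs: "grad U y = 0" if "norm y > R'" for y
    using grad_eq_0_outside_cball[OF U(3) that] .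
  have gi: "integrable lborel ?g"
    by (rule integrable_continuous_compact_support[of _ R'])
       (use U(1) gs in \<open>auto intro!: continuous_intros C1_on_imp_continuous_on_grad\<close>)
  \<comment> \<open>The change of variables requires an integrand vanishing at 0 and outside the
    image ball; at 0 this holds since U vanishes nearby.\<close>
  have g0: "?g y = 0" if "y = 0 \<or> norm y \<ge> \<phi> 1" for y
  proof (cases "y = 0")
    case True
    then show ?thesis using grad_eq_0[of "ball 0 \<delta>'" y U] U(2) \<delta>' by simp
  next
    case False
    then show ?thesis using that gs[of y] R' by simp
  qed
  let ?F = "\<lambda>x::real^'n. indicator (ball 0 1 - {0}) x *
      (\<phi>' (norm x) * (\<phi> (norm x) / norm x) ^ (CARD('n) - 1) * ?g ((\<phi> (norm x) / norm x) *\<^sub>R x))"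
  have F: "integrable lborel ?F" "(LINT x|lborel. ?F x) = (LINT y|lborel. ?g y)"
    by (rule radial_change_of_variables[OF _ _ _ \<phi>_image continuous_\<phi>' gi g0]; use DERIV_\<phi> \<phi>_pos \<phi>'_pos in simp)+
  have "indicator punctured_ball x * ((\<psi> (norm x))\<^sup>2 * ((\<phi>' (norm x))\<^sup>2 * (norm (grad U (\<Psi> x)))\<^sup>2))
      = a * ?F x" for x :: "real^'n"
    using \<psi>_\<phi>'_identity[of "norm x" "CARD('n)"] kn
    by (cases "x \<in> punctured_ball") (auto simp: punctured_ball_iff \<Psi>_def simp flip: punctured_ball_def mult.assoc)
  then show "integrable lborel (\<lambda>x. indicator punctured_ball x * ((\<psi> (norm x))\<^sup>2 * ((\<phi>' (norm x))\<^sup>2 * (norm (grad U (\<Psi> x)))\<^sup>2)))"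
    "(LINT x|lborel. indicator punctured_ball x * ((\<psi> (norm x))\<^sup>2 * ((\<phi>' (norm x))\<^sup>2 * (norm (grad U (\<Psi> x)))\<^sup>2))) = a * dirichlet U"
    using F by (simp_all add: dirichlet_def)
qed

lemma hardy_remainder_transf_ge: "hardy_remainder \<theta> \<alpha> (transf U) \<ge> a * dirichlet U"
  unfolding hardy_remainder_transf(2) dirichlet_transf(2)[symmetric]
proof (rule integral_mono[OF dirichlet_transf(1) hardy_remainder_transf(1)])
  fix x :: "real^'n"
  show "indicator punctured_ball x * ((\<psi> (norm x))\<^sup>2 * ((\<phi>' (norm x))\<^sup>2 * (norm (grad U (\<Psi> x)))\<^sup>2))
     \<le> indicator punctured_ball x * ((\<psi> (norm x))\<^sup>2 * (norm (D\<Psi> x (grad U (\<Psi> x))))\<^sup>2)"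
    using norm_D\<Psi>_ge[of x "grad U (\<Psi> x)"] by (cases "x \<in> punctured_ball") (auto intro: mult_left_mono)
qed

lemma hardy_remainder_transf_eq:
  assumes "\<And>y. \<exists>c. grad U y = c *\<^sub>R y"
  shows "hardy_remainder \<theta> \<alpha> (transf U) = a * dirichlet U"
  unfolding hardy_remainder_transf(2) dirichlet_transf(2)[symmetric]
proof (rule Bochner_Integration.integral_cong[OF refl])
  fix x :: "real^'n"
  obtain c where "grad U (\<Psi> x) = c *\<^sub>R \<Psi> x" using assms by blast
  then have "grad U (\<Psi> x) = (c * (\<phi> (norm x) / norm x)) *\<^sub>R x" by (simp add: \<Psi>_def)
  then show "indicator punctured_ball x * ((\<psi> (norm x))\<^sup>2 * (norm (D\<Psi> x (grad U (\<Psi> x))))\<^sup>2) =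
      indicator punctured_ball x * ((\<psi> (norm x))\<^sup>2 * ((\<phi>' (norm x))\<^sup>2 * (norm (grad U (\<Psi> x)))\<^sup>2))"
    using norm_D\<Psi>_parallel[of x] by (cases "x \<in> punctured_ball") auto
qed

text \<open>Change of variables together with \<open>weight_identity\<close>. Raised to the power
  \<open>2 / p\<close>, the factor \<open>a\<close> joins the one in front of the Dirichlet integral
  and makes up the constant of the theorem.\<close>

lemma weighted_p_integral_transf:
  assumes p: "2 < p" "p \<le> 2 * real CARD('n) / (real CARD('n) - 2)"
  shows "a * weighted_p_integral p \<alpha> (transf U) = hs_integral p U"
proof -
  let ?e = "hs_exponent TYPE('n) p"
  let ?g = "\<lambda>y. norm y powr ?e * \<bar>U y\<bar> powr p"
  have e: "?e = p * k / 2 - (k + 2)" using kn by (simp add: hs_exponent_def)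
  have gi: "integrable lborel ?g"
    using C1_approx_function_integral(2)[OF n3 p C1_approx_const[OF U(1,3)],
        where W = "\<lambda>y. norm y powr ?e" and B = 1 and \<beta> = "- ?e" and q = p]
      hs_exponent_bounds[OF n3 p] p by auto
  have g0: "?g y = 0" if "y = 0 \<or> norm y \<ge> \<phi> 1" for y
    using that U(3)[of y] R' by auto
  let ?F = "\<lambda>x::real^'n. indicator (ball 0 1 - {0}) x *
      (\<phi>' (norm x) * (\<phi> (norm x) / norm x) ^ (CARD('n) - 1) * ?g ((\<phi> (norm x) / norm x) *\<^sub>R x))"
  have F: "(LINT x|lborel. ?F x) = (LINT y|lborel. ?g y)"
    by (rule radial_change_of_variables(2)[OF _ _ _ \<phi>_image continuous_\<phi>' gi g0]; use DERIV_\<phi> \<phi>_pos \<phi>'_pos in simp)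
  have eq: "a * (indicator (ball 0 1) x *\<^sub>R (norm x powr ?e * X_log (\<alpha> * norm x) powr ((p
      + 2) / 2) * \<bar>transf U x\<bar> powr p)) = ?F x" for x
  proof (cases "x \<in> punctured_ball")
    case True
    then have r: "0 < norm x" "norm x < 1" by (auto simp: punctured_ball_iff)
    have "\<bar>transf U x\<bar> powr p = \<psi> (norm x) powr p * \<bar>U (\<Psi> x)\<bar> powr p"
      using \<psi>_pos[of "norm x"] r by (simp add: transf_eq[OF True] abs_mult powr_mult)
    then have "a * (indicator (ball 0 1) x *\<^sub>R (norm x powr ?e * X_log (\<alpha> * norm x) powr ((p
        + 2) / 2) * \<bar>transf U x\<bar> powr p))
      = a * (norm x powr ?e * (1 / s (norm x)) powr ((p + 2) / 2) * \<psi> (norm x) powr p) * \<bar>U (\<Psi> x)\<bar> powr p"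
      using r by (simp add: X_log_eq)
    also have "\<dots> = \<phi>' (norm x) * (\<phi> (norm x) / norm x) ^ (CARD('n) - 1) * \<phi> (norm x) powr ?e * \<bar>U (\<Psi> x)\<bar> powr p"
      using weight_identity[of "norm x" "CARD('n)" ?e p] r kn e by simp
    also have "\<dots> = ?F x"
      using r norm_\<Psi>[OF True] by (simp add: \<Psi>_def)
    finally show ?thesis .
  next
    case False
    then show ?thesis by (cases "x = 0") (auto simp: punctured_ball_iff transf_def)
  qed
  have "a * weighted_p_integral p \<alpha> (transf U) = (LINT x|lborel. a * (indicator (ball 0 1) x *\<^sub>R
      (norm x powr ?e * X_log (\<alpha> * norm x) powr ((p + 2) / 2) * \<bar>transf U x\<bar> powr p)))"
    unfolding weighted_p_integral_def set_lebesgue_integral_def hs_exponent_def by simp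
  also have "\<dots> = hs_integral p U"
    unfolding eq F hs_integral_def ..
  finally show ?thesis .
qed

end

text \<open>U is obtained by pulling u back along the inverse map and dividing by the ground state.
  Every \<open>C^1\<close> function vanishing near the origin and near the unit sphere is thus
  within reach of the transformed problem.\<close>

lemma transf_surj:
  fixes u :: "real^'n::finite \<Rightarrow> real"
  assumes u: "C1_on UNIV u" "\<And>x. norm x < \<delta> \<Longrightarrow> u x = 0" "\<And>x. norm x > R \<Longrightarrow> u x = 0"
    and R: "R < 1" and \<delta>: "\<delta> > 0"
  obtains U R' \<delta>' where "C1_on UNIV U" "\<And>y. norm y < \<delta>' \<Longrightarrow> U y = 0" "\<And>y. norm y > R' \<Longrightarrow> U y = 0"
    "R' < \<phi> 1" "\<delta>' > 0" "transf U = u"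
proof -
  define A where "A = {y::real^'n. 0 < norm y \<and> norm y < \<phi> 1}"
  define \<Phi> where "\<Phi> y = (\<iota> (norm y) / norm y) *\<^sub>R y" for y :: "real^'n"
  define U where "U y = (if y \<in> A then u (\<Phi> y) / \<psi> (\<iota> (norm y)) else 0)" for y
  \<comment> \<open>Here and for \<open>\<delta>'\<close> the comparison with \<open>1/2\<close>
    keeps the argument of \<phi> strictly between 0 and 1.\<close>
  define R' where "R' = \<phi> (max R (1/2))"
  define \<delta>' where "\<delta>' = \<phi> (min \<delta> (1/2))"
  have A: "0 < norm y" "norm y < \<phi> 1" if "y \<in> A" for y using that by (auto simp: A_def)
  have norm\<Phi>: "norm (\<Phi> y) = \<iota> (norm y)" if "y \<in> A" for y
    using \<iota>[OF A[OF that]] A[OF that] by (simp add: \<Phi>_def)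
  have oA: "open A"
  proof -
    have "open (norm -` {0<..<\<phi> 1} :: (real^'n) set)" by (intro open_vimage continuous_intros)
    then show ?thesis by (simp add: A_def vimage_def)
  qed
  have R': "R' < \<phi> 1" unfolding R'_def using R by (intro \<phi>_strict_mono) auto
  have R'0: "0 < R'" unfolding R'_def using R by (intro \<phi>_pos) auto
  have \<delta>'0: "\<delta>' > 0" unfolding \<delta>'_def using \<delta> by (intro \<phi>_pos) auto
  have U2: "U y = 0" if "norm y < \<delta>'" for y
  proof (cases "y \<in> A")
    case True
    have "\<iota> (norm y) < \<delta>"
    proof (rule ccontr)
      assume "\<not> \<iota> (norm y) < \<delta>"
      then have "min \<delta> (1/2) \<le> \<iota> (norm y)" by linarith
      then have "\<phi> (min \<delta> (1/2)) \<le> \<phi> (\<iota> (norm y))"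
        using \<phi>_strict_mono[of "min \<delta> (1/2)" "\<iota> (norm y)"] \<iota>[OF A[OF True]] \<delta>
        by (cases "min \<delta> (1/2) = \<iota> (norm y)") auto
      then show False using \<iota>(3)[OF A[OF True]] that by (simp add: \<delta>'_def)
    qed
    then show ?thesis using u(2)[of "\<Phi> y"] norm\<Phi>[OF True] by (simp add: U_def)
  qed (simp add: U_def)
  have U3: "U y = 0" if "norm y > R'" for y
  proof (cases "y \<in> A")
    case True
    have "\<iota> (norm y) > R"
    proof (rule ccontr)
      assume "\<not> \<iota> (norm y) > R"
      then have "\<iota> (norm y) \<le> max R (1/2)" by linarith
      then have "\<phi> (\<iota> (norm y)) \<le> \<phi> (max R (1/2))"
        using \<phi>_strict_mono[of "\<iota> (norm y)" "max R (1/2)"] \<iota>[OF A[OF True]] R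
        by (cases "max R (1/2) = \<iota> (norm y)") auto
      then show False using \<iota>(3)[OF A[OF True]] that by (simp add: R'_def)
    qed
    then show ?thesis using u(3)[of "\<Phi> y"] norm\<Phi>[OF True] by (simp add: U_def)
  qed (simp add: U_def)
  have C1U: "C1_on UNIV U"
  proof -
    have n: "C1_on A norm" by (rule C1_on_norm) (auto simp: A_def)
    have i: "C1_on A (\<lambda>y. \<iota> (norm y))" by (rule C1_on_compose[OF n C1_\<iota>]) (auto simp: A_def)
    have inv: "C1_on {0<..} (inverse :: real \<Rightarrow> real)"
      by (rule C1_on_inverse_real) simp
    have n': "C1_on A (\<lambda>y. inverse (norm y))" by (rule C1_on_compose[OF n inv]) (auto simp: A_def)
    have "C1_on A \<Phi>"
      unfolding \<Phi>_def[abs_def] divide_inverse by (intro C1_on_scaleR C1_on_mult i n' C1_on_ident)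
    then have 1: "C1_on A (\<lambda>y. u (\<Phi> y))" by (rule C1_on_compose[OF _ u(1)]) auto
    have 2: "C1_on A (\<lambda>y. \<psi> (\<iota> (norm y)))"
      by (rule C1_on_compose[OF i C1_\<psi>]) (use \<iota>[OF A] in auto)
    have 3: "C1_on A (\<lambda>y. inverse (\<psi> (\<iota> (norm y))))"
      by (rule C1_on_compose[OF 2 inv]) (use \<iota>[OF A] \<psi>_pos in \<open>auto simp: less_imp_le\<close>)
    have "C1_on A U"
      by (rule C1_on_cong[OF C1_on_mult[OF 1 3] oA]) (simp add: U_def divide_inverse)
    moreover have "C1_on (ball 0 \<delta>') U"
      by (rule C1_on_cong[OF C1_on_const[of _ 0]]) (auto simp: U2)
    moreover have o: "open {y::real^'n. norm y > R'}"
      using open_vimage[of "{R'<..}" "norm :: real^'n \<Rightarrow> real"]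
          by (auto simp: vimage_def intro: continuous_intros)
    moreover have "C1_on {y. norm y > R'} U"
      by (rule C1_on_cong[OF C1_on_const[of _ 0] o]) (auto simp: U3)
    ultimately have "C1_on ((A \<union> ball 0 \<delta>') \<union> {y. norm y > R'}) U"
      by (intro C1_on_Un oA open_Un) auto
    moreover have "(A \<union> ball 0 \<delta>') \<union> {y. norm y > R'} = UNIV"
      using \<delta>'0 R' by (auto simp: A_def)
    ultimately show ?thesis by simp
  qed
  have "transf U x = u x" for x
  proof (cases "x \<in> punctured_ball")
    case True
    then have r: "0 < norm x" "norm x < 1" by (auto simp: punctured_ball_iff)
    have n: "norm (\<Psi> x) = \<phi> (norm x)" by (rule norm_\<Psi>[OF True])
    have p: "\<phi> (norm x) > 0" "\<phi> (norm x) < \<phi> 1" using \<phi>_pos \<phi>_strict_mono r by auto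
    then have PA: "\<Psi> x \<in> A" by (simp only: A_def mem_Collect_eq n)
    have "\<Phi> (\<Psi> x) = x"
      using r p by (simp add: \<Phi>_def n \<iota>_\<phi> ) (simp add: \<Psi>_def)
    then show ?thesis
      using r PA \<psi>_pos[of "norm x"] by (simp add: transf_def U_def n \<iota>_\<phi>)
  next
    case False
    then show ?thesis
      using u(2)[of x] u(3)[of x] \<delta> R by (cases "x = 0") (auto simp: transf_def punctured_ball_iff)
  qed
  then have "transf U = u" by auto
  with C1U U2 U3 R' \<delta>'0 show ?thesis by (rule that)
qed

end

section \<open>Polarization\<close>

text \<open>Reflection in the hyperplane of all z with \<open>z \<bullet> d = c\<close>. The normal
  is not normalized, so that \<open>d = y - x\<close> can be used directly.\<close>

definition reflect :: "'a::real_inner \<Rightarrow> real \<Rightarrow> 'a \<Rightarrow> 'a"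
  where "reflect d c z = z - (2 * (z \<bullet> d - c) / (d \<bullet> d)) *\<^sub>R d"

text \<open>The larger of the two values goes to the half-space
  \<open>z \<bullet> d \<le> c\<close>, which contains the origin when
  \<open>c \<ge> 0\<close>.\<close>

definition polarization :: "'a::real_inner \<Rightarrow> real \<Rightarrow> ('a \<Rightarrow> real) \<Rightarrow> 'a \<Rightarrow> real"
  where "polarization d c v z =
    (if z \<bullet> d \<le> c then max (v z) (v (reflect d c z)) else min (v z) (v (reflect d c z)))"

lemma inner_reflect: "d \<noteq> 0 \<Longrightarrow> reflect d c z \<bullet> d = 2 * c - z \<bullet> d"
  by (simp add: reflect_def inner_diff_left)

lemma reflect_reflect: "d \<noteq> 0 \<Longrightarrow> reflect d c (reflect d c z) = z"
  by (subst reflect_def) (simp add: inner_reflect,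
      simp add: reflect_def algebra_simps flip: scaleR_add_left add_divide_distrib)

text \<open>The last term is nonnegative for two points on the same side. This one formula yields
  that reflections are isometries, that crossing the hyperplane lengthens distances, and, with
  \<open>x = 0\<close>, how norms change.\<close>

lemma dist_reflect_cross:
  assumes "d \<noteq> 0"
  shows "(dist x (reflect d c y))\<^sup>2 = (dist x y)\<^sup>2 + 4 * (c - x \<bullet> d) * (c - y \<bullet> d) / (d \<bullet> d)"
proof -
  define t where "t = 2 * (y \<bullet> d - c) / (d \<bullet> d)"
  have dd: "d \<bullet> d > 0" using assms by simp
  have t: "t * (d \<bullet> d) = 2 * (y \<bullet> d - c)" using dd by (simp add: t_def)
  have "(dist x (reflect d c y))\<^sup>2 = ((x - y) + t *\<^sub>R d) \<bullet> ((x - y) + t *\<^sub>R d)"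
    by (simp add: dist_norm power2_norm_eq_inner reflect_def t_def algebra_simps)
  also have "\<dots> = (x - y) \<bullet> (x - y) + (2 * t * ((x - y) \<bullet> d) + t * (t * (d \<bullet> d)))"
    by (simp add: inner_add_left inner_add_right inner_commute algebra_simps)
  also have "2 * t * ((x - y) \<bullet> d) + t * (t * (d \<bullet> d)) = 4 * (c - x \<bullet> d) * (c - y \<bullet> d) / (d \<bullet> d)"
  proof -
    have "2 * t * ((x - y) \<bullet> d) + t * (t * (d \<bullet> d)) = t * (2 * (x \<bullet> d) - 2 * c)"
      unfolding t by (simp add: inner_diff_left algebra_simps)
    also have "\<dots> = (2 * (y \<bullet> d - c) * (2 * (x \<bullet> d) - 2 * c)) / (d \<bullet> d)" by (simp add: t_def)
    also have "2 * (y \<bullet> d - c) * (2 * (x \<bullet> d) - 2 * c) = 4 * (c - x \<bullet> d) * (c - y \<bullet> d)"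
      by (simp add: algebra_simps)
    finally show ?thesis .
  qed
  finally show ?thesis by (simp add: dist_norm power2_norm_eq_inner)
qed

lemma dist_reflect: 
  assumes "d \<noteq> 0"
  shows "dist (reflect d c x) (reflect d c y) = dist x y"
proof -
  have "(dist (reflect d c x) (reflect d c y))\<^sup>2
      = (dist (reflect d c x) y)\<^sup>2 + 4 * (c - reflect d c x \<bullet> d) * (c - y \<bullet> d) / (d \<bullet> d)"
    by (rule dist_reflect_cross[OF assms])
  also have "(dist (reflect d c x) y)\<^sup>2 = (dist x y)\<^sup>2 + 4 * (c - y \<bullet> d) * (c - x \<bullet> d) / (d \<bullet> d)"
    using dist_reflect_cross[OF assms, of y c x] by (simp add: dist_commute)
  finally have "(dist (reflect d c x) (reflect d c y))\<^sup>2 = (dist x y)\<^sup>2"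
    using assms by (simp add: inner_reflect[OF assms] field_simps)
  then show ?thesis by simp
qed

lemma dist_reflect_swap: "d \<noteq> 0 \<Longrightarrow> dist (reflect d c x) y = dist x (reflect d c y)"
  using dist_reflect[of d c x "reflect d c y"] by (simp add: reflect_reflect)

lemma norm_reflect:
  assumes "d \<noteq> 0"
  shows "(norm (reflect d c x))\<^sup>2 = (norm x)\<^sup>2 + 4 * c * (c - x \<bullet> d) / (d \<bullet> d)"
  using dist_reflect_cross[OF assms, of 0 c x] by simp

lemma norm_reflect_ge:
  assumes "d \<noteq> 0" "c \<ge> 0" "x \<bullet> d \<le> c"
  shows "norm x \<le> norm (reflect d c x)"
proof (rule power2_le_imp_le)
  show "(norm x)\<^sup>2 \<le> (norm (reflect d c x))\<^sup>2"
    unfolding norm_reflect[OF assms(1)] using assms by simp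
qed simp

lemma dist_reflect_ge:
  assumes "d \<noteq> 0" "x \<bullet> d \<le> c" "y \<bullet> d \<le> c"
  shows "dist x y \<le> dist x (reflect d c y)"
proof (rule power2_le_imp_le)
  show "(dist x y)\<^sup>2 \<le> (dist x (reflect d c y))\<^sup>2"
    unfolding dist_reflect_cross[OF assms(1)] using assms by simp
qed simp

lemma continuous_reflect: "continuous_on S (reflect d c)"
  unfolding reflect_def[abs_def] by (cases "d = 0") (auto intro!: continuous_intros)

lemma reflect_measurable [measurable]: "reflect (d :: 'a::euclidean_space) c \<in> borel_measurable borel"
  by (intro borel_measurable_continuous_onI continuous_reflect)

text \<open>The reflection is the orthogonal map \<open>reflect d 0\<close> followed by a
  translation.\<close>

lemma lborel_distr_reflect:
  fixes d :: "real^'n::finite"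
  assumes "d \<noteq> 0"
  shows "distr lborel borel (reflect d c) = lborel"
proof -
  let ?w = "(2 * c / (d \<bullet> d)) *\<^sub>R d"
  have "linear (reflect d 0)"
    by (rule linearI) (simp_all add: reflect_def inner_add_left algebra_simps add_divide_distrib)
  moreover have "norm (reflect d 0 x) = norm x" for x
    using norm_reflect[OF assms, of 0 x] by simp
  ultimately have o: "orthogonal_transformation (reflect d 0)"
    by (simp add: orthogonal_transformation)
  have eq: "reflect d c = (+) ?w \<circ> reflect d 0"
    by (auto simp: fun_eq_iff reflect_def algebra_simps diff_divide_distrib)
  have "distr lborel borel (reflect d c) = distr (distr lborel borel (reflect d 0)) borel ((+) ?w)"
    unfolding eq by (subst distr_distr) auto
  then show ?thesis by (simp add: lborel_distr_orthogonal[OF o] lborel_distr_plus)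
qed

lemma nn_integral_reflect:
  fixes d :: "real^'n::finite"
  assumes "d \<noteq> 0" "f \<in> borel_measurable borel"
  shows "(\<integral>\<^sup>+x. f (reflect d c x) \<partial>lborel) = (\<integral>\<^sup>+x. f x \<partial>lborel)"
proof -
  have "(\<integral>\<^sup>+x. f x \<partial>lborel) = (\<integral>\<^sup>+x. f x \<partial>distr lborel borel (reflect d c))"
    by (simp add: lborel_distr_reflect[OF assms(1)])
  also have "\<dots> = (\<integral>\<^sup>+x. f (reflect d c x) \<partial>lborel)"
    using assms(2) by (subst nn_integral_distr) auto
  finally show ?thesis by simp
qed

lemma integral_reflect:
  fixes d :: "real^'n::finite" and f :: "real^'n \<Rightarrow> real"
  assumes "d \<noteq> 0" "integrable lborel f"
  shows "integrable lborel (\<lambda>x. f (reflect d c x))" "(LINT x|lborel. f (reflect d c x))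
      = (LINT x|lborel. f x)"
proof -
  have m: "f \<in> borel_measurable borel" using assms(2) by auto
  note di = lborel_distr_reflect[OF assms(1), of c]
  show "integrable lborel (\<lambda>x. f (reflect d c x))"
    using assms m by (subst integrable_distr_eq[symmetric, of _ _ borel]) (auto simp: di)
  show "(LINT x|lborel. f (reflect d c x)) = (LINT x|lborel. f x)"
    using assms m by (subst integral_distr[symmetric, of _ _ borel]) (auto simp: di)
qed

text \<open>The Dirichlet integral in the form of difference quotients. Unlike the Dirichlet integral itself,
  it makes sense for arbitrary functions, and polarization decreases it by a pointwise argument.\<close>

definition nonlocal_energy :: "real \<Rightarrow> (real^'n::finite \<Rightarrow> real) \<Rightarrow> ennreal"
  where "nonlocal_energy h v =
    (\<integral>\<^sup>+x. (\<integral>\<^sup>+y. ennreal (of_bool (dist x y < h) * (v x - v y)\<^sup>2) \<partial>lborel) \<partial>lborel)"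

lemma polarization_pair:
  assumes "d \<noteq> 0" "x \<bullet> d \<le> c"
  shows "polarization d c v x = max (v x) (v (reflect d c x))"
    "polarization d c v (reflect d c x) = min (v x) (v (reflect d c x))"
proof -
  show "polarization d c v x = max (v x) (v (reflect d c x))"
    using assms by (simp add: polarization_def)
  show "polarization d c v (reflect d c x) = min (v x) (v (reflect d c x))"
  proof (cases "x \<bullet> d = c")
    case True
    then have "reflect d c x = x" by (simp add: reflect_def)
    then show ?thesis by (simp add: polarization_def)
  next
    case False
    then show ?thesis using assms by (auto simp: polarization_def inner_reflect reflect_reflect min.commute)
  qed
qed

text \<open>Here \<open>a\<close>, \<open>b\<close> are the values at a point and its mirror image,
  \<open>c\<close>, \<open>d\<close> those at another pair; \<open>K1\<close> weighs same-side and
  \<open>K2\<close> cross interactions. If the pairs are oppositely ordered, one of them is swapped,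
  which gains \<open>2 * (K1 - K2) * (a - b) * (d - c)\<close>; otherwise the sum is
  unchanged.\<close>

lemma two_point_inequality:
  fixes a b c d :: real
  assumes "0 \<le> K2" "K2 \<le> K1"
  shows "K1 * (max a b - max c d)\<^sup>2 + K2 * (min a b - max c d)\<^sup>2 + K2 * (max a b - min c d)\<^sup>2
      + K1 * (min a b - min c d)\<^sup>2
    \<le> K1 * (a - c)\<^sup>2 + K2 * (b - c)\<^sup>2 + K2 * (a - d)\<^sup>2 + K1 * (b - d)\<^sup>2"
proof -
  have swap: "K1 * (a - d)\<^sup>2 + K2 * (b - d)\<^sup>2 + K2 * (a - c)\<^sup>2 + K1 * (b - c)\<^sup>2
    \<le> K1 * (a - c)\<^sup>2 + K2 * (b - c)\<^sup>2 + K2 * (a - d)\<^sup>2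
        + K1 * (b - d)\<^sup>2" if "(a - b) * (d - c) \<ge> 0" for a b c d
  proof -
    have "(K1 - K2) * ((a - b) * (d - c)) \<ge> 0"
      by (rule mult_nonneg_nonneg) (simp_all only: assms that diff_ge_0_iff_ge)
    moreover have "(K1 * (a - c)\<^sup>2 + K2 * (b - c)\<^sup>2 + K2 * (a - d)\<^sup>2 + K1 * (b - d)\<^sup>2)
      - (K1 * (a - d)\<^sup>2 + K2 * (b - d)\<^sup>2 + K2 * (a - c)\<^sup>2 + K1 * (b - c)\<^sup>2)
          = 2 * ((K1 - K2) * ((a - b) * (d - c)))"
      by (simp add: power2_eq_square algebra_simps)
    ultimately show ?thesis by linarith
  qed
  consider "a \<ge> b" "c \<ge> d" | "a \<ge> b" "c \<le> d" | "a \<le> b" "c \<ge> d" | "a \<le> b" "c \<le> d" by linarith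
  then show ?thesis
  proof cases
    case 2
    then have "(a - b) * (d - c) \<ge> 0" by (intro mult_nonneg_nonneg) auto
    from swap[OF this] show ?thesis using 2 by (simp add: max_absorb1 max_absorb2 min_absorb1 min_absorb2)
  next
    case 3
    then have "(a - b) * (d - c) \<ge> 0" by (intro mult_nonpos_nonpos) auto
    from swap[OF this] show ?thesis using 3 by (simp add: max_absorb1 max_absorb2 min_absorb1 min_absorb2)
  qed (simp_all add: max_absorb1 max_absorb2 min_absorb1 min_absorb2)
qed

lemma polarization_measurable:
  fixes v :: "real^'n::finite \<Rightarrow> real"
  assumes [measurable]: "v \<in> borel_measurable borel"
  shows "polarization d c v \<in> borel_measurable borel"
  unfolding polarization_def[abs_def] by measurable

text \<open>Averaging over the reflections of x and of y turns the comparison of the double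
  integrals into a pointwise one, namely \<open>two_point_inequality\<close>.\<close>

lemma nonlocal_energy_polarization:
  fixes v :: "real^'n::finite \<Rightarrow> real"
  assumes d: "d \<noteq> 0" and [measurable]: "v \<in> borel_measurable borel"
  shows "nonlocal_energy h (polarization d c v) \<le> nonlocal_energy h v"
proof -
  let ?\<sigma> = "reflect d c"
  define q :: "(real^'n \<Rightarrow> real) \<Rightarrow> real^'n \<Rightarrow> real^'n \<Rightarrow> real" where
      "q v x y = of_bool (dist x y < h) * (v x - v y)\<^sup>2" for v x y
  \<comment> \<open>The sum over the four reflected pairs; its double integral is four times the
    energy because reflections preserve the measure.\<close>
  define S where "S v x y = q v x y + q v (?\<sigma> x) y + q v x (?\<sigma> y) + q v (?\<sigma> x) (?\<sigma> y)" for v x y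
  have q0: "q v x y \<ge> 0" for v x y by (simp add: q_def)
  have Ssym: "S v (?\<sigma> x) y = S v x y" "S v x (?\<sigma> y) = S v x y" for v x y
    by (simp_all add: S_def reflect_reflect[OF d])
  have SH: "S (polarization d c v) x y \<le> S v x y" if "x \<bullet> d \<le> c" "y \<bullet> d \<le> c" for v x y
  proof -
    let ?K1 = "of_bool (dist x y < h) :: real" and ?K2 = "of_bool (dist x (?\<sigma> y) < h) :: real"
    have "?K2 \<le> ?K1" using dist_reflect_ge[OF d that] by auto
    then show ?thesis
      unfolding S_def q_def dist_reflect[OF d] dist_reflect_swap[OF d] reflect_reflect[OF d] polarization_pair[OF d that(1)] polarization_pair[OF d that(2)]
      by (intro two_point_inequality) auto
  qed
  \<comment> \<open>\<open>S\<close> is unchanged when x or y is reflected, so both points may be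
    assumed on the favoured side.\<close>
  have S: "S (polarization d c v) x y \<le> S v x y" for x y
  proof -
    obtain x' where x': "x' \<bullet> d \<le> c" "x' = x \<or> x' = ?\<sigma> x"
      by (cases "x \<bullet> d \<le> c") (force simp: inner_reflect[OF d])+
    obtain y' where y': "y' \<bullet> d \<le> c" "y' = y \<or> y' = ?\<sigma> y"
      by (cases "y \<bullet> d \<le> c") (force simp: inner_reflect[OF d])+
    have "S w x' y' = S w x y" for w
      using x'(2) y'(2) Ssym by metis
    then show ?thesis using SH[OF x'(1) y'(1), of v] by simp
  qed
  have key: "(\<integral>\<^sup>+x. (\<integral>\<^sup>+y. ennreal (S w x y) \<partial>lborel) \<partial>lborel) = nonlocal_energy h w + nonlocal_energy h w
      + nonlocal_energy h w + nonlocal_energy h w"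
    if [measurable]: "w \<in> borel_measurable borel" for w
  proof -
    let ?Q = "\<lambda>x y. ennreal (q w x y)"
    have [measurable]: "(\<lambda>(x, y). ?Q x y) \<in> borel_measurable (borel \<Otimes>\<^sub>M borel)"
      unfolding q_def by measurable
    have m: "(\<lambda>x. \<integral>\<^sup>+y. ?Q x y \<partial>lborel) \<in> borel_measurable borel" by measurable
    have m' [measurable]: "(\<lambda>y. ?Q x y) \<in> borel_measurable borel" for x by measurable
    have m'' [measurable]: "(\<lambda>x. \<integral>\<^sup>+y. ?Q (?\<sigma> x) y \<partial>lborel) \<in> borel_measurable borel"
      by (rule measurable_compose[OF reflect_measurable m])
    have inner: "(\<integral>\<^sup>+y. ?Q x (?\<sigma> y) \<partial>lborel) = (\<integral>\<^sup>+y. ?Q x y \<partial>lborel)" for x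
      by (rule nn_integral_reflect[OF d m'])
    have "(\<integral>\<^sup>+y. ennreal (S w x y) \<partial>lborel) =
      (\<integral>\<^sup>+y. ?Q x y \<partial>lborel) + (\<integral>\<^sup>+y. ?Q (?\<sigma> x) y \<partial>lborel) + (\<integral>\<^sup>+y. ?Q x y \<partial>lborel)
          + (\<integral>\<^sup>+y. ?Q (?\<sigma> x) y \<partial>lborel)" for x
    proof -
      have [measurable]: "(\<lambda>y. ?Q x (?\<sigma> y)) \<in> borel_measurable borel" for x
        by (rule measurable_compose[OF reflect_measurable m'])
      show ?thesis
        unfolding S_def using m' by (simp add: ennreal_plus q0 nn_integral_add inner)
    qed
    then have "(\<integral>\<^sup>+x. (\<integral>\<^sup>+y. ennreal (S w x y) \<partial>lborel) \<partial>lborel) =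
      (\<integral>\<^sup>+x. (\<integral>\<^sup>+y. ?Q x y \<partial>lborel) \<partial>lborel) + (\<integral>\<^sup>+x. (\<integral>\<^sup>+y. ?Q (?\<sigma> x) y \<partial>lborel) \<partial>lborel)
      + (\<integral>\<^sup>+x. (\<integral>\<^sup>+y. ?Q x y \<partial>lborel) \<partial>lborel) + (\<integral>\<^sup>+x. (\<integral>\<^sup>+y. ?Q (?\<sigma> x) y \<partial>lborel) \<partial>lborel)"
      by (simp add: nn_integral_add)
    moreover have "(\<integral>\<^sup>+x. (\<integral>\<^sup>+y. ?Q (?\<sigma> x) y \<partial>lborel) \<partial>lborel) = (\<integral>\<^sup>+x. (\<integral>\<^sup>+y. ?Q x y \<partial>lborel) \<partial>lborel)"
      by (rule nn_integral_reflect[OF d m])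
    ultimately show ?thesis by (simp add: nonlocal_energy_def q_def)
  qed
  have 4: "e + e + e + e = 4 * e" for e :: ennreal
    by (metis (no_types,
        lifting) ab_semigroup_add_class.add_ac(1) mult_2 mult.assoc numeral_Bit0 distrib_right numeral_code(2))
  have "4 * nonlocal_energy h (polarization d c v) \<le> 4 * nonlocal_energy h v"
    unfolding 4[symmetric] key[OF polarization_measurable[OF assms(2)], symmetric] key[OF assms(2), symmetric]
    by (intro nn_integral_mono ennreal_leI S)
  then show ?thesis
    by (subst (asm) ennreal_mult_le_mult_iff) auto
qed

lemma hs_integrable:
  fixes v :: "real^'n::finite \<Rightarrow> real"
  assumes n3: "CARD('n) \<ge> 3" and p: "2 < p" "p \<le> 2 * real CARD('n) / (real CARD('n) - 2)"
    and [measurable]: "v \<in> borel_measurable borel" and v: "\<And>x. \<bar>v x\<bar> \<le> M" "\<And>x. norm x > R \<Longrightarrow> v x = 0"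
  shows "integrable lborel (\<lambda>x. norm x powr hs_exponent TYPE('n) p * \<bar>v x\<bar> powr p)"
proof (rule norm_powr_dominated_convergence(2))
  show "0 \<le> - hs_exponent TYPE('n) p" "- hs_exponent TYPE('n) p < CARD('n)"
    using hs_exponent_bounds[OF n3 p] by auto
  show "\<bar>norm x powr hs_exponent TYPE('n) p * \<bar>v x\<bar> powr p\<bar>
      \<le> M powr p * norm x powr (- (- hs_exponent TYPE('n) p))" for x
    using v(1)[of x] p by (auto simp: abs_mult mult.commute intro!: mult_right_mono powr_mono2)
  show "norm x powr hs_exponent TYPE('n) p * \<bar>v x\<bar> powr p = 0" if "norm x > R" for x
    using v(2)[OF that] by simp
qed (auto)

text \<open>A rearrangement inequality on each pair of mirror points: the weight exponent is not
  positive, so the point nearer to the origin carries the larger weight, and it receives the larger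
  value.\<close>

lemma hs_integral_polarization:
  fixes v :: "real^'n::finite \<Rightarrow> real"
  assumes n3: "CARD('n) \<ge> 3" and p: "2 < p" "p \<le> 2 * real CARD('n) / (real CARD('n) - 2)"
    and [measurable]: "v \<in> borel_measurable borel" and v: "\<And>x. 0 \<le> v x" "\<And>x. v x \<le> M" "\<And>x. norm x > R \<Longrightarrow> v x
        = 0"
    and dc: "d \<noteq> 0" "c \<ge> 0"
    and pv: "\<And>x. norm x > R \<Longrightarrow> polarization d c v x = 0" "\<And>x. 0 \<le> polarization d c v x"
        "\<And>x. polarization d c v x \<le> M"
  shows "hs_integral p v \<le> hs_integral p (polarization d c v)"
proof -
  let ?\<sigma> = "reflect d c" and ?e = "hs_exponent TYPE('n) p"
  let ?f = "\<lambda>w x. norm x powr ?e * \<bar>w x\<bar> powr p"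
  have [measurable]: "polarization d c v \<in> borel_measurable borel" by (rule polarization_measurable) simp
  have i: "integrable lborel (?f v)" "integrable lborel (?f (polarization d c v))"
  proof -
    show "integrable lborel (?f v)"
      by (rule hs_integrable[OF n3 p _ _ v(3), where M = M]) (simp_all add: v(1,2))
    show "integrable lborel (?f (polarization d c v))"
      by (rule hs_integrable[OF n3 p _ _ pv(1), where M = M]) (simp_all add: pv(2,3))
  qed
  have dbl: "(LINT x|lborel. ?f w x + ?f w (?\<sigma> x)) = 2 * hs_integral p w"
      "integrable lborel (\<lambda>x. ?f w x + ?f w (?\<sigma> x))"
    if "integrable lborel (?f w)" for w
  proof -
    note r = integral_reflect[OF dc(1) that, of c]
    show "integrable lborel (\<lambda>x. ?f w x + ?f w (?\<sigma> x))"
        by (intro Bochner_Integration.integrable_add that r(1))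
    show "(LINT x|lborel. ?f w x + ?f w (?\<sigma> x)) = 2 * hs_integral p w"
      using that r by (simp add: hs_integral_def)
  qed
  have e0: "?e \<le> 0" using hs_exponent_bounds[OF n3 p] by simp
  have half: "?f v x + ?f v (?\<sigma> x) \<le> ?f (polarization d c v) x + ?f (polarization d c v) (?\<sigma> x)"
    if "x \<bullet> d \<le> c" "x \<noteq> 0" for x
  proof -
    have w: "norm (?\<sigma> x) powr ?e \<le> norm x powr ?e"
      using norm_reflect_ge[OF dc that(1)] that(2) e0 by (intro powr_mono2') auto
    define w1 w2 A B where "w1 = norm x powr ?e" and "w2 = norm (?\<sigma> x) powr ?e" and "A = v x powr p" and
        "B = v (?\<sigma> x) powr p"
    have w12: "w2 \<le> w1" using w by (simp add: w1_def w2_def)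
    have mono: "s powr p \<le> t powr p" if "0 \<le> s" "s \<le> t" for s t :: real using that p
        by (intro powr_mono2) auto
    show ?thesis
    proof (cases "v x \<le> v (?\<sigma> x)")
      case True
      have "(w1 - w2) * (B - A) \<ge> 0"
        using w12 mono[OF v(1) True] by (intro mult_nonneg_nonneg) (auto simp: A_def B_def)
      then have "w1 * A + w2 * B \<le> w1 * B + w2 * A" by (simp add: algebra_simps)
      then show ?thesis
        using True v(1) unfolding polarization_pair[OF dc(1) that(1)] w1_def w2_def A_def B_def
        by (simp add: max_def min_def)
    next
      case False
      then show ?thesis
        unfolding polarization_pair[OF dc(1) that(1)] by (simp add: max_def min_def)
    qed
  qed
  have "2 * hs_integral p v \<le> 2 * hs_integral p (polarization d c v)"
    unfolding dbl(1)[OF i(1), symmetric] dbl(1)[OF i(2), symmetric]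
  proof (rule integral_mono_AE[OF dbl(2)[OF i(1)] dbl(2)[OF i(2)]])
    \<comment> \<open>\<open>0 powr e = 0\<close> breaks the monotonicity of the weight at the
      origin. The mirror image of the origin is excluded too, since the argument may be run from the
      reflected point.\<close>
    have "AE x in lborel. x \<noteq> 0 \<and> x \<noteq> ?\<sigma> 0"
      using AE_lborel_singleton[of "0::real^'n"] AE_lborel_singleton[of "?\<sigma> 0"] by eventually_elim auto
    then show "AE x in lborel. ?f v x + ?f v (?\<sigma> x)
        \<le> ?f (polarization d c v) x + ?f (polarization d c v) (?\<sigma> x)"
    proof eventually_elim
      case (elim x)
      show ?case
      proof (cases "x \<bullet> d \<le> c")
        case True
        then show ?thesis using half elim by blast
      next
        case False
        have "?\<sigma> x \<bullet> d \<le> c" using False by (simp add: inner_reflect[OF dc(1)])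
        moreover have "?\<sigma> x \<noteq> 0" using elim reflect_reflect[OF dc(1), of c x] by metis
        ultimately show ?thesis using half[of "?\<sigma> x"] by (simp add: reflect_reflect[OF dc(1)] add.commute)
      qed
    qed
  qed
  then show ?thesis by simp
qed

text \<open>On one side this is the Lipschitz property of maxima and minima. For points on opposite
  sides the reflected point is no farther away, which also bounds the mixed differences.\<close>

lemma polarization_lipschitz:
  assumes d: "d \<noteq> 0" and v: "\<And>x y. \<bar>v x - v y\<bar> \<le> L * dist x y" and L: "L \<ge> 0"
  shows "\<bar>polarization d c v x - polarization d c v y\<bar> \<le> L * dist x y"
proof -
  let ?\<sigma> = "reflect d c"
  have 1: "\<bar>v x - v y\<bar> \<le> L * dist x y" by (rule v)
  have 2: "\<bar>v (?\<sigma> x) - v (?\<sigma> y)\<bar> \<le> L * dist x y"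
    using v[of "?\<sigma> x" "?\<sigma> y"] by (simp add: dist_reflect[OF d])
  have 3: "\<bar>v x - v (?\<sigma> y)\<bar> \<le> L * dist x y \<and> \<bar>v (?\<sigma> x) - v y\<bar> \<le> L * dist x y"
    if "dist x (?\<sigma> y) \<le> dist x y"
    using v[of x "?\<sigma> y"] v[of "?\<sigma> x" y] mult_left_mono[OF that L] by (auto simp: dist_reflect_swap[OF d])
  consider "x \<bullet> d \<le> c" "y \<bullet> d \<le> c" | "\<not> x \<bullet> d \<le> c" "\<not> y \<bullet> d \<le> c"
    | "x \<bullet> d \<le> c" "\<not> y \<bullet> d \<le> c" | "\<not> x \<bullet> d \<le> c" "y \<bullet> d \<le> c" by blast
  then show ?thesis
  proof cases
    case 1
    then show ?thesis using \<open>\<bar>v x - v y\<bar> \<le> L * dist x y\<close> 2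
      by (auto simp: polarization_def max_def abs_le_iff)
  next
    case 2
    then show ?thesis using 1 \<open>\<bar>v (?\<sigma> x) - v (?\<sigma> y)\<bar> \<le> L * dist x y\<close>
      by (auto simp: polarization_def min_def abs_le_iff)
  next
    case c: 3
    have "dist x (?\<sigma> y) \<le> dist x y"
      using dist_reflect_ge[OF d, of x c "?\<sigma> y"] c by (simp add: inner_reflect[OF d] reflect_reflect[OF d])
    then show ?thesis using 1 2 3 c by (simp add: polarization_def max_def min_def)
  next
    case c: 4
    have "dist y (?\<sigma> x) \<le> dist y x"
      using dist_reflect_ge[OF d, of y c "?\<sigma> x"] c by (simp add: inner_reflect[OF d] reflect_reflect[OF d])
    then have "dist x (?\<sigma> y) \<le> dist x y" by (metis dist_commute dist_reflect_swap[OF d])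
    then show ?thesis using 1 2 3 c by (simp add: polarization_def max_def min_def)
  qed
qed

section \<open>Radial symmetrization by minimizing the second moment\<close>

definition second_moment :: "(real^'n::finite \<Rightarrow> real) \<Rightarrow> real"
  where "second_moment v = (LINT x|lborel. (norm x)\<^sup>2 * v x)"

context
  fixes u :: "real^'n::finite \<Rightarrow> real" and p L M R :: real
  assumes n3: "CARD('n) \<ge> 3" and p: "2 < p" "p \<le> 2 * real CARD('n) / (real CARD('n) - 2)"
    and L: "L \<ge> 0"
begin

text \<open>Each clause survives both polarization with \<open>c \<ge> 0\<close> and pointwise
  limits. The inequalities for energy and weighted integral point in the directions that keep an
  almost optimal quotient almost optimal.\<close>

definition competitor :: "(real^'n \<Rightarrow> real) \<Rightarrow> bool"
  where "competitor v \<longleftrightarrow> (\<forall>x. 0 \<le> v x) \<and> (\<forall>x. v x \<le> M) \<and> (\<forall>x y. \<bar>v x - v y\<bar> \<le> L * dist x y) \<and>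
    (\<forall>x. norm x > R \<longrightarrow> v x = 0) \<and> (\<forall>h. nonlocal_energy h v \<le> nonlocal_energy h u) \<and>
    hs_integral p u \<le> hs_integral p v"

lemma competitorD:
  assumes "competitor v"
  shows "0 \<le> v x" "v x \<le> M" "\<bar>v x - v y\<bar> \<le> L * dist x y" "norm x > R \<Longrightarrow> v x = 0"
    "nonlocal_energy h v \<le> nonlocal_energy h u" "hs_integral p u \<le> hs_integral p v"
  using assms by (auto simp: competitor_def)

lemma competitor_continuous:
  assumes "competitor v"
  shows "continuous_on UNIV v"
proof -
  have "L-lipschitz_on UNIV v"
    using competitorD(3)[OF assms] L by (auto simp: lipschitz_on_def dist_real_def)
  then show ?thesis by (rule lipschitz_on_continuous_on)
qed

lemma competitor_measurable: "competitor v \<Longrightarrow> v \<in> borel_measurable borel"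
  by (intro borel_measurable_continuous_onI competitor_continuous)

lemma competitor_polarization:
  assumes v: "competitor v" and dc: "d \<noteq> 0" "c \<ge> 0"
  shows "competitor (polarization d c v)"
proof -
  note D = competitorD[OF v]
  have 1: "0 \<le> polarization d c v x" "polarization d c v x \<le> M" for x
    using D(1,2) by (auto simp: polarization_def min_le_iff_disj le_max_iff_disj)
  \<comment> \<open>As the origin lies on the favoured side, points outside the ball on that side
    have mirror images still farther out, so the support does not leave the ball.\<close>
  have 2: "polarization d c v x = 0" if "norm x > R" for x
  proof (cases "x \<bullet> d \<le> c")
    case True
    then have "norm (reflect d c x) > R" using norm_reflect_ge[OF dc True] that by simp
    then show ?thesis using that True D(4) by (simp add: polarization_def)
  next
    case False
    then show ?thesis using D(4)[OF that] D(1)[of "reflect d c x"] by (simp add: polarization_def)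
  qed
  have "nonlocal_energy h (polarization d c v) \<le> nonlocal_energy h u" for h
    using nonlocal_energy_polarization[OF dc(1) competitor_measurable[OF v]] D(5) order_trans by blast
  moreover have "hs_integral p u \<le> hs_integral p (polarization d c v)"
    using D(6) hs_integral_polarization[OF n3 p competitor_measurable[OF v] D(1,2,4) dc 2 1]
        by (rule order_trans)
  ultimately show ?thesis
    using 1 2 polarization_lipschitz[OF dc(1) D(3) L] by (auto simp: competitor_def)
qed

lemma second_moment_integrable:
  assumes v: "competitor v"
  shows "integrable lborel (\<lambda>x. (norm x)\<^sup>2 * v x)"
  by (rule integrable_continuous_compact_support[of _ R])
     (auto intro!: continuous_intros competitor_continuous[OF v] simp: competitorD(4)[OF v])

text \<open>Per mirror pair, polarization lowers the second moment by the difference of the squared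
  norms times the amount by which the value at the nearer point rises. If the moment does not drop,
  this continuous nonnegative loss vanishes everywhere, so nothing rises.\<close>

lemma second_moment_polarization_eq:
  assumes v: "competitor v" and dc: "d \<noteq> 0" "c \<ge> 0"
    and le: "second_moment v \<le> second_moment (polarization d c v)"
    and x: "x \<bullet> d \<le> c" "norm x < norm (reflect d c x)"
  shows "v (reflect d c x) \<le> v x"
proof -
  let ?\<sigma> = "reflect d c" and ?w = "polarization d c v"
  let ?f = "\<lambda>w x. (norm x)\<^sup>2 * w x"
  have w: "competitor ?w" by (rule competitor_polarization[OF v dc])
  note i = second_moment_integrable[OF v] second_moment_integrable[OF w]
  note r = integral_reflect[OF dc(1) i(1), of c] integral_reflect[OF dc(1) i(2), of c]
  \<comment> \<open>The loss is symmetrized over mirror pairs, so that it is nonnegative at every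
    point and its integral is twice the loss of the second moment.\<close>
  define \<Delta> where "\<Delta> x = (?f v x + ?f v (?\<sigma> x)) - (?f ?w x + ?f ?w (?\<sigma> x))" for x
  have half: "\<Delta> x = ((norm (?\<sigma> x))\<^sup>2 - (norm x)\<^sup>2) * (max (v x) (v (?\<sigma> x)) - v x)" if "x \<bullet> d \<le> c" for x
    unfolding \<Delta>_def polarization_pair[OF dc(1) that] by (auto simp: max_def min_def algebra_simps)
  have pos: "\<Delta> x \<ge> 0" for x
  proof -
    have pos': "\<Delta> x \<ge> 0" if "x \<bullet> d \<le> c" for x
      unfolding half[OF that] using norm_reflect_ge[OF dc that]
          by (intro mult_nonneg_nonneg) (auto intro: power_mono)
    show ?thesis
    proof (cases "x \<bullet> d \<le> c")
      case False
      then have "?\<sigma> x \<bullet> d \<le> c" by (simp add: inner_reflect[OF dc(1)])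
      from pos'[OF this] show ?thesis by (simp add: \<Delta>_def reflect_reflect[OF dc(1)] algebra_simps)
    qed (rule pos')
  qed
  have int: "integrable lborel \<Delta>"
    unfolding \<Delta>_def by (intro Bochner_Integration.integrable_diff Bochner_Integration.integrable_add i r)
  have "(LINT x|lborel. \<Delta> x) = 2 * second_moment v - 2 * second_moment ?w"
    unfolding \<Delta>_def second_moment_def using i r by simp
  then have "(LINT x|lborel. \<Delta> x) \<le> 0" using le by simp
  then have z: "(LINT x|lborel. \<Delta> x) = 0"
    using Bochner_Integration.integral_nonneg[of lborel \<Delta>] pos by (simp add: order_antisym)
  have vc: "continuous_on UNIV v" "continuous_on UNIV ?w" using competitor_continuous v w by auto
  have "continuous_on UNIV \<Delta>"
    unfolding \<Delta>_def
    by (intro continuous_intros vc continuous_reflect continuous_on_compose2[OF vc(1) continuous_reflect] continuous_on_compose2[OF vc(2) continuous_reflect]) auto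
  from continuous_nonneg_integral_eq_0[OF int pos z open_UNIV UNIV_I this]
  have "\<Delta> x = 0" .
  moreover have "(norm (?\<sigma> x))\<^sup>2 - (norm x)\<^sup>2 > 0" using x(2) by (simp add: power_strict_mono)
  ultimately have "max (v x) (v (?\<sigma> x)) = v x" using half[OF x(1)] x(2) by simp
  then show ?thesis by (simp add: max_def split: if_splits)
qed

text \<open>Energies pass to the limit by Fatou, applied to the inner and the outer integral; the
  weighted integral and the second moment by dominated convergence, as \<open>M\<close> and
  \<open>R\<close> bound all competitors alike.\<close>

lemma competitor_limit:
  assumes v: "\<And>j. competitor (v j)" and lim: "\<And>x. (\<lambda>j. v j x) \<longlonglongrightarrow> w x"
  shows "competitor w" "(\<lambda>j. second_moment (v j)) \<longlonglongrightarrow> second_moment w"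
proof -
  note D = competitorD[OF v]
  have [measurable]: "v j \<in> borel_measurable borel" for j by (rule competitor_measurable[OF v])
  have [measurable]: "w \<in> borel_measurable borel" by (rule borel_measurable_LIMSEQ_real[OF lim]) simp
  have 1: "0 \<le> w x" for x by (rule LIMSEQ_le_const[OF lim]) (use D(1) in auto)
  have 2: "w x \<le> M" for x by (rule LIMSEQ_le_const2[OF lim]) (use D(2) in auto)
  have 3: "\<bar>w x - w y\<bar> \<le> L * dist x y" for x y
  proof (rule LIMSEQ_le_const2)
    show "(\<lambda>j. \<bar>v j x - v j y\<bar>) \<longlonglongrightarrow> \<bar>w x - w y\<bar>" by (intro tendsto_intros lim)
  qed (use D(3) in auto)
  have 4: "w x = 0" if "norm x > R" for x
    using LIMSEQ_unique[OF lim[of x]] D(4)[OF that] by simp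
  have M0: "M \<ge> 0" using 1[of 0] 2[of 0] by simp
  have 5: "nonlocal_energy h w \<le> nonlocal_energy h u" for h
  proof -
    let ?q = "\<lambda>v x y. ennreal (of_bool (dist x y < h) * (v x - v y)\<^sup>2)"
    have "?q w x y = liminf (\<lambda>j. ?q (v j) x y)" for x y
      by (rule lim_imp_Liminf[symmetric]) (auto intro!: tendsto_intros lim)
    then have "nonlocal_energy h w = (\<integral>\<^sup>+x. (\<integral>\<^sup>+y. liminf (\<lambda>j. ?q (v j) x y) \<partial>lborel) \<partial>lborel)"
      by (simp add: nonlocal_energy_def)
    also have "\<dots> \<le> (\<integral>\<^sup>+x. liminf (\<lambda>j. \<integral>\<^sup>+y. ?q (v j) x y \<partial>lborel) \<partial>lborel)"
      by (intro nn_integral_mono nn_integral_liminf) measurable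
    also have "\<dots> \<le> liminf (\<lambda>j. \<integral>\<^sup>+x. (\<integral>\<^sup>+y. ?q (v j) x y \<partial>lborel) \<partial>lborel)"
      by (intro nn_integral_liminf) measurable
    also have "\<dots> = liminf (\<lambda>j. nonlocal_energy h (v j))" by (simp add: nonlocal_energy_def)
    also have "\<dots> \<le> liminf (\<lambda>j. nonlocal_energy h u)"
      by (intro Liminf_mono always_eventually allI D(5))
    also have "\<dots> = nonlocal_energy h u" by (simp add: Liminf_const)
    finally show ?thesis .
  qed
  have hs: "(\<lambda>j. hs_integral p (v j)) \<longlonglongrightarrow> hs_integral p w"
    unfolding hs_integral_def
  proof (rule norm_powr_dominated_convergence(3)[where \<beta> = "- hs_exponent TYPE('n) p" and R = R and C =
      "M powr p"])
    show "0 \<le> - hs_exponent TYPE('n) p" "- hs_exponent TYPE('n) p < CARD('n)"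
      using hs_exponent_bounds[OF n3 p] by auto
    show "\<bar>norm x powr hs_exponent TYPE('n) p * \<bar>v j x\<bar> powr p\<bar>
        \<le> M powr p * norm x powr (- (- hs_exponent TYPE('n) p))" for j x
      using D(1,2) p by (auto simp: abs_mult mult.commute intro!: mult_right_mono powr_mono2)
    show "norm x powr hs_exponent TYPE('n) p * \<bar>v j x\<bar> powr p = 0" if "norm x > R" for j x
      using D(4)[OF that] by simp
    show "(\<lambda>j. norm x powr hs_exponent TYPE('n) p * \<bar>v j x\<bar> powr p)
        \<longlonglongrightarrow> norm x powr hs_exponent TYPE('n) p * \<bar>w x\<bar> powr p" for x
      by (intro tendsto_intros tendsto_powr' lim) (use p in auto)
  qed measurable
  have 6: "hs_integral p u \<le> hs_integral p w"
    by (rule LIMSEQ_le_const[OF hs]) (use D(6) in auto)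
  show "competitor w" using 1 2 3 4 5 6 by (auto simp: competitor_def)
  show "(\<lambda>j. second_moment (v j)) \<longlonglongrightarrow> second_moment w"
    unfolding second_moment_def
  proof (rule norm_powr_dominated_convergence(3)[where \<beta> = 0 and R = R and C = "R\<^sup>2 * M"])
    show "\<bar>(norm x)\<^sup>2 * v j x\<bar> \<le> R\<^sup>2 * M * norm x powr (- 0)" if "x \<noteq> 0" "norm x \<le> R" for j x
      using D(1,2)[of j x] that by (auto simp: abs_mult intro!: mult_mono power_mono)
    show "(norm x)\<^sup>2 * v j x = 0" if "norm x > R" for j x
      using D(4)[OF that] by simp
    show "(\<lambda>j. (norm x)\<^sup>2 * v j x) \<longlonglongrightarrow> (norm x)\<^sup>2 * w x" for x
      by (intro tendsto_intros lim)
  qed auto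
qed

lemma competitor_subsequence:
  assumes v: "\<And>j. competitor (v j)"
  obtains w r where "strict_mono (r :: nat \<Rightarrow> nat)" "\<And>x. (\<lambda>j. v (r j) x) \<longlonglongrightarrow> w x"
proof -
  note D = competitorD[OF v]
  have b: "norm (v n x) \<le> M" if "x \<in> cball 0 R" for n x
    using D(1,2) by simp
  have eqc: "\<exists>d>0. \<forall>n y. y \<in> cball 0 R \<and> norm (x - y) < d \<longrightarrow> norm (v n x - v n y) < e"
    if "x \<in> cball 0 R" "0 < e" for x e
  \<comment> \<open>\<open>L + 1\<close> instead of \<open>L\<close> covers the case
    \<open>L = 0\<close>.\<close>
  proof (intro exI[of _ "e / (L + 1)"] conjI allI impI)
    show "e / (L + 1) > 0" using \<open>0 < e\<close> L by simp
    fix n y assume "y \<in> cball 0 R \<and> norm (x - y) < e / (L + 1)"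
    then have "dist x y < e / (L + 1)" by (simp add: dist_norm)
    then have "(L + 1) * dist x y < e" using L by (simp add: field_simps)
    moreover have "L * dist x y \<le> (L + 1) * dist x y" by (intro mult_right_mono) auto
    ultimately show "norm (v n x - v n y) < e" using D(3)[of n x y] by simp
  qed
  obtain g r where gr: "strict_mono (r :: nat \<Rightarrow> nat)"
    "\<And>e. 0 < e \<Longrightarrow> \<exists>N. \<forall>n x. n \<ge> N \<and> x \<in> cball 0 R \<longrightarrow> norm (v (r n) x - g x) < e"
    by (rule Arzela_Ascoli[OF compact_cball b eqc]) blast+
  show ?thesis
  proof (rule that[OF gr(1)])
    fix x
    show "(\<lambda>j. v (r j) x) \<longlonglongrightarrow> (if norm x \<le> R then g x else 0)"
    proof (cases "norm x \<le> R")
      case True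
      have "(\<lambda>j. v (r j) x) \<longlonglongrightarrow> g x"
        using gr(2) True by (simp add: LIMSEQ_iff) blast
      then show ?thesis using True by simp
    next
      case False
      then show ?thesis using D(4) by simp
    qed
  qed
qed

lemma ex_radial_competitor:
  assumes "competitor u"
  obtains w where "competitor w" "radial w"
proof -
  have nn: "second_moment v \<ge> 0" if "competitor v" for v
    unfolding second_moment_def using competitorD(1)[OF that]
        by (intro Bochner_Integration.integral_nonneg) auto
  define I where "I = Inf (second_moment ` Collect competitor)"
  have bb: "bdd_below (second_moment ` Collect competitor)" using nn by (intro bdd_belowI[of _ 0]) auto
  have ne: "second_moment ` Collect competitor \<noteq> {}" using assms by auto
  have "\<exists>v. competitor v \<and> second_moment v < I + inverse (real (Suc j))" for j
  proof -
    have "I < I + inverse (real (Suc j))" by simp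
    then show ?thesis unfolding I_def using cInf_lessD[OF ne] by blast
  qed
  then obtain v where v: "\<And>j. competitor (v j)" "\<And>j. second_moment (v j) < I + inverse (real (Suc j))"
    by metis
  obtain w r where wr: "strict_mono (r :: nat \<Rightarrow> nat)" "\<And>x. (\<lambda>j. v (r j) x) \<longlonglongrightarrow> w x"
    by (rule competitor_subsequence[of v, OF v(1)]) blast
  note lim = competitor_limit[OF v(1) wr(2)]
  have "second_moment w \<le> I"
  proof (rule LIMSEQ_le[OF lim(2)])
    have "(\<lambda>j. I + inverse (real (Suc j))) \<longlonglongrightarrow> I + 0"
      by (intro tendsto_intros LIMSEQ_inverse_real_of_nat)
    then have "(\<lambda>j. I + inverse (real (Suc j))) \<longlonglongrightarrow> I" by simp
    from LIMSEQ_subseq_LIMSEQ[OF this wr(1)] show "(\<lambda>j. I + inverse (real (Suc (r j)))) \<longlonglongrightarrow> I"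
      by (simp add: o_def)
    show "\<exists>N. \<forall>n\<ge>N. second_moment (v (r n)) \<le> I + inverse (real (Suc (r n)))"
      using v(2) less_imp_le by blast
  qed
  then have min: "second_moment w \<le> second_moment v'" if "competitor v'" for v'
    using cInf_lower[OF _ bb, folded I_def] that by force
  have dec: "w y \<le> w x" if "norm x < norm y" for x y
  proof -
    \<comment> \<open>The hyperplane is the perpendicular bisector of x and y. The reflection
      exchanges them, and \<open>c \<ge> 0\<close> because x is nearer to the origin.\<close>
    define d c where "d = y - x" and "c = ((norm y)\<^sup>2 - (norm x)\<^sup>2) / 2"
    have d: "d \<noteq> 0" using that by (auto simp: d_def)
    have "(norm x)\<^sup>2 < (norm y)\<^sup>2" using that by (simp add: power_strict_mono)
    then have c: "c \<ge> 0" using that by (simp add: c_def)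
    have xd: "x \<bullet> d - c = - (d \<bullet> d) / 2"
      by (simp add: d_def c_def power2_norm_eq_inner inner_diff_left inner_diff_right inner_commute field_simps)
    have ry: "reflect d c x = y" unfolding reflect_def xd using d by (simp add: d_def)
    have "x \<bullet> d \<le> c" using xd inner_ge_zero[of d] by linarith
    from second_moment_polarization_eq[OF lim(1) d c min[OF competitor_polarization[OF lim(1) d c]] this]
    show ?thesis using that by (simp add: ry)
  qed
  \<comment> \<open>Points of equal norm are not strictly comparable, so y is approached by
    multiples of larger norm and continuity of \<open>w\<close> is used.\<close>
  have le: "w y \<le> w x" if "norm x = norm y" for x y
  proof (cases "y = 0")
    case True
    then show ?thesis using that by simp
  next
    case False
    have "(\<lambda>j. (1 + inverse (real (Suc j))) *\<^sub>R y) \<longlonglongrightarrow> (1 + 0) *\<^sub>R y"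
      by (intro tendsto_intros LIMSEQ_inverse_real_of_nat)
    then have "(\<lambda>j. (1 + inverse (real (Suc j))) *\<^sub>R y) \<longlonglongrightarrow> y" by simp
    moreover have "isCont w y"
      using competitor_continuous[OF lim(1)] by (simp add: continuous_on_eq_continuous_at)
    ultimately have "(\<lambda>j. w ((1 + inverse (real (Suc j))) *\<^sub>R y)) \<longlonglongrightarrow> w y"
      by (rule isCont_tendsto_compose[rotated])
    moreover have "w ((1 + inverse (real (Suc j))) *\<^sub>R y) \<le> w x" for j
      by (rule dec) (use that False in \<open>simp add: field_simps\<close>)
    ultimately show ?thesis by (meson LIMSEQ_le_const2)
  qed
  have "radial w" unfolding radial_def using le by (metis order_antisym)
  with lim(1) show ?thesis by (rule that)
qed

end

section \<open>From difference quotients to the Dirichlet integral\<close>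

lemma C1_lipschitz:
  fixes f :: "real^'n::finite \<Rightarrow> real"
  assumes "C1_on UNIV f" "\<And>x. norm x > R \<Longrightarrow> f x = 0"
  obtains L where "L \<ge> 0" "\<And>x y. \<bar>f x - f y\<bar> \<le> L * dist x y"
proof -
  have "grad f x = 0" if "norm x > R" for x
    using grad_eq_0_outside_cball[OF assms(2) that] .
  from bounded_continuous_compact_support[OF C1_on_imp_continuous_on_grad[OF assms(1)] this]
  obtain L where L: "L > 0" "\<And>x. norm (grad f x) \<le> L" by blast
  have "norm (f x - f y) \<le> L * norm (x - y)" for x y
  proof (rule differentiable_bound[of UNIV f "\<lambda>x h. grad f x \<bullet> h"])
    show "(f has_derivative (\<lambda>h. grad f x \<bullet> h)) (at x within UNIV)" for x
      using C1_on_has_derivative_grad[OF assms(1)] by simp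
    show "onorm (\<lambda>h. grad f x \<bullet> h) \<le> L" for x
    proof (rule onorm_bound)
      show "norm (grad f x \<bullet> h) \<le> L * norm h" for h
        using Cauchy_Schwarz_ineq2[of "grad f x" h] mult_right_mono[OF L(2)[of x], of "norm h"] by simp
    qed (use L in simp)
  qed auto
  then have "\<bar>f x - f y\<bar> \<le> L * dist x y" for x y by (simp add: dist_norm)
  then show ?thesis by (rule that[OF less_imp_le[OF L(1)]])
qed

lemma nn_integral_lborel_affine:
  fixes f :: "'a::euclidean_space \<Rightarrow> ennreal"
  assumes [measurable]: "f \<in> borel_measurable borel" and h: "h > 0"
  shows "(\<integral>\<^sup>+y. f y \<partial>lborel) = ennreal (h ^ DIM('a)) * (\<integral>\<^sup>+z. f (x + h *\<^sub>R z) \<partial>lborel)"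
proof -
  have "(\<integral>\<^sup>+y. f y \<partial>lborel) = (\<integral>\<^sup>+y. f y \<partial>density (distr lborel borel (\<lambda>z. x + h *\<^sub>R z)) (\<lambda>_. \<bar>h\<bar>^DIM('a)))"
    using lborel_affine[of h x] h by simp
  also have "\<dots> = (\<integral>\<^sup>+y. ennreal (h ^ DIM('a)) * f y \<partial>distr lborel borel (\<lambda>z. x + h *\<^sub>R z))"
    using h by (subst nn_integral_density) auto
  also have "\<dots> = (\<integral>\<^sup>+z. ennreal (h ^ DIM('a)) * f (x + h *\<^sub>R z) \<partial>lborel)"
    by (subst nn_integral_distr) auto
  also have "\<dots> = ennreal (h ^ DIM('a)) * (\<integral>\<^sup>+z. f (x + h *\<^sub>R z) \<partial>lborel)"
    by (intro nn_integral_cmult) auto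
  finally show ?thesis .
qed

text \<open>The nonlocal energy in the variable \<open>z = (y - x) / h\<close>, divided by
  \<open>h ^ (n + 2)\<close>, so that it has a limit as h tends to 0.\<close>

definition difference_energy :: "real \<Rightarrow> (real^'n::finite \<Rightarrow> real) \<Rightarrow> ennreal"
  where "difference_energy h v =
    (\<integral>\<^sup>+x. (\<integral>\<^sup>+z. ennreal (indicator (ball 0 1) z * ((v (x + h *\<^sub>R z) - v x) / h)\<^sup>2) \<partial>lborel) \<partial>lborel)"

lemma nonlocal_energy_eq:
  fixes v :: "real^'n::finite \<Rightarrow> real"
  assumes [measurable]: "v \<in> borel_measurable borel" and h: "h > 0"
  shows "nonlocal_energy h v = ennreal (h ^ (CARD('n) + 2)) * difference_energy h v"
proof -
  have [measurable]: "ball 0 1 \<in> sets (borel :: (real^'n) measure)" by simp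
  have m1: "(\<lambda>y. ennreal (of_bool (dist x y < h) * (v x - v y)\<^sup>2)) \<in> borel_measurable borel" for x
      by measurable
  have m2 [measurable]: "(\<lambda>(x, z). ennreal (indicator (ball 0 1) z * ((v (x
      + h *\<^sub>R z) - v x) / h)\<^sup>2)) \<in> borel_measurable (borel \<Otimes>\<^sub>M borel)"
    by measurable
  have eq: "ennreal (of_bool (dist x (x + h *\<^sub>R z) < h) * (v x - v (x + h *\<^sub>R z))\<^sup>2)
     = ennreal (h\<^sup>2) * ennreal (indicator (ball 0 1) z * ((v (x
         + h *\<^sub>R z) - v x) / h)\<^sup>2)" for x z :: "real^'n"
  proof -
    have "dist x (x + h *\<^sub>R z) < h \<longleftrightarrow> norm z < 1"
      using h by (simp add: dist_norm)
    then show ?thesis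
      using h by (simp add: ennreal_mult[symmetric] indicator_def power_divide power2_commute)
  qed
  have "(\<integral>\<^sup>+y. ennreal (of_bool (dist x y < h) * (v x - v y)\<^sup>2) \<partial>lborel) =
      ennreal (h ^ (CARD('n) + 2)) * (\<integral>\<^sup>+z. ennreal (indicator (ball 0 1) z * ((v (x
          + h *\<^sub>R z) - v x) / h)\<^sup>2) \<partial>lborel)" for x
  proof -
    have "(\<integral>\<^sup>+y. ennreal (of_bool (dist x y < h) * (v x - v y)\<^sup>2) \<partial>lborel) = ennreal (h ^ CARD('n)) *
       (\<integral>\<^sup>+z. ennreal (h\<^sup>2) * ennreal (indicator (ball 0 1) z * ((v (x + h *\<^sub>R z) - v x) / h)\<^sup>2) \<partial>lborel)"
      using nn_integral_lborel_affine[OF m1[of x] h, of x] by (simp add: eq)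
    also have "\<dots> = ennreal (h ^ CARD('n)) * (ennreal (h\<^sup>2) * (\<integral>\<^sup>+z. ennreal (indicator (ball 0 1) z * ((v (x
        + h *\<^sub>R z) - v x) / h)\<^sup>2) \<partial>lborel))"
      by (subst nn_integral_cmult) auto
    also have "\<dots> = ennreal (h ^ (CARD('n) + 2)) * (\<integral>\<^sup>+z. ennreal (indicator (ball 0 1) z * ((v (x
        + h *\<^sub>R z) - v x) / h)\<^sup>2) \<partial>lborel)"
    proof -
      have "ennreal (h ^ (CARD('n) + 2)) = ennreal (h ^ CARD('n)) * ennreal (h\<^sup>2)"
        using h by (subst ennreal_mult[symmetric]) (auto simp: power_add power2_eq_square)
      then show ?thesis by (simp only: mult.assoc)
    qed
    finally show ?thesis .
  qed
  then show ?thesis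
    unfolding nonlocal_energy_def difference_energy_def by (simp add: nn_integral_cmult)
qed

lemma difference_energy_tendsto:
  fixes v :: "real^'n::finite \<Rightarrow> real"
  assumes v: "C1_on UNIV v" "\<And>x. norm x > R \<Longrightarrow> v x = 0"
  shows "(\<lambda>j. difference_energy (inverse (real (Suc j))) v) \<longlonglongrightarrow>
    (\<integral>\<^sup>+x. (\<integral>\<^sup>+z. ennreal (indicator (ball 0 1) z * (grad v x \<bullet> z)\<^sup>2) \<partial>lborel) \<partial>lborel)"
proof -
  have [measurable]: "ball 0 1 \<in> sets (borel :: (real^'n) measure)" by simp
  have [measurable]: "cball 0 r \<in> sets (borel :: (real^'n) measure)" for r by simp
  note [measurable] = C1_measurable[OF v(1)]
  obtain L where L: "L \<ge> 0" "\<And>x y. \<bar>v x - v y\<bar> \<le> L * dist x y"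
    using C1_lipschitz[OF v] by blast
  define h where "h j = inverse (real (Suc j))" for j
  have h: "h j > 0" "h j \<le> 1" for j by (auto simp: h_def field_simps)
  have hlim: "h \<longlonglongrightarrow> 0" unfolding h_def by (rule LIMSEQ_inverse_real_of_nat)
  let ?q = "\<lambda>j x z. indicator (ball 0 1) z * ((v (x + h j *\<^sub>R z) - v x) / h j)\<^sup>2"
  let ?g = "\<lambda>x z. indicator (ball 0 1) z * (grad v x \<bullet> z)\<^sup>2"
  \<comment> \<open>The Lipschitz constant dominates the difference quotients; displacements have
    length at most 1, which enlarges the support radius to \<open>R + 1\<close>.\<close>
  let ?W = "\<lambda>(x::real^'n) (z::real^'n). indicator (cball 0 (R + 1)) x * (L\<^sup>2 * indicator (ball 0 1) z)"
  have bound: "?q j x z \<le> ?W x z" for j x z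
  proof (cases "norm z < 1")
    case True
    have hz: "norm (h j *\<^sub>R z) \<le> 1" using True h[of j] by (simp add: mult_le_one)
    show ?thesis
    proof (cases "norm x \<le> R + 1")
      case x: True
      have "\<bar>v (x + h j *\<^sub>R z) - v x\<bar> \<le> L * (h j * norm z)"
        using L(2)[of "x + h j *\<^sub>R z" x] h[of j] by (simp add: dist_norm)
      also have "\<dots> \<le> L * (h j * 1)" using True L(1) h[of j] by (intro mult_left_mono) auto
      finally have "\<bar>(v (x + h j *\<^sub>R z) - v x) / h j\<bar> \<le> L" using h[of j] by (simp add: divide_le_eq)
      then have "((v (x + h j *\<^sub>R z) - v x) / h j)\<^sup>2 \<le> L\<^sup>2" using L(1)
          by (intro abs_le_square_iff[THEN iffD1]) simp
      then show ?thesis using True x by simp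
    next
      case x: False
      have "norm x \<le> norm (x + h j *\<^sub>R z) + norm (h j *\<^sub>R z)"
        by (metis add_diff_cancel_right' norm_triangle_ineq4)
      then have "norm (x + h j *\<^sub>R z) > R" using hz x by linarith
      then show ?thesis using x v(2)[of x] v(2)[of "x + h j *\<^sub>R z"] by simp
    qed
  qed simp
  have lim: "(\<lambda>j. ?q j x z) \<longlonglongrightarrow> ?g x z" for x z
  proof -
    have "((\<lambda>t. x + t *\<^sub>R z) has_derivative (\<lambda>t. t *\<^sub>R z)) (at 0)"
      by (auto intro!: derivative_eq_intros)
    from has_derivative_compose[OF this, of v "\<lambda>k. grad v x \<bullet> k"] C1_on_has_derivative_grad[OF v(1) UNIV_I,
        of x]
    have "((\<lambda>t. v (x + t *\<^sub>R z)) has_derivative (\<lambda>t. grad v x \<bullet> (t *\<^sub>R z))) (at 0)"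
      by simp
    then have "((\<lambda>t. v (x + t *\<^sub>R z)) has_real_derivative (grad v x \<bullet> z)) (at 0)"
      unfolding has_field_derivative_def by (rule has_derivative_eq_rhs) (auto simp: mult.commute)
    then have "((\<lambda>t. (v (x + t *\<^sub>R z) - v x) / t) \<longlongrightarrow> grad v x \<bullet> z) (at 0)"
      by (simp add: DERIV_def)
    moreover have "filterlim h (at 0) sequentially"
      using hlim h by (auto simp: filterlim_at less_imp_neq[symmetric])
    ultimately have "(\<lambda>j. (v (x + h j *\<^sub>R z) - v x) / h j) \<longlonglongrightarrow> grad v x \<bullet> z"
      by (rule filterlim_compose)
    then show ?thesis by (intro tendsto_intros)
  qed
  have vol: "emeasure lborel (ball 0 1 :: (real^'n) set) < top"
      "emeasure lborel (cball 0 (R + 1) :: (real^'n) set) < top"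
    by (auto intro: emeasure_lborel_ball_finite[unfolded infinity_ennreal_def] emeasure_lborel_cball_finite[unfolded infinity_ennreal_def])
  have W: "(\<integral>\<^sup>+z. ennreal (?W x z) \<partial>lborel)
      = ennreal (L\<^sup>2) * emeasure lborel (ball 0 1 :: (real^'n) set) * indicator (cball 0 (R
      + 1)) x" for x :: "real^'n"
  proof -
    have "ennreal (?W x z) = (ennreal (L\<^sup>2) * indicator (cball 0 (R + 1)) x) * indicator (ball 0 1) z" for z
      by (auto simp: indicator_def)
    then have "(\<integral>\<^sup>+z. ennreal (?W x z) \<partial>lborel) =
        (\<integral>\<^sup>+z. (ennreal (L\<^sup>2) * indicator (cball 0 (R + 1)) x) * indicator (ball 0 1) (z::real^'n) \<partial>lborel)"
      by (simp only:)
    also have "\<dots> = (ennreal (L\<^sup>2) * indicator (cball 0 (R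
        + 1)) x) * emeasure lborel (ball 0 1 :: (real^'n) set)"
      by (rule nn_integral_cmult_indicator) simp
    finally show ?thesis by (simp only: mult_ac)
  qed
  have inner: "(\<lambda>j. \<integral>\<^sup>+z. ennreal (?q j x z) \<partial>lborel) \<longlonglongrightarrow> (\<integral>\<^sup>+z. ennreal (?g x z) \<partial>lborel)" for x
  proof (rule nn_integral_dominated_convergence[where w = "\<lambda>z. ennreal (?W x z)"])
    show "AE z in lborel. ennreal (?q j x z) \<le> ennreal (?W x z)" for j
      by (intro AE_I2 ennreal_leI bound)
    show "(\<integral>\<^sup>+z. ennreal (?W x z) \<partial>lborel) < \<infinity>"
      unfolding W using vol by (auto simp: ennreal_mult_less_top indicator_def)
    show "AE z in lborel. (\<lambda>j. ennreal (?q j x z)) \<longlonglongrightarrow> ennreal (?g x z)"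
      by (intro AE_I2 tendsto_ennrealI lim)
  qed auto
  have "(\<lambda>j. \<integral>\<^sup>+x. (\<integral>\<^sup>+z. ennreal (?q j x z) \<partial>lborel) \<partial>lborel)
      \<longlonglongrightarrow> (\<integral>\<^sup>+x. (\<integral>\<^sup>+z. ennreal (?g x z) \<partial>lborel) \<partial>lborel)"
  proof (rule nn_integral_dominated_convergence[where w = "\<lambda>x. \<integral>\<^sup>+z. ennreal (?W x z) \<partial>lborel"])
    show "AE x in lborel. (\<integral>\<^sup>+z. ennreal (?q j x z) \<partial>lborel) \<le> (\<integral>\<^sup>+z. ennreal (?W x z) \<partial>lborel)" for j
      by (intro AE_I2 nn_integral_mono ennreal_leI bound)
    show "(\<integral>\<^sup>+x. (\<integral>\<^sup>+z. ennreal (?W x z) \<partial>lborel) \<partial>lborel) < \<infinity>"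
      unfolding W using vol by (subst nn_integral_cmult_indicator) (auto simp: ennreal_mult_less_top)
    show "AE x in lborel. (\<lambda>j. \<integral>\<^sup>+z. ennreal (?q j x z) \<partial>lborel) \<longlonglongrightarrow> (\<integral>\<^sup>+z. ennreal (?g x z) \<partial>lborel)"
      by (intro AE_I2 inner)
  qed (unfold W, measurable)
  then show ?thesis by (simp add: difference_energy_def h_def)
qed

text \<open>Rotating a coordinate axis onto the direction of g reduces the quadratic form to one
  coordinate; the remaining integral does not depend on g.\<close>

lemma sphere_average:
  fixes g :: "real^'n::finite"
  shows "(\<integral>\<^sup>+z. ennreal (indicator (ball 0 1) z * (g \<bullet> z)\<^sup>2) \<partial>lborel) =
    ennreal ((norm g)\<^sup>2) * (\<integral>\<^sup>+z. ennreal (indicator (ball 0 1) (z::real^'n) * (z $ k)\<^sup>2) \<partial>lborel)"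
proof -
  have [measurable]: "ball 0 1 \<in> sets (borel :: (real^'n) measure)" by simp
  obtain f where f: "orthogonal_transformation f" "f (axis k (norm g)) = g"
    using orthogonal_transformation_exists[of "axis k (norm g)" g] by (auto simp: norm_axis)
  have [measurable]: "f \<in> borel_measurable borel"
    by (intro linear_borel_measurable orthogonal_transformation_linear f)
  have "(\<integral>\<^sup>+z. ennreal (indicator (ball 0 1) z * (g \<bullet> z)\<^sup>2) \<partial>lborel)
      = (\<integral>\<^sup>+z. ennreal (indicator (ball 0 1) z * (g \<bullet> z)\<^sup>2) \<partial>distr lborel borel f)"
    by (simp add: lborel_distr_orthogonal[OF f(1)])
  also have "\<dots> = (\<integral>\<^sup>+z. ennreal (indicator (ball 0 1) (f z) * (g \<bullet> f z)\<^sup>2) \<partial>lborel)"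
    by (subst nn_integral_distr) auto
  also have "\<dots> = (\<integral>\<^sup>+z. ennreal ((norm g)\<^sup>2) * ennreal (indicator (ball 0 1) z * (z $ k)\<^sup>2) \<partial>lborel)"
  proof (rule nn_integral_cong)
    fix z
    have "norm (f z) = norm z" using f(1) by (simp add: orthogonal_transformation_norm)
    moreover have "g \<bullet> f z = norm g * z $ k"
    proof -
      have "g \<bullet> f z = f (axis k (norm g)) \<bullet> f z" by (simp add: f(2))
      also have "\<dots> = axis k (norm g) \<bullet> z" using f(1) by (simp add: orthogonal_transformation_def)
      finally show ?thesis by (simp add: inner_axis')
    qed
    ultimately show "ennreal (indicator (ball 0 1) (f z) * (g \<bullet> f z)\<^sup>2)
        = ennreal ((norm g)\<^sup>2) * ennreal (indicator (ball 0 1) z * (z $ k)\<^sup>2)"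
      by (simp add: ennreal_mult[symmetric] indicator_def power_mult_distrib)
  qed
  finally show ?thesis by (simp add: nn_integral_cmult)
qed

text \<open>After division by \<open>h ^ (n + 2)\<close> both energies tend to the Dirichlet
  integrals times the same constant \<kappa>, the integral of one squared coordinate over the unit
  ball, which is positive and finite.\<close>

lemma dirichlet_mono_nonlocal:
  fixes u v :: "real^'n::finite \<Rightarrow> real"
  assumes u: "C1_on UNIV u" "\<And>x. norm x > R \<Longrightarrow> u x = 0"
    and v: "C1_on UNIV v" "\<And>x. norm x > R' \<Longrightarrow> v x = 0"
    and le: "\<And>h. h > 0 \<Longrightarrow> nonlocal_energy h v \<le> nonlocal_energy h u"
  shows "dirichlet v \<le> dirichlet u"
proof -
  have [measurable]: "ball 0 1 \<in> sets (borel :: (real^'n) measure)" by simp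
  obtain k :: 'n where True by auto
  define \<kappa> where "\<kappa> = (\<integral>\<^sup>+z. ennreal (indicator (ball 0 1) (z::real^'n) * (z $ k)\<^sup>2) \<partial>lborel)"
  have lim: "(\<integral>\<^sup>+x. (\<integral>\<^sup>+z. ennreal (indicator (ball 0 1) z * (grad w x \<bullet> z)\<^sup>2) \<partial>lborel) \<partial>lborel)
      = ennreal (dirichlet w) * \<kappa>"
    if w: "C1_on UNIV w" "\<And>x. norm x > R \<Longrightarrow> w x = 0" for w :: "real^'n \<Rightarrow> real" and R
  proof -
    note [measurable] = C1_measurable[OF w(1)]
    have gs: "grad w x = 0" if "norm x > R" for x
      using grad_eq_0_outside_cball[OF w(2) that] .
    have i: "integrable lborel (\<lambda>x. (norm (grad w x))\<^sup>2)"
      by (rule integrable_continuous_compact_support[of _ R])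
         (use gs in \<open>auto intro!: continuous_intros C1_on_imp_continuous_on_grad[OF w(1)]\<close>)
    have "(\<integral>\<^sup>+x. (\<integral>\<^sup>+z. ennreal (indicator (ball 0 1) z * (grad w x \<bullet> z)\<^sup>2) \<partial>lborel) \<partial>lborel)
        = (\<integral>\<^sup>+x. ennreal ((norm (grad w x))\<^sup>2) * \<kappa> \<partial>lborel)"
      unfolding sphere_average[of _ k] \<kappa>_def ..
    also have "\<dots> = (\<integral>\<^sup>+x. ennreal ((norm (grad w x))\<^sup>2) \<partial>lborel) * \<kappa>"
      by (rule nn_integral_multc) measurable
    also have "(\<integral>\<^sup>+x. ennreal ((norm (grad w x))\<^sup>2) \<partial>lborel) = ennreal (dirichlet w)"
      unfolding dirichlet_def by (rule nn_integral_eq_integral[OF i]) simp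
    finally show ?thesis .
  qed
  have i: "integrable lborel (\<lambda>z::real^'n. indicator (ball 0 1) z * (z $ k)\<^sup>2)"
  proof (rule Bochner_Integration.integrable_bound)
    show "integrable lborel (indicator (ball 0 1) :: real^'n \<Rightarrow> real)"
      by (rule integrable_real_indicator) (auto intro: emeasure_lborel_ball_finite[unfolded infinity_ennreal_def])
    have "(z $ k)\<^sup>2 \<le> 1" if "norm z < 1" for z :: "real^'n"
      using component_le_norm_cart[of z k] that by (simp add: abs_square_le_1)
    then show "AE z in lborel. norm (indicator (ball 0 1) z * (z $ k)\<^sup>2)
        \<le> norm (indicator (ball 0 1) (z::real^'n) :: real)"
      by (intro AE_I2) (auto simp: indicator_def)
    show "(\<lambda>z::real^'n. indicator (ball 0 1) z * (z $ k)\<^sup>2) \<in> borel_measurable lborel"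
      by measurable
  qed
  have \<kappa>i: "\<kappa> = ennreal (LINT z|lborel. indicator (ball 0 1) (z::real^'n) * (z $ k)\<^sup>2)"
    unfolding \<kappa>_def by (rule nn_integral_eq_integral[OF i]) simp
  have "(LINT z|lborel. indicator (ball 0 1) (z::real^'n) * (z $ k)\<^sup>2) \<noteq> 0"
  proof
    assume z: "(LINT z|lborel. indicator (ball 0 1) (z::real^'n) * (z $ k)\<^sup>2) = 0"
    have c: "continuous_on (ball 0 1) (\<lambda>z::real^'n. indicator (ball 0 1) z * (z $ k)\<^sup>2)"
      by (subst continuous_on_cong[OF HOL.refl, of _ _ "\<lambda>z. (z $ k)\<^sup>2"]) (auto intro!: continuous_intros)
    \<comment> \<open>A point of the ball at which the integrand is positive.\<close>
    have m: "axis k (1/2) \<in> ball (0::real^'n) 1" by (simp add: norm_axis)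
    from continuous_nonneg_integral_eq_0[OF i _ z open_ball m c] m show False by simp
  qed
  moreover have "(LINT z|lborel. indicator (ball 0 1) (z::real^'n) * (z $ k)\<^sup>2) \<ge> 0"
    by (intro Bochner_Integration.integral_nonneg) simp
  ultimately have "(LINT z|lborel. indicator (ball 0 1) (z::real^'n) * (z $ k)\<^sup>2) > 0"
    by linarith
  then have \<kappa>: "\<kappa> \<noteq> 0" "\<kappa> \<noteq> \<infinity>"
    unfolding \<kappa>i by (simp_all add: ennreal_eq_0_iff not_le)
  have "difference_energy h v \<le> difference_energy h u" if "h > 0" for h
  proof -
    have "ennreal (h ^ (CARD('n) + 2)) * difference_energy h v
        \<le> ennreal (h ^ (CARD('n) + 2)) * difference_energy h u"
      using le[OF that] nonlocal_energy_eq[OF C1_measurable(1)[OF u(1)] that] nonlocal_energy_eq[OF C1_measurable(1)[OF v(1)] that] by simp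
    then show ?thesis
      using that by (subst (asm) ennreal_mult_le_mult_iff) auto
  qed
  then have "ennreal (dirichlet v) * \<kappa> \<le> ennreal (dirichlet u) * \<kappa>"
    using LIMSEQ_le[OF difference_energy_tendsto[OF v] difference_energy_tendsto[OF u]] lim[OF u] lim[OF v]
        by simp
  then have "\<kappa> * ennreal (dirichlet v) \<le> \<kappa> * ennreal (dirichlet u)" by (simp add: mult.commute)
  then have "ennreal (dirichlet v) \<le> ennreal (dirichlet u)"
    using \<kappa> by (subst (asm) ennreal_mult_le_mult_iff) auto
  moreover have "dirichlet u \<ge> 0" unfolding dirichlet_def by simp
  ultimately show ?thesis by (simp add: ennreal_le_iff)
qed

text \<open>A mollification is an average of translates, the energy is translation invariant, and
  the square is convex.\<close>

lemma nonlocal_energy_convol: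
  fixes v :: "real^'n::finite \<Rightarrow> real"
  assumes e: "e > 0" and v: "continuous_on UNIV v"
  shows "nonlocal_energy h (convol v (mollifier e)) \<le> nonlocal_energy h v"
proof -
  let ?m = "mollifier e :: real^'n \<Rightarrow> real"
  note mc = mollifier(6)[OF e, where 'n='n] and m0 = mollifier(2)[OF e, where 'n='n]
  have ms: "?m z = 0" if "norm z > e" for z using mollifier(3)[OF e less_imp_le[OF that]] .
  have [measurable]: "v \<in> borel_measurable borel" "?m \<in> borel_measurable borel"
    using v mc by (auto intro: borel_measurable_continuous_onI)
  have mi: "integrable lborel ?m" by (rule mollifier_integrable[OF e])
  have vx: "continuous_on UNIV (\<lambda>z. v (x - z))" for x
    by (intro continuous_on_compose2[OF v] continuous_intros) auto
  have conv: "convol v ?m x = (LINT z|lborel. ?m z * v (x - z))" for x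
    using convol_commute[OF v mc] by (simp add: convol_def)
  have jensen: "(convol v ?m x - convol v ?m y)\<^sup>2 \<le> (LINT z|lborel. ?m z * (v (x - z) - v (y - z))\<^sup>2)"
    "integrable lborel (\<lambda>z. ?m z * (v (x - z) - v (y - z))\<^sup>2)" for x y
  proof -
    define g where "g z = v (x - z) - v (y - z)" for z
    have gc: "continuous_on UNIV g" unfolding g_def by (intro continuous_intros vx)
    have i1: "integrable lborel (\<lambda>z. ?m z * v (x - z))" for x
      by (rule integrable_continuous_compact_support[of _ e]) (use ms in \<open>auto intro!: continuous_intros vx mc\<close>)
    have ig: "integrable lborel (\<lambda>z. ?m z * g z)" "integrable lborel (\<lambda>z. ?m z * (g z)\<^sup>2)"
      by (rule integrable_continuous_compact_support[of _ e]; use ms in \<open>auto intro!: continuous_intros gc mc\<close>)+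
    define c where "c = (LINT z|lborel. ?m z * g z)"
    have c: "convol v ?m x - convol v ?m y = c"
      unfolding conv c_def g_def using i1 by (simp add: right_diff_distrib)
    \<comment> \<open>Jensen's inequality for the square, in the form that a variance is
      nonnegative.\<close>
    have "0 \<le> (LINT z|lborel. ?m z * (g z - c)\<^sup>2)"
      by (intro Bochner_Integration.integral_nonneg mult_nonneg_nonneg m0) simp
    also have "(\<lambda>z. ?m z * (g z - c)\<^sup>2) = (\<lambda>z. ?m z * (g z)\<^sup>2 - 2 * c * (?m z * g z) + c\<^sup>2 * ?m z)"
      by (simp add: fun_eq_iff power2_eq_square algebra_simps)
    also have "(LINT z|lborel. ?m z * (g z)\<^sup>2 - 2 * c * (?m z * g z) + c\<^sup>2 * ?m z) =
       (LINT z|lborel. ?m z * (g z)\<^sup>2) - 2 * c * c + c\<^sup>2"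
      using ig mi mollifier(5)[OF e, where 'n='n] by (simp add: c_def)
    finally have "c\<^sup>2 \<le> (LINT z|lborel. ?m z * (g z)\<^sup>2)" by (simp add: power2_eq_square)
    then show "(convol v ?m x - convol v ?m y)\<^sup>2 \<le> (LINT z|lborel. ?m z * (v (x - z) - v (y - z))\<^sup>2)"
      unfolding c g_def .
    show "integrable lborel (\<lambda>z. ?m z * (v (x - z) - v (y - z))\<^sup>2)" using ig(2) by (simp add: g_def)
  qed
  define Q where "Q x y = ennreal (of_bool (dist x y < h) * (v x - v y)\<^sup>2)" for x y
  have [measurable]: "(\<lambda>(x, y). Q x y) \<in> borel_measurable (borel \<Otimes>\<^sub>M borel)"
    unfolding Q_def by measurable
  have le: "ennreal (of_bool (dist x y < h) * (convol v ?m x - convol v ?m y)\<^sup>2)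
      \<le> (\<integral>\<^sup>+z. ennreal (?m z) * Q (x - z) (y - z) \<partial>lborel)" for x y
  proof (cases "dist x y < h")
    case True
    have "ennreal ((convol v ?m x - convol v ?m y)\<^sup>2)
        \<le> ennreal (LINT z|lborel. ?m z * (v (x - z) - v (y - z))\<^sup>2)"
      by (rule ennreal_leI[OF jensen(1)])
    also have "\<dots> = (\<integral>\<^sup>+z. ennreal (?m z * (v (x - z) - v (y - z))\<^sup>2) \<partial>lborel)"
      by (intro nn_integral_eq_integral[symmetric] jensen(2) AE_I2 mult_nonneg_nonneg m0) simp
    also have "\<dots> = (\<integral>\<^sup>+z. ennreal (?m z) * Q (x - z) (y - z) \<partial>lborel)"
      using True m0 by (simp add: Q_def ennreal_mult dist_norm)
    finally show ?thesis using True by simp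
  qed simp
  have "nonlocal_energy h (convol v ?m)
      \<le> (\<integral>\<^sup>+x. (\<integral>\<^sup>+y. (\<integral>\<^sup>+z. ennreal (?m z) * Q (x - z) (y - z) \<partial>lborel) \<partial>lborel) \<partial>lborel)"
    unfolding nonlocal_energy_def by (intro nn_integral_mono le)
  \<comment> \<open>Tonelli moves the mollifier variable z to the outside; for fixed z both inner
    variables are then translated by it.\<close>
  also have "\<dots> = (\<integral>\<^sup>+x. (\<integral>\<^sup>+z. (\<integral>\<^sup>+y. ennreal (?m z) * Q (x - z) (y - z) \<partial>lborel) \<partial>lborel) \<partial>lborel)"
    by (intro nn_integral_cong lborel_pair.Fubini') measurable
  also have "\<dots> = (\<integral>\<^sup>+z. (\<integral>\<^sup>+x. (\<integral>\<^sup>+y. ennreal (?m z) * Q (x - z) (y - z) \<partial>lborel) \<partial>lborel) \<partial>lborel)"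
    by (intro lborel_pair.Fubini') measurable
  also have "\<dots> = (\<integral>\<^sup>+z. ennreal (?m z) * nonlocal_energy h v \<partial>lborel)"
  proof (rule nn_integral_cong)
    fix z
    have m1: "Q x \<in> borel_measurable borel" for x by measurable
    have m2: "(\<lambda>x. \<integral>\<^sup>+y. Q x y \<partial>lborel) \<in> borel_measurable borel" by measurable
    have "(\<integral>\<^sup>+x. (\<integral>\<^sup>+y. ennreal (?m z) * Q (x - z) (y - z) \<partial>lborel) \<partial>lborel)
        = ennreal (?m z) * (\<integral>\<^sup>+x. (\<integral>\<^sup>+y. Q (x - z) (y - z) \<partial>lborel) \<partial>lborel)"
      by (simp add: nn_integral_cmult)
    also have "(\<lambda>x. \<integral>\<^sup>+y. Q (x - z) (y - z) \<partial>lborel) = (\<lambda>x. \<integral>\<^sup>+y. Q (x - z) y \<partial>lborel)"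
      using nn_integral_lborel_translation[OF m1, of _ "- z"] by (simp add: fun_eq_iff)
    also have "(\<integral>\<^sup>+x. (\<integral>\<^sup>+y. Q (x - z) y \<partial>lborel) \<partial>lborel) = (\<integral>\<^sup>+x. (\<integral>\<^sup>+y. Q x y \<partial>lborel) \<partial>lborel)"
      using nn_integral_lborel_translation[OF m2, of "- z"] by simp
    finally show "(\<integral>\<^sup>+x. (\<integral>\<^sup>+y. ennreal (?m z) * Q (x - z) (y - z) \<partial>lborel) \<partial>lborel)
        = ennreal (?m z) * nonlocal_energy h v"
      by (simp add: nonlocal_energy_def Q_def)
  qed
  also have "\<dots> = (\<integral>\<^sup>+z. ennreal (?m z) \<partial>lborel) * nonlocal_energy h v"
    by (rule nn_integral_multc) measurable
  also have "(\<integral>\<^sup>+z. ennreal (?m z) \<partial>lborel) = 1"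
    using nn_integral_eq_integral[OF mi] m0 mollifier(5)[OF e, where 'n='n] by simp
  finally show ?thesis by simp
qed

section \<open>Radial functions\<close>

text \<open>If the part \<open>h\<close> of the gradient orthogonal to y were nonzero, the
  reflection with normal \<open>h\<close> would fix y and preserve v, forcing the gradient to be
  orthogonal to \<open>h\<close>.\<close>

lemma grad_radial:
  fixes v :: "real^'n::finite \<Rightarrow> real"
  assumes "radial v" "\<And>x. v differentiable (at x)"
  shows "\<exists>c. grad v y = c *\<^sub>R y"
proof -
  define g c where "g = grad v y" and "c = (g \<bullet> y) / (y \<bullet> y)"
  define h where "h = g - c *\<^sub>R y"
  have hy: "h \<bullet> y = 0" by (cases "y = 0") (simp_all add: h_def c_def inner_diff_left)
  have "h = 0"
  proof (rule ccontr)
    assume h: "h \<noteq> 0"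
    let ?\<sigma> = "reflect h 0"
    have \<sigma>y: "?\<sigma> y = y" using hy by (simp add: reflect_def inner_commute)
    have "norm (?\<sigma> x) = norm x" for x using norm_reflect[OF h, of 0 x] by simp
    then have inv: "v (?\<sigma> x) = v x" for x using assms(1) unfolding radial_def by blast
    have D: "(v has_derivative (\<lambda>k. g \<bullet> k)) (at y)"
      unfolding g_def by (rule has_derivative_grad[OF assms(2)])
    have "(?\<sigma> has_derivative (\<lambda>k. k - (2 * (k \<bullet> h) / (h \<bullet> h)) *\<^sub>R h)) (at y)"
      unfolding reflect_def[abs_def] using h by (auto intro!: derivative_eq_intros)
    from has_derivative_compose[OF this, of v "\<lambda>k. g \<bullet> k"] D
    have "(v has_derivative (\<lambda>k. g \<bullet> (k - (2 * (k \<bullet> h) / (h \<bullet> h)) *\<^sub>R h))) (at y)"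
      by (simp add: inv \<sigma>y)
    \<comment> \<open>In the direction \<open>h\<close> the two derivatives are
      \<open>- (g \<bullet> h)\<close> and \<open>g \<bullet> h\<close>.\<close>
    from fun_cong[OF has_derivative_unique[OF this D], of h]
    have "g \<bullet> h = 0" using h by (simp add: inner_diff_right)
    then have "h \<bullet> h = 0" using hy by (simp add: h_def inner_diff_left inner_diff_right inner_commute)
    with h show False by simp
  qed
  then show ?thesis by (auto simp: h_def g_def)
qed

text \<open>A linear reflection takes x to y. It preserves the measure, the mollifier and v.\<close>

lemma radial_convol_mollifier:
  fixes v :: "real^'n::finite \<Rightarrow> real"
  assumes e: "e > 0" and v: "continuous_on UNIV v" "radial v"
  shows "radial (convol v (mollifier e))"
  unfolding radial_def
proof (intro allI impI)
  fix x y :: "real^'n" assume n: "norm x = norm y"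
  let ?m = "mollifier e :: real^'n \<Rightarrow> real"
  note mc = mollifier(6)[OF e, where 'n='n]
  have conv: "convol v ?m x = (LINT z|lborel. ?m z * v (x - z))" for x
    using convol_commute[OF v(1) mc] by (simp add: convol_def)
  show "convol v ?m x = convol v ?m y"
  proof (cases "x = y")
    case False
    define d where "d = y - x"
    have d: "d \<noteq> 0" using False by (simp add: d_def)
    let ?\<sigma> = "reflect d 0"
    have "x \<bullet> x = y \<bullet> y" using n by (simp add: dot_square_norm)
    then have xd: "2 * (x \<bullet> d) = - (d \<bullet> d)"
      by (simp add: d_def inner_diff_left inner_diff_right inner_commute)
    have \<sigma>x: "?\<sigma> x = y"
      using d by (simp add: reflect_def xd) (simp add: d_def)
    have lin: "?\<sigma> (a - b) = ?\<sigma> a - ?\<sigma> b" for a b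
      using d by (simp add: reflect_def inner_diff_left algebra_simps diff_divide_distrib)
    have n\<sigma>: "norm (?\<sigma> z) = norm z" for z using norm_reflect[OF d, of 0 z] by simp
    have i: "integrable lborel (\<lambda>z. ?m z * v (y - z))"
    proof (rule integrable_continuous_compact_support[of _ e])
      show "continuous_on UNIV (\<lambda>z. ?m z * v (y - z))"
        by (intro continuous_intros mc continuous_on_compose2[OF v(1)]) auto
    qed (simp add: mollifier(3)[OF e] less_imp_le)
    have "(LINT z|lborel. ?m z * v (y - z)) = (LINT z|lborel. ?m (?\<sigma> z) * v (y - ?\<sigma> z))"
      by (rule integral_reflect(2)[OF d i, symmetric])
    also have "\<dots> = (LINT z|lborel. ?m z * v (x - z))"
    proof (rule Bochner_Integration.integral_cong[OF HOL.refl])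
      fix z
      have "?m (?\<sigma> z) = ?m z" by (rule mollifier(4)[OF e n\<sigma>])
      moreover have "v (y - ?\<sigma> z) = v (x - z)"
      proof -
        have "v (?\<sigma> (x - z)) = v (x - z)"
          using v(2) n\<sigma>[of "x - z"] unfolding radial_def by blast
        then show ?thesis by (simp only: lin \<sigma>x)
      qed
      ultimately show "?m (?\<sigma> z) * v (y - ?\<sigma> z) = ?m z * v (x - z)" by simp
    qed
    finally show ?thesis unfolding conv by simp
  qed simp
qed

lemma integral_lborel_scale:
  fixes f :: "'a::euclidean_space \<Rightarrow> real"
  assumes [measurable]: "f \<in> borel_measurable borel" and c: "c > 0"
  shows "(LINT x|lborel. f (c *\<^sub>R x)) = (LINT x|lborel. f x) / c ^ DIM('a)"
proof -
  have "(LINT x|lborel. f x) = (LINT x|density (distr lborel borel (\<lambda>x::'a. 0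
      + c *\<^sub>R x)) (\<lambda>_. \<bar>c\<bar>^DIM('a)). f x)"
    using lborel_affine[of c "0::'a"] c by simp
  also have "\<dots> = (LINT x|distr lborel borel (\<lambda>x::'a. 0 + c *\<^sub>R x). c ^ DIM('a) *\<^sub>R f x)"
    using c by (subst integral_density) auto
  also have "\<dots> = (LINT x|lborel. c ^ DIM('a) * f (c *\<^sub>R x))"
    by (subst integral_distr) auto
  finally show ?thesis using c by simp
qed

text \<open>Both sides of the inequality scale by the same power of c, so a nearly optimal function
  can be squeezed into any ball.\<close>

lemma dirichlet_hs_integral_scale:
  fixes v :: "real^'n::finite \<Rightarrow> real"
  assumes n3: "CARD('n) \<ge> 3" and p: "p > 2" and v: "C1_on UNIV v" and c: "c > 0"
  defines "w \<equiv> \<lambda>x. v (c *\<^sub>R x)"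
  shows "C1_on UNIV w" "dirichlet w = c powr (2 - real CARD('n)) * dirichlet v"
    "hs_integral p w powr (2 / p) = c powr (2 - real CARD('n)) * hs_integral p v powr (2 / p)"
proof -
  note [measurable] = C1_measurable[OF v]
  have lin: "C1_on UNIV (\<lambda>x::real^'n. c *\<^sub>R x)" by (intro C1_on_scaleR C1_on_const C1_on_ident)
  show "C1_on UNIV w" unfolding w_def by (rule C1_on_compose[OF lin v]) auto
  have gr: "grad w x = c *\<^sub>R grad v (c *\<^sub>R x)" for x
  proof (rule grad_eqI)
    have "((\<lambda>x. c *\<^sub>R x) has_derivative (\<lambda>h. c *\<^sub>R h)) (at x)" by (auto intro!: derivative_eq_intros)
    from has_derivative_compose[OF this C1_on_has_derivative_grad[OF v UNIV_I]]
    show "(w has_derivative (\<bullet>) (c *\<^sub>R grad v (c *\<^sub>R x))) (at x)"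
      unfolding w_def by (rule has_derivative_eq_rhs) (simp add: fun_eq_iff)
  qed
  have cn: "c powr real CARD('n) = c ^ CARD('n)" using c by (simp add: powr_realpow)
  have "dirichlet w = (LINT x|lborel. c\<^sup>2 * (norm (grad v (c *\<^sub>R x)))\<^sup>2)"
    by (simp add: dirichlet_def gr power_mult_distrib)
  also have "\<dots> = c\<^sup>2 * ((LINT x|lborel. (norm (grad v x))\<^sup>2) / c ^ CARD('n))"
    using integral_lborel_scale[of "\<lambda>x. (norm (grad v x))\<^sup>2" c] c by simp
  finally show "dirichlet w = c powr (2 - real CARD('n)) * dirichlet v"
    using c cn by (simp add: dirichlet_def powr_diff powr_numeral)
  let ?e = "hs_exponent TYPE('n) p"
  have "hs_integral p w = (LINT x|lborel. c powr (- ?e) * (norm (c *\<^sub>R x) powr ?e * \<bar>v (c *\<^sub>R x)\<bar> powr p))"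
    unfolding hs_integral_def w_def
  proof (rule Bochner_Integration.integral_cong[OF HOL.refl])
    fix x :: "real^'n"
    have "c powr (- ?e) * norm (c *\<^sub>R x) powr ?e = norm x powr ?e"
      using c by (simp add: powr_mult powr_add[symmetric] flip: mult.assoc)
    then show "norm x powr ?e * \<bar>v (c *\<^sub>R x)\<bar> powr p
        = c powr (- ?e) * (norm (c *\<^sub>R x) powr ?e * \<bar>v (c *\<^sub>R x)\<bar> powr p)"
      by (metis mult.assoc)
  qed
  also have "\<dots> = c powr (- ?e) * (hs_integral p v / c ^ CARD('n))"
    using integral_lborel_scale[of "\<lambda>x. norm x powr ?e * \<bar>v x\<bar> powr p" c] c by (simp add: hs_integral_def)
  also have "\<dots> = c powr (- ?e - real CARD('n)) * hs_integral p v"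
    using c cn by (simp add: powr_diff)
  finally have hw: "hs_integral p w = c powr (- ?e - real CARD('n)) * hs_integral p v" .
  have "hs_integral p v \<ge> 0" unfolding hs_integral_def by (intro Bochner_Integration.integral_nonneg) simp
  then have "hs_integral p w powr (2 / p)
      = (c powr (- ?e - real CARD('n))) powr (2 / p) * hs_integral p v powr (2 / p)"
    unfolding hw by (intro powr_mult)
  moreover have "(- ?e - real CARD('n)) * (2 / p) = 2 - real CARD('n)"
    using p by (simp add: hs_exponent_def field_simps)
  ultimately show "hs_integral p w powr (2 / p) = c powr (2 - real CARD('n)) * hs_integral p v powr (2 / p)"
    by (simp add: powr_powr)
qed

section \<open>The best constant\<close>

lemma dirichlet_nonneg: "dirichlet u \<ge> 0"
  by (simp add: dirichlet_def)

lemma hs_integral_nonneg: "hs_integral p u \<ge> 0"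
  unfolding hs_integral_def by (intro Bochner_Integration.integral_nonneg) simp

lemma best_const_eq:
  "best_const TYPE('n::finite) p
      = Sup {C. \<forall>u \<in> Cc_infinity (UNIV :: (real^'n) set). dirichlet u \<ge> C * hs_integral p u powr (2 / p)}"
  by (simp add: best_const_def dirichlet_def hs_integral_def hs_exponent_def)

text \<open>The quotient of any fixed u bounds all admissible constants, hence also their supremum,
  which is therefore admissible itself.\<close>

lemma best_const_admissible:
  fixes u :: "real^'n::finite \<Rightarrow> real"
  assumes "u \<in> Cc_infinity UNIV"
  shows "best_const TYPE('n) p * hs_integral p u powr (2 / p) \<le> dirichlet u"
proof (cases "hs_integral p u = 0")
  case True
  then show ?thesis by (simp add: dirichlet_nonneg)
next
  case False
  let ?A = "{C. \<forall>u \<in> Cc_infinity (UNIV :: (real^'n) set). dirichlet u \<ge> C * hs_integral p u powr (2 / p)}"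
  have pos: "hs_integral p u powr (2 / p) > 0" using False hs_integral_nonneg[of p u] by simp
  have "best_const TYPE('n) p \<le> dirichlet u / hs_integral p u powr (2 / p)"
    unfolding best_const_eq
  proof (rule cSup_least)
    have "0 \<in> ?A" by (simp add: dirichlet_nonneg)
    then show "?A \<noteq> {}" by blast
    fix C assume "C \<in> ?A"
    then show "C \<le> dirichlet u / hs_integral p u powr (2 / p)"
      using assms pos by (auto simp: le_divide_eq)
  qed
  then show ?thesis using pos by (simp add: le_divide_eq)
qed

context
  fixes p :: real and N :: "'n::finite itself"
  assumes n3: "CARD('n) \<ge> 3" and p: "2 < p" "p \<le> 2 * real CARD('n) / (real CARD('n) - 2)"
begin

lemma tendsto_hs_powr:
  assumes "(f \<longlongrightarrow> l) F" "\<And>j. f j \<ge> (0::real)"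
  shows "((\<lambda>j. f j powr (2 / p)) \<longlongrightarrow> l powr (2 / p)) F"
  by (rule tendsto_powr'[OF assms(1) tendsto_const]) (use p assms(2) in auto)

lemma best_const_admissible_C1:
  fixes u :: "real^'n \<Rightarrow> real"
  assumes u: "C1_on UNIV u" "\<And>x. norm x > R \<Longrightarrow> u x = 0"
  shows "best_const TYPE('n) p * hs_integral p u powr (2 / p) \<le> dirichlet u"
proof -
  obtain f where f: "C1_approx (R + 1) f u" "\<And>j. f j \<in> Cc_infinity UNIV"
    using C1_approx_mollification[of u R "R + 1"] u by (metis less_add_one)
  show ?thesis
  proof (rule LIMSEQ_le)
    show "(\<lambda>j. best_const TYPE('n) p * hs_integral p (f j) powr (2 / p))
        \<longlonglongrightarrow> best_const TYPE('n) p * hs_integral p u powr (2 / p)"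
      by (intro tendsto_intros tendsto_hs_powr C1_approx_hs_integral[OF n3 p f(1)] hs_integral_nonneg)
    show "(\<lambda>j. dirichlet (f j)) \<longlonglongrightarrow> dirichlet u"
      by (rule C1_approx_dirichlet[OF n3 p f(1)])
  qed (use best_const_admissible[OF f(2)] in auto)
qed

text \<open>One test function with a positive weighted integral bounds the admissible constants from
  above, so that constants beyond the supremum are really violated.\<close>

lemma hs_integral_bump_pos: "hs_integral p (bump 1 :: real^'n \<Rightarrow> real) > 0"
proof -
  let ?b = "bump 1 :: real^'n \<Rightarrow> real"
  have c: "continuous_on UNIV ?b" by (rule continuous_on_bump) simp
  have [measurable]: "?b \<in> borel_measurable borel" by (intro borel_measurable_continuous_onI c)
  have z: "?b x = 0" if "norm x > 1" for x using bump_eq_0[of 1 x] that by simp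
  obtain M where M: "\<And>x. norm (?b x) \<le> M"
    using bounded_continuous_compact_support[OF c z] by blast
  have i: "integrable lborel (\<lambda>x. norm x powr hs_exponent TYPE('n) p * \<bar>?b x\<bar> powr p)"
    by (rule hs_integrable[OF n3 p _ _ z, where M = M]) (use M in auto)
  have "hs_integral p ?b \<noteq> 0"
  proof
    assume "hs_integral p ?b = 0"
    then have z: "(LINT x|lborel. norm x powr hs_exponent TYPE('n) p * \<bar>?b x\<bar> powr p) = 0"
      by (simp add: hs_integral_def)
    obtain k :: 'n where True by auto
    \<comment> \<open>The test point lies inside the unit ball, where the bump is positive, and off
      the origin, where the weight is continuous and positive.\<close>
    have nk: "norm (axis k (1/2) :: real^'n) = 1/2" by (simp add: norm_axis)
    then have nz: "axis k (1/2) \<noteq> (0::real^'n)"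
        by (metis norm_zero zero_neq_numeral divide_eq_0_iff one_neq_zero)
    have "continuous_on (- {0}) (\<lambda>x. norm x powr hs_exponent TYPE('n) p * \<bar>?b x\<bar> powr p)"
      using p by (intro continuous_intros continuous_on_subset[OF c] continuous_on_powr') auto
    from continuous_nonneg_integral_eq_0[OF i _ z open_Compl[OF closed_singleton] _ this, of
        "axis k (1/2)"] nz
    have "norm (axis k (1/2) :: real^'n) powr hs_exponent TYPE('n) p * \<bar>?b (axis k (1/2))\<bar> powr p = 0" by simp
    then show False
      using bump_pos[of 1 "axis k (1/2) :: real^'n"] nk by simp
  qed
  then show ?thesis using hs_integral_nonneg[of p ?b] by linarith
qed

lemma best_const_optimal:
  assumes "C > best_const TYPE('n) p"
  obtains u :: "real^'n \<Rightarrow> real" where "u \<in> Cc_infinity UNIV" "dirichlet u < C * hs_integral p u powr (2 / p)"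
proof -
  let ?A = "{C. \<forall>u \<in> Cc_infinity (UNIV :: (real^'n) set). dirichlet u \<ge> C * hs_integral p u powr (2 / p)}"
  let ?b = "bump 1 :: real^'n \<Rightarrow> real"
  have b: "?b \<in> Cc_infinity UNIV" using bump_Cc_infinity[of 1 1] by simp
  have pos: "hs_integral p ?b powr (2 / p) > 0" using hs_integral_bump_pos by simp
  have "bdd_above ?A"
  proof (rule bdd_aboveI)
    fix C assume "C \<in> ?A"
    then show "C \<le> dirichlet ?b / hs_integral p ?b powr (2 / p)"
      using b pos by (auto simp: le_divide_eq)
  qed
  then have "C \<notin> ?A" using assms cSup_upper[of C ?A] unfolding best_const_eq by force
  then show ?thesis using that by (auto simp: not_le)
qed

text \<open>Symmetrization, mollification, removal of a neighbourhood of the origin (a set of capacity zero)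
  and scaling all keep the strict inequality.\<close>

lemma best_const_optimal_radial:
  assumes C: "C > best_const TYPE('n) p" and R0: "R0 > 0"
  obtains v :: "real^'n \<Rightarrow> real" and \<delta> where "C1_on UNIV v" "radial v" "\<delta> > 0"
    "\<And>x. norm x < \<delta> \<Longrightarrow> v x = 0" "\<And>x. norm x > R0 \<Longrightarrow> v x = 0"
    "dirichlet v < C * hs_integral p v powr (2 / p)"
proof -
  obtain u :: "real^'n \<Rightarrow> real" where u: "u \<in> Cc_infinity UNIV"
      "dirichlet u < C * hs_integral p u powr (2 / p)"
    using best_const_optimal[OF C] by blast
  \<comment> \<open>With a positive \<open>C\<close>, enlarging the weighted integral keeps the
    strict inequality.\<close>
  have C0: "C > 0"
  proof (rule ccontr)
    assume "\<not> C > 0"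
    then have "C * hs_integral p u powr (2 / p) \<le> 0" by (intro mult_nonpos_nonneg) auto
    then show False using u(2) dirichlet_nonneg[of u] by linarith
  qed
  note C1u = Cc_infinity_C1_on[OF u(1)]
  obtain R where R: "R > 0" "\<And>x. norm x > R \<Longrightarrow> u x = 0" using Cc_infinity_support[OF u(1)] by blast
  obtain L where L: "L \<ge> 0" "\<And>x y. \<bar>u x - u y\<bar> \<le> L * dist x y" using C1_lipschitz[OF C1u R(2)] by blast
  obtain M where M: "\<And>x. norm (u x) \<le> M"
    using bounded_continuous_compact_support[OF C1_on_imp_continuous_on[OF C1u] R(2)] by blast
  \<comment> \<open>Competitors are nonnegative. Taking absolute values may destroy
    differentiability but does not increase the nonlocal energies.\<close>
  define u0 where "u0 x = \<bar>u x\<bar>" for x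
  have hs0: "hs_integral p u0 = hs_integral p u" by (simp add: hs_integral_def u0_def)
  have nl0: "nonlocal_energy h u0 \<le> nonlocal_energy h u" for h
    unfolding nonlocal_energy_def u0_def
  proof (intro nn_integral_mono ennreal_leI mult_left_mono)
    show "(\<bar>u x\<bar> - \<bar>u y\<bar>)\<^sup>2 \<le> (u x - u y)\<^sup>2" for x y
      by (rule abs_le_square_iff[THEN iffD1]) (rule abs_triangle_ineq3)
  qed simp
  note comp_ctx = n3 p L(1)
  have "competitor u0 p L M R u0"
    unfolding competitor_def[OF comp_ctx]
  proof (intro conjI allI impI)
    show "\<bar>u0 x - u0 y\<bar> \<le> L * dist x y" for x y
      using L(2)[of x y] abs_triangle_ineq3[of "u x" "u y"] by (simp add: u0_def)
  qed (use M R in \<open>auto simp: u0_def\<close>)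
  then obtain w where w: "competitor u0 p L M R w" "radial w"
    using ex_radial_competitor[OF comp_ctx] by blast
  note D = competitorD[OF comp_ctx w(1)]
  have wc: "continuous_on UNIV w" by (rule competitor_continuous[OF comp_ctx w(1)])
  \<comment> \<open>The radial competitor \<open>w\<close> is only Lipschitz. Mollification makes it
    smooth, keeps it radial and does not increase its energies, so its Dirichlet integral can be
    compared with that of \<open>u\<close>.\<close>
  define e where "e j = inverse (real (Suc j))" for j
  have e: "e j > 0" "e j \<le> 1" for j by (auto simp: e_def field_simps)
  have elim: "e \<longlonglongrightarrow> 0" unfolding e_def by (rule LIMSEQ_inverse_real_of_nat)
  define f where "f j = convol w (mollifier (e j))" for j
  have fCc: "f j \<in> Cc_infinity UNIV" for j
    unfolding f_def by (rule convol_mollifier_Cc_infinity[OF e(1) wc D(4)]) auto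
  have fs: "f j x = 0" if "norm x > R + 1" for j x
    unfolding f_def using e[of j] that by (intro convol_mollifier_support[OF e(1) wc D(4)]) auto
  have fr: "radial (f j)" for j unfolding f_def by (rule radial_convol_mollifier[OF e(1) wc w(2)])
  have fd: "dirichlet (f j) \<le> dirichlet u" for j
  proof (rule dirichlet_mono_nonlocal[OF C1u R(2) Cc_infinity_C1_on[OF fCc] fs])
    fix h :: real assume "h > 0"
    have "nonlocal_energy h (f j) \<le> nonlocal_energy h w"
      unfolding f_def by (rule nonlocal_energy_convol[OF e(1) wc])
    also have "\<dots> \<le> nonlocal_energy h u0" by (rule D(5))
    also have "\<dots> \<le> nonlocal_energy h u" by (rule nl0)
    finally show "nonlocal_energy h (f j) \<le> nonlocal_energy h u" .
  qed
  have fM: "\<bar>f j x\<bar> \<le> M" for j x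
    using convol_mollifier_bound[OF e(1) wc, where c = 0 and M = M] D(1,2) by (simp add: f_def)
  have [measurable]: "f j \<in> borel_measurable borel" "w \<in> borel_measurable borel" for j
    using C1_measurable(1)[OF Cc_infinity_C1_on[OF fCc]] wc by (auto intro: borel_measurable_continuous_onI)
  have flim: "(\<lambda>j. f j x) \<longlonglongrightarrow> w x" for x
    unfolding f_def by (rule convol_mollifier_tendsto[OF wc e(1) elim])
  have "(\<lambda>j. hs_integral p (f j)) \<longlonglongrightarrow> hs_integral p w"
    unfolding hs_integral_def
  proof (rule norm_powr_dominated_convergence(3)[where \<beta> = "- hs_exponent TYPE('n) p" and R =
      "R + 1" and C = "M powr p"])
    show "0 \<le> - hs_exponent TYPE('n) p" "- hs_exponent TYPE('n) p < CARD('n)"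
      using hs_exponent_bounds[OF n3 p] by auto
    show "\<bar>norm x powr hs_exponent TYPE('n) p * \<bar>f j x\<bar> powr p\<bar>
        \<le> M powr p * norm x powr (- (- hs_exponent TYPE('n) p))" for j x
    proof -
      have "\<bar>f j x\<bar> powr p \<le> M powr p" using fM[of j x] p by (intro powr_mono2) auto
      from mult_right_mono[OF this, of "norm x powr hs_exponent TYPE('n) p"]
      show ?thesis by (simp add: abs_mult mult.commute)
    qed
    show "norm x powr hs_exponent TYPE('n) p * \<bar>f j x\<bar> powr p = 0" if "norm x > R + 1" for j x
      using fs[OF that] by simp
    show "(\<lambda>j. norm x powr hs_exponent TYPE('n) p * \<bar>f j x\<bar> powr p)
        \<longlonglongrightarrow> norm x powr hs_exponent TYPE('n) p * \<bar>w x\<bar> powr p" for x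
      by (intro tendsto_intros tendsto_powr' flim) (use p in auto)
  qed measurable
  then have lim: "(\<lambda>j. C * hs_integral p (f j) powr (2 / p)) \<longlonglongrightarrow> C * hs_integral p w powr (2 / p)"
    by (intro tendsto_intros tendsto_hs_powr hs_integral_nonneg)
  have "dirichlet u < C * hs_integral p w powr (2 / p)"
  proof -
    have "hs_integral p u powr (2 / p) \<le> hs_integral p w powr (2 / p)"
      using D(6) p hs_integral_nonneg[of p u] by (intro powr_mono2) (auto simp: hs0)
    then have "C * hs_integral p u powr (2 / p) \<le> C * hs_integral p w powr (2 / p)"
      using C0 by (intro mult_left_mono) auto
    then show ?thesis using u(2) by linarith
  qed
  \<comment> \<open>Only the weighted integrals have to converge here, since all Dirichlet integrals
    of \<open>f j\<close> stay below that of \<open>u\<close>.\<close>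
  from eventually_happens[OF order_tendstoD(1)[OF lim this]]
  obtain j where j: "dirichlet u < C * hs_integral p (f j) powr (2 / p)" by auto
  have fj: "dirichlet (f j) < C * hs_integral p (f j) powr (2 / p)" using fd[of j] j by linarith
  note C1f = Cc_infinity_C1_on[OF fCc[of j]]
  obtain g where co: "C1_approx (R + 1) g (f j)" "\<And>i. \<exists>\<delta>>0. \<forall>x. norm x < \<delta> \<longrightarrow> g i x = 0"
    "\<And>i. radial (f j) \<Longrightarrow> radial (g i)"
    by (rule C1_approx_cutoff[OF C1f fs]) blast+
  have "(\<lambda>i. C * hs_integral p (g i) powr (2 / p) - dirichlet (g i))
      \<longlonglongrightarrow> C * hs_integral p (f j) powr (2 / p) - dirichlet (f j)"
    by (intro tendsto_intros tendsto_hs_powr C1_approx_hs_integral[OF n3 p co(1)] C1_approx_dirichlet[OF n3 p co(1)] hs_integral_nonneg)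
  from eventually_happens[OF order_tendstoD(1)[OF this, of 0]] fj
  obtain i where i: "dirichlet (g i) < C * hs_integral p (g i) powr (2 / p)" by auto
  obtain \<delta> where \<delta>: "\<delta> > 0" "\<And>x. norm x < \<delta> \<Longrightarrow> g i x = 0" using co(2)[of i] by blast
  have gC1: "C1_on UNIV (g i)" and gs: "\<And>x. norm x > R + 1 \<Longrightarrow> g i x = 0"
    using co(1) by (auto simp: C1_approx_def)
  \<comment> \<open>The dilation factor that shrinks the support radius \<open>R + 1\<close> to
    \<open>R0\<close>.\<close>
  define c where "c = (R + 1) / R0"
  have c: "c > 0" using R(1) R0 by (simp add: c_def)
  note sc = dirichlet_hs_integral_scale[OF n3 p(1) gC1 c]
  show ?thesis
  proof (rule that[OF sc(1)])
    show "radial (\<lambda>x. g i (c *\<^sub>R x))"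
      using co(3)[OF fr, of i] by (auto simp: radial_def)
    show "\<delta> / c > 0" using \<delta>(1) c by simp
    show "g i (c *\<^sub>R x) = 0" if "norm x < \<delta> / c" for x
      by (rule \<delta>(2)) (use that c in \<open>simp add: field_simps\<close>)
    show "g i (c *\<^sub>R x) = 0" if "norm x > R0" for x
    proof (rule gs)
      have "(R + 1) / R0 * R0 < c * norm x" unfolding c_def using that R(1) R0
          by (intro mult_strict_left_mono) auto
      then show "norm (c *\<^sub>R x) > R + 1" using R0 c by simp
    qed
    have "c powr (2 - real CARD('n)) * dirichlet (g i) < c powr (2 - real CARD('n)) * (C * hs_integral p (g i) powr (2 / p))"
      using i c by (intro mult_strict_left_mono) auto
    then show "dirichlet (\<lambda>x. g i (c *\<^sub>R x)) < C * hs_integral p (\<lambda>x. g i (c *\<^sub>R x)) powr (2 / p)"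
      unfolding sc(2,3) by (simp add: mult_ac)
  qed
qed

end

section \<open>The Hardy--Sobolev inequality\<close>

theorem theorem5:
  fixes n :: nat and p \<theta> \<alpha> K :: real
  assumes "n = CARD('n::finite)" and "n \<ge> 3"
    and "2 < p" and "p \<le> 2 * real n / (real n - 2)"
    and "0 \<le> \<theta>" and "\<theta> < 1 / 2"
    and "0 < \<alpha>" and "\<alpha> \<le> exp ((real n - 3) / (real n - 2))"
    and "K = ((1 - 2 * \<theta>) / (real n - 2)) powr ((p + 2) / p) * best_const TYPE('n) p"
  shows "(\<forall>u \<in> Cc_infinity (ball (0 :: real^'n) 1).
            hardy_remainder \<theta> \<alpha> u \<ge> K * weighted_p_integral p \<alpha> u powr (2 / p))
       \<and> (\<forall>C > K. \<not> (\<forall>u \<in> Cc_infinity (ball (0 :: real^'n) 1).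
            hardy_remainder \<theta> \<alpha> u \<ge> C * weighted_p_integral p \<alpha> u powr (2 / p)))"
proof -
  define k where "k = real CARD('n) - 2"
  define a where "a = (1 - 2 * \<theta>) / k"
  have n3: "CARD('n) \<ge> 3" and p: "2 < p" "p \<le> 2 * real CARD('n) / (real CARD('n) - 2)" using assms by auto
  have k: "k > 0" using n3 by (simp add: k_def)
  \<comment> \<open>Since \<open>(n - 3) / (n - 2) = 1 - 1 / k\<close>, the bound on \<alpha> is the
    condition \<open>1 / k \<le> 1 - ln \<alpha>\<close> of the locale.\<close>
  have "ln \<alpha> \<le> (real n - 3) / (real n - 2)"
    using assms(7,8) by (metis exp_gt_zero ln_exp ln_le_cancel_iff)
  also have "(real n - 3) / (real n - 2) = 1 - 1 / k"
    using k assms(1) by (simp add: k_def field_simps)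
  finally have \<alpha>: "1 / k \<le> 1 - ln \<alpha>" by simp
  interpret ground_state k \<theta> \<alpha> a
    by unfold_locales (use k \<alpha> assms in \<open>auto simp: a_def\<close>)
  have kn: "real CARD('n) = k + 2" by (simp add: k_def)
  let ?S = "best_const TYPE('n) p"
  have K: "K = a powr ((p + 2) / p) * ?S" using assms(1,9) by (simp add: a_def k_def)
  have ap: "a powr ((p + 2) / p) = a * a powr (2 / p)"
  proof -
    have "(p + 2) / p = 1 + 2 / p" using p by (simp add: field_simps)
    then show ?thesis using a(1) by (simp add: powr_add)
  qed
  have wn: "weighted_p_integral p \<alpha> u \<ge> 0" for u :: "real^'n \<Rightarrow> real"
    unfolding weighted_p_integral_def set_lebesgue_integral_def
        by (intro Bochner_Integration.integral_nonneg) auto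
  have hs_w: "a * hs_integral p U powr (2 / p)
      = a powr ((p + 2) / p) * weighted_p_integral p \<alpha> (transf U) powr (2 / p)"
    if "a * weighted_p_integral p \<alpha> (transf U) = hs_integral p U" for U :: "real^'n \<Rightarrow> real"
    unfolding that[symmetric] using a(1) wn[of "transf U"] by (simp add: powr_mult ap)
  note twp = tendsto_hs_powr[OF n3 p _ wn]
  show ?thesis
  proof (intro conjI ballI allI impI)
    fix u :: "real^'n \<Rightarrow> real" assume u: "u \<in> Cc_infinity (ball 0 1)"
    obtain R where R: "0 < R" "R < 1" "\<And>x. norm x > R \<Longrightarrow> u x = 0"
      using Cc_infinity_ball_support[OF u] by blast
    \<comment> \<open>The transformation reaches only functions vanishing near the origin, so the
      inequality is shown for cut-off functions and passed to the limit.\<close>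
    obtain f where co: "C1_approx R f u" "\<And>j. \<exists>\<delta>>0. \<forall>x. norm x < \<delta> \<longrightarrow> f j x = 0"
      by (rule C1_approx_cutoff[OF Cc_infinity_C1_on[OF u] R(3)]) blast+
    note lim = C1_approx_remainders(1,2)[OF n3 p co(1) \<alpha>(1) ln_\<alpha>]
    have "K * weighted_p_integral p \<alpha> (f j) powr (2 / p) \<le> hardy_remainder \<theta> \<alpha> (f j)" for j
    proof -
      have C1: "C1_on UNIV (f j)" and s: "\<And>x. norm x > R \<Longrightarrow> f j x = 0"
        using co(1) by (auto simp: C1_approx_def)
      obtain \<delta> where \<delta>: "\<delta> > 0" "\<And>x. norm x < \<delta> \<Longrightarrow> f j x = 0" using co(2)[of j] by blast
      obtain U R' \<delta>' where U: "C1_on UNIV U" "\<And>y. norm y < \<delta>' \<Longrightarrow> U y = 0" "\<And>y. norm y > R' \<Longrightarrow> U y = 0"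
        "R' < \<phi> 1" "\<delta>' > 0" "transf U = f j"
        using transf_surj[of "f j" \<delta> R] C1 \<delta> s R(2) by metis
      have "K * weighted_p_integral p \<alpha> (f j) powr (2 / p) = a * (?S * hs_integral p U powr (2 / p))"
        using hs_w[OF weighted_p_integral_transf[OF kn n3 U(1-5) p]] unfolding K U(6) by (simp add: mult_ac)
      also have "\<dots> \<le> a * dirichlet U"
        using best_const_admissible_C1[OF n3 p U(1,3)] a(1) by (intro mult_left_mono) auto
      also have "\<dots> \<le> hardy_remainder \<theta> \<alpha> (f j)"
        using hardy_remainder_transf_ge[OF kn n3 U(1-5)] by (simp add: U(6))
      finally show ?thesis .
    qed
    then show "K * weighted_p_integral p \<alpha> u powr (2 / p) \<le> hardy_remainder \<theta> \<alpha> u"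
      by (intro LIMSEQ_le[OF tendsto_mult[OF tendsto_const twp[OF lim(2)]] lim(1)]) auto
  next
    fix C assume C: "C > K"
    \<comment> \<open>Dividing out the factor from the substitution turns \<open>C > K\<close> into
      a constant above the best one on the whole space.\<close>
    define C' where "C' = C / a powr ((p + 2) / p)"
    have apos: "a powr ((p + 2) / p) > 0" using a(1) by simp
    have "C' > ?S" using C apos by (simp add: C'_def K less_divide_eq mult.commute)
    \<comment> \<open>The support radius is taken strictly below \<open>\<phi> 1\<close>, so that
      the radial function lies in the domain of the transformation.\<close>
    moreover have "\<phi> 1 / 2 > 0" using \<phi>_pos[of 1] by simp
    ultimately obtain v :: "real^'n \<Rightarrow> real" and \<delta> where v: "C1_on UNIV v" "radial v" "\<delta> > 0"
      "\<And>x. norm x < \<delta> \<Longrightarrow> v x = 0" "\<And>x. norm x > \<phi> 1 / 2 \<Longrightarrow> v x = 0"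
      "dirichlet v < C' * hs_integral p v powr (2 / p)"
      using best_const_optimal_radial[OF n3 p] by metis
    have R': "\<phi> 1 / 2 < \<phi> 1" using \<phi>_pos[of 1] by simp
    note tr = v(1,4,5) R' v(3)
    define u where "u = transf v"
    have "hardy_remainder \<theta> \<alpha> u = a * dirichlet v"
      unfolding u_def using v(1,2)
          by (intro hardy_remainder_transf_eq[OF kn n3 tr] grad_radial) (auto simp: C1_on_def)
    also have "\<dots> < a * (C' * hs_integral p v powr (2 / p))"
      using v(6) a(1) by (intro mult_strict_left_mono) auto
    also have "\<dots> = C' * (a * hs_integral p v powr (2 / p))" by (simp add: mult_ac)
    also have "\<dots> = C * weighted_p_integral p \<alpha> u powr (2 / p)"
    proof -
      have "a * hs_integral p v powr (2 / p) = a powr ((p + 2) / p) * weighted_p_integral p \<alpha> u powr (2 / p)"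
        unfolding u_def by (rule hs_w[OF weighted_p_integral_transf[OF kn n3 tr p]])
      then show ?thesis using apos by (simp add: C'_def)
    qed
    finally have less: "hardy_remainder \<theta> \<alpha> u < C * weighted_p_integral p \<alpha> u powr (2 / p)" .
    obtain R1 where R1: "R1 < 1" "\<And>x. norm x > R1 \<Longrightarrow> u x = 0"
      using transf_support[OF kn n3 tr] unfolding u_def by metis
    have C1u: "C1_on UNIV u" unfolding u_def by (rule C1_transf[OF kn n3 tr])
    \<comment> \<open>The transformed function is only \<open>C^1\<close>; mollifying it within the
      gap between \<open>R1\<close> and the unit sphere gives test functions in the ball.\<close>
    have "R1 < (R1 + 1) / 2" "cball 0 ((R1 + 1) / 2) \<subseteq> ball (0::real^'n) 1" using R1(1) by auto
    then obtain f where f: "C1_approx ((R1 + 1) / 2) f u" "\<And>j. f j \<in> Cc_infinity (ball 0 1)"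
      using C1_approx_mollification[of u R1 "(R1 + 1) / 2"] C1u R1(2) by metis
    note lim = C1_approx_remainders(1,2)[OF n3 p f(1) \<alpha>(1) ln_\<alpha>]
    have "(\<lambda>j. C * weighted_p_integral p \<alpha> (f j) powr (2 / p) - hardy_remainder \<theta> \<alpha> (f j)) \<longlonglongrightarrow>
       C * weighted_p_integral p \<alpha> u powr (2 / p) - hardy_remainder \<theta> \<alpha> u"
      by (intro tendsto_intros twp lim)
    from eventually_happens[OF order_tendstoD(1)[OF this, of 0]] less
    obtain j where "hardy_remainder \<theta> \<alpha> (f j) < C * weighted_p_integral p \<alpha> (f j) powr (2 / p)" by auto
    moreover have "f j \<in> Cc_infinity (ball 0 1)" by (rule f(2))
    ultimately show "\<not> (\<forall>u \<in> Cc_infinity (ball (0 :: real^'n) 1).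
            hardy_remainder \<theta> \<alpha> u \<ge> C * weighted_p_integral p \<alpha> u powr (2 / p))"
      by (meson not_le)
  qed
qed

end
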